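(* Let $L$ be an integral unimodular lattice of rank $n$ with no vectors of norm $1$, and suppose that $L$ is not an even lattice of rank $16$. Let $N_2$ be the number of vectors of norm $2$ in $L$. Then $$N_2\equiv 2n(23-n) \pmod{2^{25-n}},$$ i.e. $N_2-2n(23-n)$ is an integer multiple of $2^{25-n}$.
   Context: An integral unimodular lattice $L\subset\mathbb{R}^n$ is a lattice of rank $n$ with $(v,w)\in\mathbb{Z}$ for all $v,w\in L$ and equal to its own dual lattice under the standard inner product $(\cdot,\cdot)$ of $\mathbb{R}^n$. The norm of a vector $v$ is $(v,v)$. The lattice $L$ is even if all its vectors have even norm; the even unimodular lattices of rank $16$ are $E_8\oplus E_8$ and $D_{16}^+$. For $n>25$ the modulus $2^{25-n}$ is a fraction and the congruence means that the difference is an integer multiple of it. *)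

theory Defs
  imports "HOL-Analysis.Analysis"
begin

definition lattice_of_rank :: "nat \<Rightarrow> 'a::real_vector set \<Rightarrow> bool" where
  "lattice_of_rank r L \<longleftrightarrow>
     (\<exists>B. finite B \<and> card B = r \<and> independent B \<and>
          L = {(\<Sum>b\<in>B. real_of_int (c b) *\<^sub>R b) | c. True})"

(* This is the dual in the usual sense when L spans the whole space;
   it is only used for lattices of full rank. *)
definition dual_lattice :: "'a::real_inner set \<Rightarrow> 'a set" where
  "dual_lattice L = {v. \<forall>w\<in>L. v \<bullet> w \<in> \<int>}"

definition integral_unimodular_lattice :: "(real ^ 'n::finite) set \<Rightarrow> bool" where
  "integral_unimodular_lattice L \<longleftrightarrow>
     lattice_of_rank CARD('n) L \<and> (\<forall>v\<in>L. \<forall>w\<in>L. v \<bullet> w \<in> \<int>) \<and> dual_lattice L = L"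

(* The norm of a lattice vector v is the inner product of v with itself,
   not its Euclidean length. *)
definition even_lattice :: "'a::real_inner set \<Rightarrow> bool" where
  "even_lattice L \<longleftrightarrow> (\<forall>v\<in>L. \<exists>k::int. even k \<and> v \<bullet> v = real_of_int k)"

definition vectors_of_norm :: "'a::real_inner set \<Rightarrow> real \<Rightarrow> 'a set" where
  "vectors_of_norm L m = {v \<in> L. v \<bullet> v = m}"

end

theory Submission
  imports Defs "HOL-Complex_Analysis.Complex_Analysis" "HOL-Probability.Probability"
begin

text \<open>
Only ranks \<open>n \<le> 23\<close> carry content: for \<open>n = 24\<close> the claim is that the number of vectors of norm 2 is
even, and beyond that the modulus divides 1. For \<open>n \<le> 23\<close> an exact formula holds
(\<open>root_count_formula\<close>). Let \<open>u\<close> be a characteristic vector of \<open>L\<close>, that is \<open>v \<bullet> v\<close> and \<open>v \<bullet> u\<close> have the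
same parity for all lattice vectors \<open>v\<close>. Then the number of vectors of norm 2 minus \<open>2 n (23 - n)\<close>
equals \<open>2 ^ (24 - n)\<close> times the number of vectors of norm \<open>(n - 16) / 4\<close> in the coset of \<open>L\<close> through
\<open>u / 2\<close>. This coset is stable under negation, and it contains a vector of norm zero only if \<open>L\<close> is even.
Since the norm in question is zero exactly for \<open>n = 16\<close>, the number of such vectors is even outside
the excluded case, which gives the missing factor 2.

The formula is a residue theorem. The theta function of \<open>L\<close> has weight \<open>n / 2\<close> for the theta group,
which is generated by \<open>\<tau> + 2\<close> and \<open>- 1 / \<tau>\<close> and has the two cusps infinity and 1; at the cusp 1 it
becomes the theta function of the coset. Multiplied by a suitable product of powers of Jacobi theta
functions it becomes a form of weight two without poles in the upper half-plane, and the constant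
terms of such a form at the two cusps cancel (\<open>theta_group_residues\<close>). At infinity the constant term is
the left side of the formula up to a power of 2, at the cusp 1 it is the right side.

This needs three facts. The transformation under \<open>- 1 / \<tau>\<close> (\<open>theta_char_inversion\<close>) comes from Poisson
summation for Gaussians, proved by induction along a lattice basis (\<open>gaussian_poisson_lattice\<close>). The
Jacobi theta functions have no zeros (\<open>\<theta>\<^sub>3_nonzero\<close>), which follows from a doubling identity. And
\<open>u \<bullet> u\<close> is congruent to \<open>n\<close> modulo 8 (\<open>characteristic_norm_cong\<close>), which for \<open>n \<le> 23\<close> excludes vectors in
the coset of norm below \<open>(n - 16) / 4\<close>.
\<close>

section \<open>Poisson summation on the line\<close>

text \<open>The kernels \<open>cos (pi (x - y)) ^ (2 N)\<close> are trigonometric polynomials, so their integrals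
against \<open>g\<close> vanish. As \<open>N\<close> grows they concentrate at \<open>y\<close>: away from \<open>y\<close> they are bounded by the \<open>N\<close>-th power
of a number that is smaller than their values near \<open>y\<close>. Hence their weighted average of \<open>g\<close>, which is
zero, tends to \<open>g y\<close>.\<close>
lemma fourier_coefficients_determine:
  fixes g :: "real \<Rightarrow> complex"
  assumes cont: "continuous_on {0..1} g"
    and zero: "\<And>k::int. integral {0..1} (\<lambda>x. g x * cis (2 * pi * of_int k * x)) = 0"
    and x: "x \<in> {0..1}"
  shows "g x = 0"
proof -
  have main: "g y = 0" if y: "y \<in> {0<..<1}" for y
  proof -
    \<comment> \<open>The endpoints follow by continuity; an interior \<open>y\<close> keeps the peak of the kernel inside the interval.\<close>
    define p where "p = (\<lambda>x. (cos (pi * (x - y)))\<^sup>2)"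
    have p_exp: "complex_of_real (p x) =
        (2 + cis (2 * pi * x) * cis (-(2 * pi * y)) + cis (-(2 * pi * x)) * cis (2 * pi * y)) / 4" for x
    proof -
      have "p x = (1 + cos (2 * pi * x - 2 * pi * y)) / 2"
        using cos_double_cos[of "pi * (x - y)"] by (simp add: p_def algebra_simps)
      then show ?thesis
        by (simp add: complex_eq_iff cis_mult cos_diff sin_diff)
    qed
    have contp: "continuous_on A p" for A
      unfolding p_def by (intro continuous_intros)
    have p01: "0 \<le> p x" "p x \<le> 1" for x
      by (auto simp: p_def abs_square_le_1)
    have int: "(\<lambda>x. g x * h x) integrable_on {0..1}" if "continuous_on {0..1} h" for h
      by (intro integrable_continuous_interval continuous_intros cont that)
    have pN: "integral {0..1} (\<lambda>x. g x * (cis (2 * pi * of_int k * x) * complex_of_real (p x) ^ N)) = 0"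
      for N and k :: int
    proof (induction N arbitrary: k)
      case 0
      then show ?case using zero by simp
    next
      case (Suc N)
      let ?f = "\<lambda>k x. g x * (cis (2 * pi * of_int k * x) * complex_of_real (p x) ^ N)"
      have fint: "?f j integrable_on {0..1}" for j :: int
        by (rule int) (intro continuous_intros contp)
      have f0: "(?f j has_integral 0) {0..1}" for j :: int
        using integrable_integral[OF fint[of j]] by (simp only: Suc.IH)
      have cc: "cis (2 * pi * of_int k * x) * cis (2 * pi * x) = cis (2 * pi * of_int (k + 1) * x)"
        "cis (2 * pi * of_int k * x) * cis (-(2 * pi * x)) = cis (2 * pi * of_int (k - 1) * x)" for x
        by (simp_all add: cis_mult algebra_simps)
      have eq: "g x * (cis (2 * pi * of_int k * x) * complex_of_real (p x) ^ Suc N) =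
          1/2 * ?f k x + cis (-(2 * pi * y)) / 4 * ?f (k+1) x + cis (2 * pi * y) / 4 * ?f (k-1) x" for x
        unfolding power_Suc p_exp[of x] cc[symmetric] by (simp add: field_simps)
      have "((\<lambda>x. 1/2 * ?f k x + cis (-(2 * pi * y)) / 4 * ?f (k+1) x + cis (2 * pi * y) / 4 * ?f (k-1) x)
          has_integral (1/2 * 0 + cis (-(2 * pi * y)) / 4 * 0 + cis (2 * pi * y) / 4 * 0)) {0..1}"
        by (intro has_integral_add has_integral_mult_right f0)
      then show ?case
        unfolding eq by (simp add: integral_unique)
    qed
    have pN0: "integral {0..1} (\<lambda>x. g x * complex_of_real (p x) ^ N) = 0" for N
      using pN[of 0 N] by simp
    obtain C where C: "\<And>x. x \<in> {0..1} \<Longrightarrow> norm (g x) \<le> C" "C > 0"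
    proof -
      have "bounded (g ` {0..1})"
        by (intro compact_imp_bounded compact_continuous_image cont) auto
      then obtain b where "b > 0" "\<forall>x\<in>{0..1}. norm (g x) \<le> b"
        by (auto simp: bounded_pos)
      then show ?thesis using that[of b] by blast
    qed
    have "norm (g y) \<le> e" if e: "e > 0" for e
    proof -
      have "y \<in> {0..1}" using y by simp
      then obtain d0 where d0: "d0 > 0" "\<And>x. x \<in> {0..1} \<Longrightarrow> dist x y < d0 \<Longrightarrow> dist (g x) (g y) < e"
        using cont e unfolding continuous_on_iff by blast
      define d where "d = min (d0/2) (min y (1 - y))"
      have d: "d > 0" "d < d0" "d \<le> y" "d \<le> 1 - y" "d \<le> 1/2"
        using d0 y by (auto simp: d_def min_def)
      \<comment> \<open>\<open>r\<close> bounds the squared cosine at distance at least \<open>d\<close>, \<open>\<rho>\<close> bounds it from below at distance at most \<open>d / 2\<close>.\<close>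
      define r where "r = (cos (pi * d))\<^sup>2"
      define \<rho> where "\<rho> = (cos (pi * (d / 2)))\<^sup>2"
      have pid: "0 < pi * d" "pi * d \<le> pi / 2"
        using d by (auto simp: mult_left_mono)
      have "- (pi / 2) < pi * (d / 2)" "pi * (d / 2) < pi / 2" "- (pi / 2) \<le> pi * d"
        using pid pi_gt_zero by linarith+
      then have cpos: "0 < cos (pi * (d/2))" "0 \<le> cos (pi * d)"
        using pid cos_gt_zero_pi cos_ge_zero by (simp_all only:)
      have clt: "cos (pi * d) < cos (pi * (d/2))"
        by (rule cos_monotone_0_pi) (use d in auto)
      have r: "0 \<le> r" "r < \<rho>" "0 < \<rho>"
        using cpos clt by (auto simp: r_def \<rho>_def intro!: power_strict_mono)
      have near: "p x \<ge> \<rho>" if "\<bar>x - y\<bar> \<le> d / 2" for x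
      proof -
        have "cos (pi * (d/2)) \<le> cos (pi * \<bar>x - y\<bar>)"
          by (rule cos_monotone_0_pi_le) (use that d in \<open>auto simp: mult_left_mono\<close>)
        moreover have "cos (pi * \<bar>x - y\<bar>) = cos (pi * (x - y))"
          using cos_abs_real[of "pi * (x - y)"] by (simp add: abs_mult)
        ultimately show ?thesis
          unfolding \<rho>_def p_def using cpos by (intro power_mono) auto
      qed
      have far: "p x \<le> r" if "\<bar>x - y\<bar> \<ge> d" "x \<in> {0..1}" for x
      proof -
        have le: "\<bar>x - y\<bar> \<le> 1 - d" using that d y by (auto simp: abs_if)
        have c1: "cos (pi * \<bar>x - y\<bar>) \<le> cos (pi * d)"
          by (rule cos_monotone_0_pi_le) (use that le d in \<open>auto simp: mult_left_mono\<close>)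
        have "cos (pi * (1 - d)) \<le> cos (pi * \<bar>x - y\<bar>)"
          by (rule cos_monotone_0_pi_le) (use that le d in \<open>auto simp: mult_left_mono\<close>)
        then have c2: "- cos (pi * d) \<le> cos (pi * \<bar>x - y\<bar>)"
          by (simp add: algebra_simps cos_diff)
        have "cos (pi * \<bar>x - y\<bar>) = cos (pi * (x - y))"
          using cos_abs_real[of "pi * (x - y)"] by (simp add: abs_mult)
        then have "\<bar>cos (pi * (x - y))\<bar> \<le> \<bar>cos (pi * d)\<bar>"
          using c1 c2 by linarith
        then show ?thesis unfolding p_def r_def by (subst abs_le_square_iff[symmetric])
      qed
      have bound: "norm (g y) * (d * \<rho> ^ N) \<le> e * integral {0..1} (\<lambda>x. p x ^ N) + 2 * C * r ^ N
          \<and> d * \<rho> ^ N \<le> integral {0..1} (\<lambda>x. p x ^ N)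
          \<and> norm (g y) * integral {0..1} (\<lambda>x. p x ^ N) \<le> e * integral {0..1} (\<lambda>x. p x ^ N) + 2 * C * r ^ N" for N
      proof -
        let ?M = "integral {0..1} (\<lambda>x. p x ^ N)"
        have pint: "(\<lambda>x. p x ^ N) integrable_on {a..b}" for a b
          by (intro integrable_continuous_interval continuous_intros contp)
        have "d * \<rho> ^ N = integral {y - d/2..y + d/2} (\<lambda>x. \<rho> ^ N)"
          using d by simp
        also have "\<dots> \<le> integral {y - d/2..y + d/2} (\<lambda>x. p x ^ N)"
          by (rule integral_le) (use near r pint in \<open>auto simp: abs_if intro!: power_mono\<close>)
        also have "\<dots> \<le> ?M"
          by (rule integral_subset_le) (use d pint p01 in auto)
        finally have 1: "d * \<rho> ^ N \<le> ?M" .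
        have hi: "((\<lambda>x. g y * complex_of_real (p x ^ N)) has_integral g y * complex_of_real ?M) {0..1}"
          by (intro has_integral_mult_right has_integral_of_real integrable_integral pint)
        have hi0: "((\<lambda>x. g x * complex_of_real (p x) ^ N) has_integral 0) {0..1}"
        proof -
          have "continuous_on {0..1} (\<lambda>x. complex_of_real (p x) ^ N)"
            by (intro continuous_intros contp)
          from integrable_integral[OF int[OF this]] show ?thesis by (simp only: pN0)
        qed
        have hi2: "((\<lambda>x. (g y - g x) * complex_of_real (p x ^ N)) has_integral g y * complex_of_real ?M) {0..1}"
          using has_integral_diff[OF hi hi0] by (simp add: algebra_simps)
        have rhs: "((\<lambda>x. e * p x ^ N + 2 * C * r ^ N) has_integral e * ?M + 2 * C * r ^ N) {0..1}"
          using has_integral_add[OF has_integral_mult_right[OF integrable_integral[OF pint, of 0 1], of e]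
              has_integral_const_real[of "2 * C * r ^ N" 0 1]] by simp
        have "norm (integral {0..1} (\<lambda>x. (g y - g x) * complex_of_real (p x ^ N)))
            \<le> integral {0..1} (\<lambda>x. e * p x ^ N + 2 * C * r ^ N)"
        proof (rule integral_norm_bound_integral)
          show "(\<lambda>x. (g y - g x) * complex_of_real (p x ^ N)) integrable_on {0..1}"
            using hi2 by blast
          show "(\<lambda>x. e * p x ^ N + 2 * C * r ^ N) integrable_on {0..1}"
            using rhs by blast
          fix x :: real assume x: "x \<in> {0..1}"
          show "norm ((g y - g x) * complex_of_real (p x ^ N)) \<le> e * p x ^ N + 2 * C * r ^ N"
          proof (cases "\<bar>x - y\<bar> < d")
            case True
            then have "norm (g y - g x) \<le> e"
              using d0(2)[OF x] d by (simp add: dist_norm norm_minus_commute less_imp_le)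
            then have "norm (g y - g x) * p x ^ N \<le> e * p x ^ N"
              by (intro mult_right_mono) (use p01 in auto)
            moreover have "0 \<le> 2 * C * r ^ N" using C r by simp
            ultimately show ?thesis using p01[of x] by (simp add: norm_mult norm_power)
          next
            case False
            have "norm (g y - g x) \<le> 2 * C"
              using norm_triangle_ineq4[of "g y" "g x"] C(1)[of x] C(1)[of y] x y by auto
            moreover have "p x ^ N \<le> r ^ N"
              using far[of x] False x p01 by (intro power_mono) auto
            ultimately have "norm (g y - g x) * p x ^ N \<le> 2 * C * r ^ N"
              by (intro mult_mono) (use p01 C in auto)
            moreover have "0 \<le> e * p x ^ N" using e p01 by simp
            ultimately show ?thesis using p01[of x] by (simp add: norm_mult norm_power)
          qed
        qed
        then have 2: "norm (g y * complex_of_real ?M) \<le> e * ?M + 2 * C * r ^ N"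
          using hi2 rhs by (simp add: integral_unique)
        have M0: "0 \<le> ?M" by (rule integral_nonneg) (use pint p01 in auto)
        have 3: "norm (g y) * ?M \<le> e * ?M + 2 * C * r ^ N"
          using 2 M0 by (simp add: norm_mult)
        have "norm (g y) * (d * \<rho> ^ N) \<le> norm (g y) * ?M"
          using 1 by (intro mult_left_mono) auto
        then show ?thesis using 1 3 by linarith
      qed
      have "norm (g y) \<le> e + 2 * C / d * (r / \<rho>) ^ N" for N
      proof -
        let ?M = "integral {0..1} (\<lambda>x. p x ^ N)"
        have Mp: "?M > 0" using bound[of N] d r by (smt (verit) mult_pos_pos zero_less_power)
        have "norm (g y) \<le> e + 2 * C * r ^ N / ?M"
          using bound[of N] Mp by (simp add: field_simps)
        also have "2 * C * r ^ N / ?M \<le> 2 * C * r ^ N / (d * \<rho> ^ N)"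
          using bound[of N] C r d Mp by (intro divide_left_mono) auto
        also have "\<dots> = 2 * C / d * (r / \<rho>) ^ N" by (simp add: power_divide)
        finally show ?thesis by simp
      qed
      moreover have "(\<lambda>N. e + 2 * C / d * (r / \<rho>) ^ N) \<longlonglongrightarrow> e + 2 * C / d * 0"
        by (intro tendsto_intros LIMSEQ_realpow_zero) (use r in auto)
      ultimately show "norm (g y) \<le> e"
        by (intro LIMSEQ_le_const) auto
    qed
    then have "norm (g y) \<le> 0" using field_le_epsilon[of "norm (g y)" 0] by simp
    then show "g y = 0" by simp
  qed
  have cl: "closure {0<..<1} = {0..1::real}"
    by simp
  show ?thesis
    using continuous_constant_on_closure[of "{0<..<1}" g 0 x] main x cont unfolding cl by blast
qed

lemma filterlim_symmetric_int_intervals: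
  "filterlim (\<lambda>N. {- int N..<int N}) (finite_subsets_at_top UNIV) sequentially"
  unfolding filterlim_def le_filter_def eventually_filtermap eventually_finite_subsets_at_top
proof (intro allI impI, elim exE conjE)
  fix P and X :: "int set"
  assume X: "finite X" and P: "\<forall>Y. finite Y \<and> X \<subseteq> Y \<and> Y \<subseteq> UNIV \<longrightarrow> P Y"
  have b: "\<bar>x\<bar> \<le> Max (abs ` X)" if "x \<in> X" for x
    using X that by simp
  define b where "b = Max (abs ` X)"
  have "\<forall>\<^sub>F N in sequentially. int N > b"
    by (rule eventually_at_top_linorderI[of "nat b + 1"]) linarith
  then show "\<forall>\<^sub>F N in sequentially. P {- int N..<int N}"
  proof eventually_elim
    case (elim N)
    then have "X \<subseteq> {- int N..<int N}" using b unfolding b_def by force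
    then show ?case using P by blast
  qed
qed

lemma integral_cis_int:
  "((\<lambda>x. cis (2 * pi * of_int j * x)) has_integral (if j = 0 then 1 else 0)) {0..1}"
proof (cases "j = 0")
  case True
  then show ?thesis using has_integral_const_real[of "1::complex" 0 1] by simp
next
  case False
  let ?c = "2 * pi * of_int j :: real"
  have "((\<lambda>x. cis (?c * x)) has_integral (cis (?c * 1) / (\<i> * ?c) - cis (?c * 0) / (\<i> * ?c))) {0..1}"
  proof (rule fundamental_theorem_of_calculus)
    fix x :: real
    have "((\<lambda>z. exp (\<i> * ?c * z) / (\<i> * ?c)) has_field_derivative exp (\<i> * ?c * of_real x)) (at (of_real x))"
      using False by (auto intro!: derivative_eq_intros)
    from has_vector_derivative_real_field[OF this]
    show "((\<lambda>x. cis (?c * x) / (\<i> * ?c)) has_vector_derivative cis (?c * x)) (at x within {0..1})"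
      by (simp add: cis_conv_exp mult_ac)
  qed simp
  then show ?thesis using False cis_multiple_2pi[of "of_int j"] by simp
qed

text \<open>The periodization of \<open>f\<close> and the Fourier series with coefficients \<open>fhat\<close> are continuous functions on
the circle with equal Fourier coefficients, hence they agree; the claim is their value at 0. The
hypotheses on \<open>M\<close> and \<open>fhat\<close> are what makes both series converge uniformly.\<close>
lemma poisson_summation:
  fixes f :: "real \<Rightarrow> complex" and fhat :: "int \<Rightarrow> complex" and M :: "int \<Rightarrow> real"
  assumes cont: "continuous_on UNIV f"
    and int: "integrable lborel f"
    and fhat: "\<And>k. fhat k = (LINT u|lborel. f u * cis (- (2 * pi * of_int k * u)))"
    and M: "\<And>m x. x \<in> {0..1} \<Longrightarrow> norm (f (of_int m + x)) \<le> M m" "M summable_on UNIV"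
    and sum: "(\<lambda>k. norm (fhat k)) summable_on UNIV"
  shows "(\<Sum>\<^sub>\<infinity>m. f (of_int m)) = (\<Sum>\<^sub>\<infinity>k. fhat k)"
proof -
  define F where "F = (\<lambda>x. \<Sum>\<^sub>\<infinity>m. f (of_int m + x))"
  define G where "G = (\<lambda>x. \<Sum>\<^sub>\<infinity>k. fhat k * cis (2 * pi * of_int k * x))"
  have uF: "uniform_limit {0..1} (\<lambda>X x. \<Sum>m\<in>X. f (of_int m + x)) F (finite_subsets_at_top UNIV)"
    unfolding F_def by (rule Weierstrass_m_test_general) (use M in auto)
  have uG: "uniform_limit {0..1} (\<lambda>X x. \<Sum>k\<in>X. fhat k * cis (2 * pi * of_int k * x)) G (finite_subsets_at_top UNIV)"
    unfolding G_def by (rule Weierstrass_m_test_general[where M = "\<lambda>k. norm (fhat k)"]) 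
      (use sum in \<open>auto simp: norm_mult\<close>)
  have contf: "continuous_on A (\<lambda>x. f (c + x))" for A c
    by (rule continuous_on_compose2[OF cont]) (auto intro!: continuous_intros)
  have cF: "continuous_on {0..1} F"
    by (rule uniform_limit_theorem[OF _ uF]) (auto intro!: always_eventually continuous_intros contf)
  have cG: "continuous_on {0..1} G"
    by (rule uniform_limit_theorem[OF _ uG]) (auto intro!: always_eventually continuous_intros)
  have bcis: "bounded ((\<lambda>x. cis (c * x)) ` A)" for c :: real and A
    by (rule boundedI[where B = 1]) auto
  have coF: "((\<lambda>x. F x * cis (- (2 * pi * of_int k * x))) has_integral fhat k) {0..1}" for k
  proof -
    let ?e = "\<lambda>x. cis (- (2 * pi * of_int k * x))"
    let ?h = "\<lambda>u. f u * ?e u"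
    have per: "?e (of_int m + x) = ?e x" for m :: int and x
    proof -
      have "?e (of_int m + x) = cis (2 * pi * of_int (- k * m)) * ?e x"
        by (simp add: cis_mult algebra_simps)
      then show ?thesis using cis_multiple_2pi[of "of_int (- k * m)"] by simp
    qed
    have ul: "uniform_limit {0..1} (\<lambda>X x. (\<Sum>m\<in>X. f (of_int m + x)) * ?e x) (\<lambda>x. F x * ?e x) (finite_subsets_at_top UNIV)"
    proof (rule uniform_lim_mult[OF uF uniform_limit_const])
      show "bounded (F ` {0..1})"
        by (intro compact_imp_bounded compact_continuous_image cF) auto
      show "bounded (?e ` {0..1})"
        using bcis[of "- (2 * pi * of_int k)"] by simp
    qed
    obtain I J where IJ: "\<And>X. ((\<lambda>x. (\<Sum>m\<in>X. f (of_int m + x)) * ?e x) has_integral I X) {0..1}"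
       "((\<lambda>x. F x * ?e x) has_integral J) {0..1}" "(I \<longlongrightarrow> J) (finite_subsets_at_top UNIV)"
      by (rule uniform_limit_integral[OF ul]) (auto intro!: continuous_intros contf)
    have lim1: "(\<lambda>N. I {- int N..<int N}) \<longlonglongrightarrow> J"
      by (rule filterlim_compose[OF IJ(3) filterlim_symmetric_int_intervals])
    have conth: "continuous_on A ?h" for A
      by (intro continuous_intros continuous_on_subset[OF cont]) auto
    have hint: "?h integrable_on {a..b}" for a b
      by (intro integrable_continuous_interval conth)
    have Im: "((\<lambda>x. f (of_int m + x) * ?e x) has_integral integral {of_int m..of_int m + 1} ?h) {0..1}" for m :: int
    proof -
      have "(?h has_integral integral {of_int m..of_int m + 1} ?h) {of_int m..of_int m + 1}"
        by (intro integrable_integral hint)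
      from has_integral_affinity'[where m = 1 and c = "of_int m", OF this[unfolded interval_cbox]]
      have "((\<lambda>x. ?h (of_int m + x)) has_integral integral {of_int m..of_int m + 1} ?h) {0..1}"
        by (simp add: add.commute)
      then show ?thesis by (simp only: per)
    qed
    have IN: "I {- int N..<int N} = integral {- real N..real N} ?h" for N
    proof -
      have 1: "((\<lambda>x. (\<Sum>m\<in>{- int N..<int N}. f (of_int m + x)) * ?e x) has_integral
          (\<Sum>m\<in>{- int N..<int N}. integral {of_int m..of_int m + 1} ?h)) {0..1}"
        unfolding sum_distrib_right by (intro has_integral_sum Im) auto
      have 2: "(\<Sum>m\<in>{- int N..<int N}. integral {of_int m..of_int m + 1} ?h) = integral {- real N..real N} ?h" for N
      proof (induction N)
        case 0
        then show ?case by simp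
      next
        case (Suc N)
        have "{- int (Suc N)..<int (Suc N)} = insert (- int (Suc N)) (insert (int N) {- int N..<int N})"
          by auto
        then have "(\<Sum>m\<in>{- int (Suc N)..<int (Suc N)}. integral {of_int m..of_int m + 1} ?h)
           = integral {- real (Suc N)..- real (Suc N) + 1} ?h + (integral {real N..real N + 1} ?h
            + integral {- real N..real N} ?h)"
          using Suc by (simp add: algebra_simps)
        also have "integral {real N..real N + 1} ?h + integral {- real N..real N} ?h
            = integral {- real N..real N + 1} ?h"
          using Henstock_Kurzweil_Integration.integral_combine[of "- real N" "real N" "real N + 1" ?h] hint by (simp add: add.commute)
        also have "integral {- real (Suc N)..- real (Suc N) + 1} ?h + \<dots> = integral {- real (Suc N)..real (Suc N)} ?h"
          using Henstock_Kurzweil_Integration.integral_combine[of "- real (Suc N)" "- real N" "real N + 1" ?h] hint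
          by (simp add: add.commute)
        finally show ?case .
      qed
      show ?thesis using has_integral_unique[OF IJ(1) 1] 2 by simp
    qed
    have inth: "integrable lborel ?h"
    proof (rule Bochner_Integration.integrable_bound[OF int])
      show "?h \<in> borel_measurable lborel"
        using conth by (simp add: borel_measurable_continuous_onI)
    qed (simp add: norm_mult)
    have lim2: "(\<lambda>N. LINT u|lborel. indicator {- real N..real N} u *\<^sub>R ?h u) \<longlonglongrightarrow> (LINT u|lborel. ?h u)"
    proof (rule integral_dominated_convergence[where w = "\<lambda>u. norm (?h u)"])
      show "?h \<in> borel_measurable lborel" using inth by (rule borel_measurable_integrable)
      show "(\<lambda>u. indicator {- real N..real N} u *\<^sub>R ?h u) \<in> borel_measurable lborel" for N
        by (intro borel_measurable_scaleR) (use inth in auto)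
      show "integrable lborel (\<lambda>u. norm (?h u))" using inth by (rule integrable_norm)
      show "AE u in lborel. (\<lambda>N. indicator {- real N..real N} u *\<^sub>R ?h u) \<longlonglongrightarrow> ?h u"
      proof (rule AE_I2)
        fix u :: real
        obtain N0 where N0: "\<bar>u\<bar> \<le> real N0" using real_arch_simple by blast
        show "(\<lambda>N. indicator {- real N..real N} u *\<^sub>R ?h u) \<longlonglongrightarrow> ?h u"
        proof (rule tendsto_eventually, rule eventually_at_top_linorderI[of N0])
          fix N :: nat assume "N0 \<le> N"
          then have "\<bar>u\<bar> \<le> real N" using N0 by linarith
          then have "u \<in> {- real N..real N}" by auto
          then show "indicator {- real N..real N} u *\<^sub>R ?h u = ?h u" by simp
        qed
      qed
      show "AE u in lborel. norm (indicator {- real N..real N} u *\<^sub>R ?h u) \<le> norm (?h u)" for N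
        by (auto simp: indicator_def)
    qed
    have "integral {- real N..real N} ?h = (LINT u|lborel. indicator {- real N..real N} u *\<^sub>R ?h u)" for N :: nat
    proof -
      have "set_integrable lborel {- real N..real N} ?h"
        unfolding set_integrable_def by (rule integrable_mult_indicator[OF _ inth]) simp
      from set_borel_integral_eq_integral(2)[OF this, symmetric] show ?thesis
        unfolding set_lebesgue_integral_def .
    qed
    then have "(\<lambda>N. I {- int N..<int N}) \<longlonglongrightarrow> fhat k"
      using lim2 by (simp add: IN fhat)
    then have "J = fhat k" using lim1 LIMSEQ_unique by blast
    then show ?thesis using IJ(2) by simp
  qed
  have coG: "((\<lambda>x. G x * cis (- (2 * pi * of_int k * x))) has_integral fhat k) {0..1}" for k
  proof -
    let ?e = "\<lambda>x. cis (- (2 * pi * of_int k * x))"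
    have ul: "uniform_limit {0..1} (\<lambda>X x. (\<Sum>m\<in>X. fhat m * cis (2 * pi * of_int m * x)) * ?e x) (\<lambda>x. G x * ?e x) (finite_subsets_at_top UNIV)"
    proof (rule uniform_lim_mult[OF uG uniform_limit_const])
      show "bounded (G ` {0..1})"
        by (intro compact_imp_bounded compact_continuous_image cG) auto
      show "bounded (?e ` {0..1})"
        using bcis[of "- (2 * pi * of_int k)"] by simp
    qed
    obtain I J where IJ: "\<And>X. ((\<lambda>x. (\<Sum>m\<in>X. fhat m * cis (2 * pi * of_int m * x)) * ?e x) has_integral I X) {0..1}"
       "((\<lambda>x. G x * ?e x) has_integral J) {0..1}" "(I \<longlongrightarrow> J) (finite_subsets_at_top UNIV)"
      by (rule uniform_limit_integral[OF ul]) (auto intro!: continuous_intros)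
    have Im: "((\<lambda>x. fhat m * cis (2 * pi * of_int m * x) * ?e x) has_integral (if m = k then fhat k else 0)) {0..1}" for m :: int
      using has_integral_mult_right[OF integral_cis_int[of "m - k"], of "fhat m"]
      by (auto simp: cis_mult algebra_simps split: if_splits)
    have "((\<lambda>x. (\<Sum>m\<in>X. fhat m * cis (2 * pi * of_int m * x)) * ?e x) has_integral
          (\<Sum>m\<in>X. if m = k then fhat k else 0)) {0..1}" if "finite X" for X
      unfolding sum_distrib_right by (intro has_integral_sum Im that)
    then have IX: "I X = fhat k" if "finite X" "{k} \<subseteq> X" for X
      using that has_integral_unique[OF IJ(1)] by fastforce
    have "\<forall>\<^sub>F X in finite_subsets_at_top UNIV. finite X \<and> {k} \<subseteq> X"
      unfolding eventually_finite_subsets_at_top by (rule exI[of _ "{k}"]) auto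
    then have "\<forall>\<^sub>F X in finite_subsets_at_top UNIV. I X = fhat k"
      by eventually_elim (use IX in blast)
    then have "J = fhat k"
      using IJ(3) tendsto_eventually tendsto_unique finite_subsets_at_top_neq_bot by metis
    then show ?thesis using IJ(2) by simp
  qed
  have "F 0 - G 0 = 0"
  proof (rule fourier_coefficients_determine[where g = "\<lambda>x. F x - G x"])
    show "continuous_on {0..1} (\<lambda>x. F x - G x)"
      by (intro continuous_intros cF cG)
    fix k :: int
    show "integral {0..1} (\<lambda>x. (F x - G x) * cis (2 * pi * of_int k * x)) = 0"
      using has_integral_diff[OF coF[of "-k"] coG[of "-k"]]
      by (simp add: algebra_simps integral_unique)
  qed auto
  then show ?thesis by (simp add: F_def G_def)
qed

section \<open>Gaussian sums over lattices\<close>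

lemma infsum_of_real:
  "(\<Sum>\<^sub>\<infinity>x\<in>A. of_real (f x) :: complex) = of_real (\<Sum>\<^sub>\<infinity>x\<in>A. f x)"
proof (cases "f summable_on A")
  case True
  then show ?thesis by (intro infsumI has_sum_of_real) simp
next
  case False
  then have "\<not> (\<lambda>x. of_real (f x) :: complex) summable_on A"
    using summable_on_Re by fastforce
  then show ?thesis using False by (simp add: infsum_not_exists)
qed

lemma gaussian_fourier_transform:
  assumes "s > 0"
  shows "(LINT u|lborel. complex_of_real (exp (- (pi * s * u\<^sup>2))) * cis (- (2 * pi * \<xi> * u))) =
    complex_of_real (exp (- (pi * \<xi>\<^sup>2 / s)) / sqrt s)"
proof -
  define c where "c = sqrt (2 * pi * s)"
  have c: "c > 0" "c\<^sup>2 = 2 * pi * s" using assms by (auto simp: c_def)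
  define t where "t = - (2 * pi * \<xi> / c)"
  have "complex_of_real (exp (- (t\<^sup>2) / 2)) = (LINT x|density lborel std_normal_density. iexp (t * x))"
    using char_std_normal_distribution unfolding char_def fun_eq_iff by metis
  also have "\<dots> = (LINT x|lborel. std_normal_density x *\<^sub>R iexp (t * x))"
    by (rule integral_density) auto
  also have "\<dots> = \<bar>c\<bar> *\<^sub>R (LINT u|lborel. std_normal_density (0 + c * u) *\<^sub>R iexp (t * (0 + c * u)))"
    by (rule lborel_integral_real_affine) (use c in auto)
  also have "(\<lambda>u. std_normal_density (0 + c * u) *\<^sub>R iexp (t * (0 + c * u))) =
     (\<lambda>u. complex_of_real (1 / sqrt (2 * pi)) * (complex_of_real (exp (- (pi * s * u\<^sup>2))) * cis (- (2 * pi * \<xi> * u))))"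
  proof
    fix u
    have 1: "std_normal_density (c * u) = 1 / sqrt (2 * pi) * exp (- (pi * s * u\<^sup>2))"
      by (simp add: std_normal_density_def power_mult_distrib c)
    have 2: "t * (c * u) = - (2 * pi * \<xi> * u)" using c by (simp add: t_def)
    show "std_normal_density (0 + c * u) *\<^sub>R iexp (t * (0 + c * u)) =
      complex_of_real (1 / sqrt (2 * pi)) * (complex_of_real (exp (- (pi * s * u\<^sup>2))) * cis (- (2 * pi * \<xi> * u)))"
      by (simp only: add_0 1 2 cis_conv_exp scaleR_conv_of_real of_real_mult mult.assoc)
  qed
  also have "(LINT u|lborel. complex_of_real (1 / sqrt (2 * pi)) * (complex_of_real (exp (- (pi * s * u\<^sup>2))) * cis (- (2 * pi * \<xi> * u))))
    = complex_of_real (1 / sqrt (2 * pi)) * (LINT u|lborel. complex_of_real (exp (- (pi * s * u\<^sup>2))) * cis (- (2 * pi * \<xi> * u)))"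
    by (rule integral_mult_right_zero)
  finally have *: "complex_of_real (exp (- (t\<^sup>2) / 2)) = complex_of_real (c / sqrt (2 * pi)) *
     (LINT u|lborel. complex_of_real (exp (- (pi * s * u\<^sup>2))) * cis (- (2 * pi * \<xi> * u)))"
    using c by (simp add: scaleR_conv_of_real)
  have "c / sqrt (2 * pi) = sqrt s"
    using assms by (simp add: c_def real_sqrt_mult)
  moreover have "- (t\<^sup>2) / 2 = - (pi * \<xi>\<^sup>2 / s)"
    using assms unfolding t_def power2_minus power_divide c(2)
    by (simp add: power_mult_distrib field_simps power2_eq_square)
  ultimately have eq: "complex_of_real (exp (- (pi * \<xi>\<^sup>2 / s))) = complex_of_real (sqrt s) *
     (LINT u|lborel. complex_of_real (exp (- (pi * s * u\<^sup>2))) * cis (- (2 * pi * \<xi> * u)))"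
    using * by (simp only:)
  show ?thesis unfolding of_real_divide eq using assms by simp
qed

lemma gaussian_integrable:
  assumes "s > 0"
  shows "integrable lborel (\<lambda>u::real. exp (- (pi * s * u\<^sup>2)))"
proof -
  define c where "c = sqrt (2 * pi * s)"
  have c: "c \<noteq> 0" "c\<^sup>2 = 2 * pi * s" using assms by (auto simp: c_def)
  have "integrable lborel (\<lambda>u. std_normal_density u)"
    by (rule integrable_normal_density) simp
  then have "integrable lborel (\<lambda>u. std_normal_density (0 + c * u))"
    by (rule lborel_integrable_real_affine) (use c in simp)
  then have "integrable lborel (\<lambda>u. sqrt (2 * pi) * std_normal_density (0 + c * u))"
    by (rule integrable_mult_right)
  also have "(\<lambda>u. sqrt (2 * pi) * std_normal_density (0 + c * u)) = (\<lambda>u::real. exp (- (pi * s * u\<^sup>2)))"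
    by (auto simp: std_normal_density_def power_mult_distrib c)
  finally show ?thesis .
qed

lemma summable_exp_abs_int:
  assumes "c > 0"
  shows "(\<lambda>m::int. exp (- (c * \<bar>of_int m\<bar>)) :: real) summable_on UNIV"
proof -
  let ?f = "\<lambda>m::int. exp (- (c * \<bar>of_int m\<bar>)) :: real"
  have nat: "(\<lambda>n::nat. exp (- (c * real n))) summable_on UNIV"
  proof (rule summable_nonneg_imp_summable_on)
    have "(\<lambda>n::nat. exp (- (c * real n))) = (\<lambda>n. exp (- c) ^ n)"
      by (simp add: exp_of_nat_mult[symmetric] mult.commute)
    then show "summable (\<lambda>n::nat. exp (- (c * real n)))"
      using assms by (simp add: summable_geometric)
  qed simp
  have "?f summable_on range int"
    by (subst summable_on_reindex) (use nat in \<open>auto simp: o_def\<close>)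
  moreover have "?f summable_on range (\<lambda>n. - int n)"
    by (subst summable_on_reindex) (use nat in \<open>auto simp: o_def inj_def\<close>)
  ultimately have "?f summable_on (range int \<union> range (\<lambda>n. - int n))"
    by (rule summable_on_union)
  also have "range int \<union> range (\<lambda>n. - int n) = UNIV"
    by (auto, metis int_cases2 rangeI)
  finally show ?thesis .
qed

lemma gaussian_le_exp_abs:
  fixes m x s :: real
  assumes "s > 0"
  shows "exp (- (pi * s * (m + x)\<^sup>2)) \<le> exp (pi * s * (1 + 2 * \<bar>x\<bar>)) * exp (- (2 * pi * s * \<bar>m\<bar>))"
proof -
  have "0 \<le> (\<bar>m + x\<bar> - 1)\<^sup>2" by simp
  then have "(m + x)\<^sup>2 \<ge> 2 * \<bar>m + x\<bar> - 1" by (simp add: power2_diff)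
  moreover have "2 * \<bar>m\<bar> - 2 * \<bar>x\<bar> - 1 \<le> 2 * \<bar>m + x\<bar> - 1"
    using abs_triangle_ineq[of "m + x" "- x"] by simp
  ultimately have "2 * \<bar>m\<bar> - 2 * \<bar>x\<bar> - 1 \<le> (m + x)\<^sup>2" by (rule order_trans[rotated])
  then have "pi * s * (2 * \<bar>m\<bar> - 2 * \<bar>x\<bar> - 1) \<le> pi * s * (m + x)\<^sup>2"
    using assms by (intro mult_left_mono) auto
  then show ?thesis by (simp add: exp_add[symmetric] algebra_simps)
qed

lemma gaussian_summable_int:
  assumes "s > 0"
  shows "(\<lambda>m::int. exp (- (pi * s * (of_int m + x)\<^sup>2)) :: real) summable_on UNIV"
proof (rule summable_on_comparison_test)
  show "(\<lambda>m::int. exp (pi * s * (1 + 2 * \<bar>x\<bar>)) * exp (- (2 * pi * s * \<bar>of_int m\<bar>)) :: real) summable_on UNIV"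
    using summable_exp_abs_int[of "2 * pi * s"] assms by (intro summable_on_cmult_right) auto
qed (use gaussian_le_exp_abs[OF assms] in auto)

text \<open>Both a shift \<open>x\<close> and a character \<open>y\<close> are needed: in the induction over a lattice basis the new
basis vector contributes a shift along its component orthogonal to the old span and a character from
its component inside.\<close>
lemma gaussian_poisson_1d:
  assumes s: "s > 0"
  shows "(\<Sum>\<^sub>\<infinity>m::int. complex_of_real (exp (- (pi * s * (of_int m + x)\<^sup>2))) * cis (2 * pi * (of_int m * y))) =
    1 / sqrt s * (\<Sum>\<^sub>\<infinity>k::int. complex_of_real (exp (- (pi * (of_int k - y)\<^sup>2 / s))) * cis (2 * pi * (x * (of_int k - y))))"
proof -
  define f where "f = (\<lambda>u::real. complex_of_real (exp (- (pi * s * (u + x)\<^sup>2))) * cis (2 * pi * (u * y)))"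
  define fhat where "fhat = (\<lambda>k::int. 1 / sqrt s * (complex_of_real (exp (- (pi * (of_int k - y)\<^sup>2 / s))) * cis (2 * pi * (x * (of_int k - y)))))"
  have "(\<Sum>\<^sub>\<infinity>m. f (of_int m)) = (\<Sum>\<^sub>\<infinity>k. fhat k)"
  proof (rule poisson_summation)
    show "continuous_on UNIV f" unfolding f_def by (intro continuous_intros)
    then have meas: "f \<in> borel_measurable lborel" by (simp add: borel_measurable_continuous_onI)
    have "integrable lborel (\<lambda>u::real. exp (- (pi * s * (x + 1 * u)\<^sup>2)))"
      by (rule lborel_integrable_real_affine[OF gaussian_integrable[OF s]]) simp
    then show "integrable lborel f"
      by (rule Bochner_Integration.integrable_bound[OF _ meas]) (simp add: f_def norm_mult add.commute)
    show "norm (f (of_int m + t)) \<le> exp (pi * s * (3 + 2 * \<bar>x\<bar>)) * exp (- (2 * pi * s * \<bar>of_int m\<bar>))"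
      if "t \<in> {0..1}" for m :: int and t
    proof -
      have "norm (f (of_int m + t)) = exp (- (pi * s * (of_int m + (t + x))\<^sup>2))"
        by (simp add: f_def norm_mult add.assoc)
      also have "\<dots> \<le> exp (pi * s * (1 + 2 * \<bar>t + x\<bar>)) * exp (- (2 * pi * s * \<bar>of_int m\<bar>))"
        by (rule gaussian_le_exp_abs[OF s])
      also have "exp (pi * s * (1 + 2 * \<bar>t + x\<bar>)) \<le> exp (pi * s * (3 + 2 * \<bar>x\<bar>))"
        using that s by (simp add: abs_if)
      finally show ?thesis by simp
    qed
    show "(\<lambda>m::int. exp (pi * s * (3 + 2 * \<bar>x\<bar>)) * exp (- (2 * pi * s * \<bar>of_int m\<bar>))) summable_on UNIV"
      using summable_exp_abs_int[of "2 * pi * s"] s by (intro summable_on_cmult_right) auto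
    have "(\<lambda>k. norm (fhat k)) = (\<lambda>k. 1 / sqrt s * exp (- (pi * (1/s) * (of_int k + (- y))\<^sup>2)))"
      using s by (simp add: fhat_def norm_mult norm_divide fun_eq_iff)
    then show "(\<lambda>k. norm (fhat k)) summable_on UNIV"
      using gaussian_summable_int[of "1/s" "-y"] s by (simp only:) (rule summable_on_cmult_right, simp)
    fix k :: int
    let ?g = "\<lambda>u. complex_of_real (exp (- (pi * s * u\<^sup>2))) * cis (- (2 * pi * (of_int k - y) * u))"
    have "(LINT u|lborel. f u * cis (- (2 * pi * of_int k * u))) =
        (LINT u|lborel. cis (2 * pi * (x * (of_int k - y))) * ?g (x + 1 * u))"
    proof (rule Bochner_Integration.integral_cong[OF refl])
      fix u
      have "cis (2 * pi * (u * y)) * cis (- (2 * pi * of_int k * u)) =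
          cis (2 * pi * (x * (of_int k - y))) * cis (- (2 * pi * (of_int k - y) * (x + 1 * u)))"
        by (simp add: cis_mult algebra_simps)
      then show "f u * cis (- (2 * pi * of_int k * u)) = cis (2 * pi * (x * (of_int k - y))) * ?g (x + 1 * u)"
        unfolding f_def by (simp add: mult_ac add.commute)
    qed
    also have "\<dots> = cis (2 * pi * (x * (of_int k - y))) * (LINT u|lborel. ?g (x + 1 * u))"
      by (rule integral_mult_right_zero)
    also have "(LINT u|lborel. ?g (x + 1 * u)) = (LINT u|lborel. ?g u)"
      using lborel_integral_real_affine[of 1 ?g x] by simp
    also have "\<dots> = complex_of_real (exp (- (pi * (of_int k - y)\<^sup>2 / s)) / sqrt s)"
      by (rule gaussian_fourier_transform[OF s])
    finally show "fhat k = (LINT u|lborel. f u * cis (- (2 * pi * of_int k * u)))"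
      by (simp add: fhat_def)
  qed
  then show ?thesis
    by (simp only: f_def fhat_def infsum_cmult_right')
qed

text \<open>Poisson summation turns the shift \<open>y\<close> into phases of modulus one, which gives a bound that is
uniform in \<open>y\<close>.\<close>
lemma gaussian_sum_bound:
  assumes s: "s > 0"
  shows "(\<Sum>\<^sub>\<infinity>k::int. exp (- (pi * (of_int k - y)\<^sup>2 / s))) \<le> sqrt s * (\<Sum>\<^sub>\<infinity>m::int. exp (- (pi * s * (of_int m)\<^sup>2)))"
proof -
  let ?S = "\<Sum>\<^sub>\<infinity>k::int. exp (- (pi * (of_int k - y)\<^sup>2 / s))"
  have "complex_of_real ?S = (\<Sum>\<^sub>\<infinity>k::int. complex_of_real (exp (- (pi * (of_int k - y)\<^sup>2 / s))))"
    by (rule infsum_of_real[symmetric])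
  also have "\<dots> = sqrt s * (\<Sum>\<^sub>\<infinity>m::int. complex_of_real (exp (- (pi * s * (of_int m + 0)\<^sup>2))) * cis (2 * pi * (of_int m * y)))"
    unfolding gaussian_poisson_1d[OF s] using s by simp
  finally have *: "norm (complex_of_real ?S) = norm \<dots>"
    by (rule arg_cong)
  have "0 \<le> ?S" by (rule infsum_nonneg) simp
  then have "?S = norm (complex_of_real ?S)" unfolding norm_of_real by simp
  also have "\<dots> = norm (sqrt s * (\<Sum>\<^sub>\<infinity>m::int. complex_of_real (exp (- (pi * s * (of_int m + 0)\<^sup>2))) * cis (2 * pi * (of_int m * y))))"
    by (rule *)
  also have "\<dots> \<le> sqrt s * (\<Sum>\<^sub>\<infinity>m::int. norm (complex_of_real (exp (- (pi * s * (of_int m + 0)\<^sup>2))) * cis (2 * pi * (of_int m * y))))"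
    unfolding norm_mult[of "complex_of_real (sqrt s)"]
    by (intro mult_mono norm_infsum_bound) (use s gaussian_summable_int[OF s, of 0] in \<open>auto simp: norm_mult\<close>)
  finally show ?thesis by (simp add: norm_mult)
qed

definition int_span :: "'a::real_vector set \<Rightarrow> 'a set" where
  "int_span B = {(\<Sum>b\<in>B. real_of_int (c b) *\<^sub>R b) | c. True}"

text \<open>The dual of the lattice spanned by \<open>B\<close> inside the real span of \<open>B\<close>, so that it is again a lattice
when \<open>B\<close> does not span the whole space.\<close>
definition span_dual :: "'a::real_inner set \<Rightarrow> 'a set" where
  "span_dual B = {w \<in> span B. \<forall>b\<in>B. w \<bullet> b \<in> \<int>}"

lemma int_span_empty [simp]: "int_span {} = {0}"
  by (simp add: int_span_def)

lemma int_span_subset_span: "int_span B \<subseteq> span B"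
proof
  fix v assume "v \<in> int_span B"
  then obtain c where v: "v = (\<Sum>b\<in>B. real_of_int (c b) *\<^sub>R b)"
    by (auto simp: int_span_def)
  show "v \<in> span B"
    unfolding v by (intro span_sum span_scale span_base)
qed

lemma int_span_superset:
  assumes "finite B"
  shows "B \<subseteq> int_span B"
proof
  fix b assume b: "b \<in> B"
  have "(\<Sum>a\<in>B. real_of_int (if a = b then 1 else 0) *\<^sub>R a) = (\<Sum>a\<in>B. if a = b then a else 0)"
    by (rule sum.cong) auto
  also have "\<dots> = b" using assms b by simp
  finally have "b = (\<Sum>a\<in>B. real_of_int (if a = b then 1 else 0) *\<^sub>R a)" ..
  then show "b \<in> int_span B"
    unfolding int_span_def mem_Collect_eq by (intro exI[of _ "\<lambda>a. if a = b then 1 else 0"] conjI TrueI)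
qed

lemma int_span_insert:
  assumes "finite B" "b \<notin> B"
  shows "int_span (insert b B) = (\<lambda>(m, v). v + real_of_int m *\<^sub>R b) ` (UNIV \<times> int_span B)"
proof (intro equalityI subsetI)
  fix x assume "x \<in> int_span (insert b B)"
  then obtain c where "x = (\<Sum>a\<in>B. real_of_int (c a) *\<^sub>R a) + real_of_int (c b) *\<^sub>R b"
    using assms by (auto simp: int_span_def add.commute)
  then show "x \<in> (\<lambda>(m, v). v + real_of_int m *\<^sub>R b) ` (UNIV \<times> int_span B)"
    by (auto simp: int_span_def image_iff)
next
  fix x assume "x \<in> (\<lambda>(m, v). v + real_of_int m *\<^sub>R b) ` (UNIV \<times> int_span B)"
  then obtain c m where x: "x = (\<Sum>a\<in>B. real_of_int (c a) *\<^sub>R a) + real_of_int m *\<^sub>R b"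
    by (auto simp: int_span_def)
  have "(\<Sum>a\<in>B. real_of_int (c a) *\<^sub>R a) = (\<Sum>a\<in>B. real_of_int ((c(b := m)) a) *\<^sub>R a)"
    by (rule sum.cong) (use assms in auto)
  then have "x = (\<Sum>a\<in>insert b B. real_of_int ((c(b := m)) a) *\<^sub>R a)"
    using assms x by (simp add: add.commute)
  then show "x \<in> int_span (insert b B)" unfolding int_span_def by blast
qed

text \<open>Poisson summation for Gaussians on a lattice, by induction on a basis. Write the new basis vector
as \<open>b = p + q\<close> with \<open>p\<close> in the old span and \<open>q\<close> orthogonal to it. For a fixed multiple \<open>m\<close> of \<open>b\<close> the
induction hypothesis applies to the shift by \<open>m p\<close>; the remaining sum over \<open>m\<close> is one-dimensional, with
the character \<open>w \<bullet> p\<close> that depends on the dual vector \<open>w\<close>. The pair of \<open>w\<close> and the dual integer \<open>k\<close>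
corresponds to the vector \<open>w + ((k - w \<bullet> p) / h) q\<close> of the larger dual lattice, where \<open>h = q \<bullet> q\<close>;
its inner product with \<open>b\<close> is \<open>k\<close>.

The constant \<open>V\<close> is the inverse covolume. Its value never has to be computed, because self-duality
forces it to be 1.\<close>
theorem gaussian_poisson_lattice:
  fixes B :: "'a::euclidean_space set"
  assumes "finite B" "independent B"
  shows "\<exists>V>0. \<forall>t>0. \<forall>x\<in>span B.
      (\<lambda>v. exp (- (pi * t * ((v + x) \<bullet> (v + x))))) summable_on int_span B \<and>
      (\<lambda>w. exp (- (pi * (w \<bullet> w) / t))) summable_on span_dual B \<and>
      (\<Sum>\<^sub>\<infinity>v\<in>int_span B. complex_of_real (exp (- (pi * t * ((v + x) \<bullet> (v + x)))))) =
      complex_of_real (V / sqrt t ^ card B) *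
        (\<Sum>\<^sub>\<infinity>w\<in>span_dual B. complex_of_real (exp (- (pi * (w \<bullet> w) / t))) * cis (2 * pi * (w \<bullet> x)))"
  using assms
proof (induction B rule: finite_induct)
  case empty
  have "span_dual {} = ({0} :: 'a set)" by (auto simp: span_dual_def)
  then show ?case by (intro exI[of _ 1]) simp
next
  case (insert b B)
  have indB: "independent B" and b: "b \<notin> span B"
    using insert by (auto simp: independent_insert)
  obtain V where V: "V > 0" and IH: "\<And>t x. t > 0 \<Longrightarrow> x \<in> span B \<Longrightarrow>
      (\<lambda>v. exp (- (pi * t * ((v + x) \<bullet> (v + x))))) summable_on int_span B \<and>
      (\<lambda>w. exp (- (pi * (w \<bullet> w) / t))) summable_on span_dual B \<and>
      (\<Sum>\<^sub>\<infinity>v\<in>int_span B. complex_of_real (exp (- (pi * t * ((v + x) \<bullet> (v + x)))))) =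
      complex_of_real (V / sqrt t ^ card B) *
        (\<Sum>\<^sub>\<infinity>w\<in>span_dual B. complex_of_real (exp (- (pi * (w \<bullet> w) / t))) * cis (2 * pi * (w \<bullet> x)))"
    using insert.IH[OF indB] by blast
  obtain p q where p: "p \<in> span B" and q: "\<And>w. w \<in> span B \<Longrightarrow> orthogonal q w" and bpq: "b = p + q"
    using orthogonal_subspace_decomp_exists[of B b] by blast
  have q0: "q \<noteq> 0" using p b bpq by auto
  define h where "h = q \<bullet> q"
  have h: "h > 0" using q0 by (simp add: h_def)
  have qw: "q \<bullet> w = 0" "w \<bullet> q = 0" if "w \<in> span B" for w
    using q[OF that] by (auto simp: orthogonal_def inner_commute)
  have bb: "bij_betw (\<lambda>(m, v). v + real_of_int m *\<^sub>R b) (UNIV \<times> int_span B) (int_span (insert b B))"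
  proof (rule bij_betw_imageI)
    show "(\<lambda>(m, v). v + real_of_int m *\<^sub>R b) ` (UNIV \<times> int_span B) = int_span (insert b B)"
      using int_span_insert[OF insert(1,2)] by simp
    show "inj_on (\<lambda>(m, v). v + real_of_int m *\<^sub>R b) (UNIV \<times> int_span B)"
    proof (clarsimp simp: inj_on_def)
      fix m v m' v' assume v: "v \<in> int_span B" "v' \<in> int_span B"
        and eq: "v + real_of_int m *\<^sub>R b = v' + real_of_int m' *\<^sub>R b"
      have m: "m = m'"
      proof (rule ccontr)
        assume ne: "m \<noteq> m'"
        have "(real_of_int m - real_of_int m') *\<^sub>R b = v' - v"
          using eq by (simp add: algebra_simps)
        then have "b = (1 / (real_of_int m - real_of_int m')) *\<^sub>R (v' - v)"
          using ne by (metis (no_types, lifting) divide_self_if of_int_eq_iff right_minus_eq scaleR_one scaleR_scaleR times_divide_eq_left mult_1)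
        then show False
          using b v int_span_subset_span[of B] by (metis span_diff span_scale subsetD)
      qed
      then show "m = m' \<and> v = v'" using eq by simp
    qed
  qed
  have dd: "bij_betw (\<lambda>(w, k). w + ((real_of_int k - w \<bullet> p) / h) *\<^sub>R q) (span_dual B \<times> UNIV) (span_dual (insert b B))"
  proof (rule bij_betw_byWitness[where f' = "\<lambda>w. (w - ((w \<bullet> q) / h) *\<^sub>R q, \<lfloor>w \<bullet> b\<rfloor>)"])
    have wspan: "w - ((w \<bullet> q) / h) *\<^sub>R q \<in> span B" if w_in: "w \<in> span (insert b B)" for w
    proof -
      obtain k where k: "w - k *\<^sub>R b \<in> span B" using w_in by (auto simp: span_breakdown_eq)
      define u where "u = w - k *\<^sub>R b + k *\<^sub>R p"
      have w: "w = u + k *\<^sub>R q" by (simp add: u_def bpq scaleR_add_right)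
      have s: "u \<in> span B" unfolding u_def by (intro span_add k span_scale p)
      have "(w \<bullet> q) / h = k" using h by (simp add: w inner_add_left qw(2)[OF s] flip: h_def)
      then have "w - ((w \<bullet> q) / h) *\<^sub>R q = u" by (simp add: w)
      then show ?thesis using s by simp
    qed
    show "\<forall>a\<in>span_dual B \<times> UNIV. (\<lambda>w. (w - ((w \<bullet> q) / h) *\<^sub>R q, \<lfloor>w \<bullet> b\<rfloor>))
        (case a of (w, k) \<Rightarrow> w + ((real_of_int k - w \<bullet> p) / h) *\<^sub>R q) = a"
      using h by (auto simp: span_dual_def qw inner_add_left inner_add_right bpq p simp flip: h_def)
    show "\<forall>a'\<in>span_dual (insert b B). (case (a' - ((a' \<bullet> q) / h) *\<^sub>R q, \<lfloor>a' \<bullet> b\<rfloor>) of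
        (w, k) \<Rightarrow> w + ((real_of_int k - w \<bullet> p) / h) *\<^sub>R q) = a'"
    proof
      fix w assume w: "w \<in> span_dual (insert b B)"
      then have "real_of_int \<lfloor>w \<bullet> b\<rfloor> = w \<bullet> b"
        by (auto simp: span_dual_def elim: Ints_cases)
      also have "w \<bullet> b = w \<bullet> p + w \<bullet> q"
        by (simp add: bpq inner_add_right)
      finally have "real_of_int \<lfloor>w \<bullet> b\<rfloor> = w \<bullet> p + w \<bullet> q" .
      moreover have "(w - ((w \<bullet> q) / h) *\<^sub>R q) \<bullet> p = w \<bullet> p"
        using qw(1)[OF p] by (simp add: inner_diff_left)
      ultimately show "(case (w - ((w \<bullet> q) / h) *\<^sub>R q, \<lfloor>w \<bullet> b\<rfloor>) of
        (w, k) \<Rightarrow> w + ((real_of_int k - w \<bullet> p) / h) *\<^sub>R q) = w"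
        by simp
    qed
    show "(\<lambda>(w, k). w + ((real_of_int k - w \<bullet> p) / h) *\<^sub>R q) ` (span_dual B \<times> UNIV) \<subseteq> span_dual (insert b B)"
    proof (clarsimp simp: span_dual_def, intro conjI ballI)
      fix w :: 'a and k :: int assume w: "w \<in> span B" "\<forall>b\<in>B. w \<bullet> b \<in> \<int>"
      have qs: "q \<in> span (insert b B)"
      proof -
        have "q = b - p" using bpq by simp
        moreover have "p \<in> span (insert b B)" using p span_mono[of B "insert b B"] by blast
        ultimately show ?thesis by (simp add: span_base span_diff)
      qed
      show "w + ((real_of_int k - w \<bullet> p) / h) *\<^sub>R q \<in> span (insert b B)"
        by (intro span_add span_scale qs) (use w span_mono[of B "insert b B"] in blast)
      show "(w + ((real_of_int k - w \<bullet> p) / h) *\<^sub>R q) \<bullet> b \<in> \<int>"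
        using h w p by (simp add: bpq inner_add_left inner_add_right qw flip: h_def)
      show "(w + ((real_of_int k - w \<bullet> p) / h) *\<^sub>R q) \<bullet> a \<in> \<int>" if "a \<in> B" for a
        using w that by (simp add: inner_add_left qw span_base)
    qed
    show "(\<lambda>w. (w - ((w \<bullet> q) / h) *\<^sub>R q, \<lfloor>w \<bullet> b\<rfloor>)) ` span_dual (insert b B) \<subseteq> span_dual B \<times> UNIV"
    proof (clarsimp, unfold span_dual_def mem_Collect_eq, intro conjI ballI)
      fix w assume w: "w \<in> span (insert b B) \<and> (\<forall>a\<in>insert b B. w \<bullet> a \<in> \<int>)"
      show "w - ((w \<bullet> q) / h) *\<^sub>R q \<in> span B" using w wspan by blast
      show "(w - ((w \<bullet> q) / h) *\<^sub>R q) \<bullet> a \<in> \<int>" if "a \<in> B" for a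
        using w that by (simp add: inner_diff_left qw span_base)
    qed
  qed
  have step: "(\<lambda>v. exp (- (pi * t * ((v + x) \<bullet> (v + x))))) summable_on int_span (insert b B) \<and>
      (\<lambda>w. exp (- (pi * (w \<bullet> w) / t))) summable_on span_dual (insert b B) \<and>
      (\<Sum>\<^sub>\<infinity>v\<in>int_span (insert b B). complex_of_real (exp (- (pi * t * ((v + x) \<bullet> (v + x)))))) =
      complex_of_real (V / sqrt h / sqrt t ^ card (insert b B)) *
        (\<Sum>\<^sub>\<infinity>w\<in>span_dual (insert b B). complex_of_real (exp (- (pi * (w \<bullet> w) / t))) * cis (2 * pi * (w \<bullet> x)))"
    if t: "t > 0" and x: "x \<in> span (insert b B)" for t x
  proof -
    obtain \<xi> where "x - \<xi> *\<^sub>R b \<in> span B" using x by (auto simp: span_breakdown_eq)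
    define x' where "x' = x - \<xi> *\<^sub>R b + \<xi> *\<^sub>R p"
    have x': "x' \<in> span B"
      unfolding x'_def by (intro span_add span_scale p \<open>x - \<xi> *\<^sub>R b \<in> span B\<close>)
    have xdec: "x = x' + \<xi> *\<^sub>R q"
      by (simp add: x'_def bpq scaleR_add_right)
    let ?c = "complex_of_real (V / sqrt t ^ card B)"
    define a where "a = (\<lambda>m::int. exp (- (pi * (t * h) * (of_int m + \<xi>)\<^sup>2)))"
    define y where "y = (\<lambda>m::int. x' + of_int m *\<^sub>R p)"
    define G where "G = (\<lambda>m v. exp (- (pi * t * ((v + y m) \<bullet> (v + y m)))))"
    define E where "E = (\<lambda>w::'a. exp (- (pi * (w \<bullet> w) / t)))"
    define H where "H = (\<lambda>w (k::int). exp (- (pi * (of_int k - w \<bullet> p)\<^sup>2 / (t * h))))"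
    have y: "y m \<in> span B" for m unfolding y_def by (intro span_add x' span_scale p)
    have th: "t * h > 0" using t h by simp
    have asum: "a summable_on UNIV" unfolding a_def by (rule gaussian_summable_int[OF th])
    have Esum: "E summable_on span_dual B" unfolding E_def using IH[OF t x'] by blast
    have Gsum: "G m summable_on int_span B" for m unfolding G_def using IH[OF t y] by blast
    have Gval: "complex_of_real (\<Sum>\<^sub>\<infinity>v\<in>int_span B. G m v) =
        ?c * (\<Sum>\<^sub>\<infinity>w\<in>span_dual B. complex_of_real (E w) * cis (2 * pi * (w \<bullet> y m)))" for m
      unfolding G_def E_def using IH[OF t y] by (simp only: infsum_of_real[symmetric])
    have a0: "0 \<le> a m" and G0: "0 \<le> G m v" and E0: "0 \<le> E w" and H0: "0 \<le> H w k" for m v w k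
      by (simp_all add: a_def G_def E_def H_def)
    have term1: "exp (- (pi * t * ((v + real_of_int m *\<^sub>R b + x) \<bullet> (v + real_of_int m *\<^sub>R b + x)))) = a m * G m v"
      if v: "v \<in> int_span B" for m v
    proof -
      let ?u = "v + y m"
      have u: "?u \<in> span B" using v int_span_subset_span[of B] y span_add by blast
      have "v + real_of_int m *\<^sub>R b + x = ?u + (of_int m + \<xi>) *\<^sub>R q"
        by (simp add: y_def xdec bpq algebra_simps)
      moreover have "(u + (of_int m + \<xi>) *\<^sub>R q) \<bullet> (u + (of_int m + \<xi>) *\<^sub>R q) = u \<bullet> u + (of_int m + \<xi>)\<^sup>2 * h"
        if "u \<in> span B" for u
        using qw[OF that] by (simp add: inner_add_left inner_add_right h_def power2_eq_square)
      ultimately have "(v + real_of_int m *\<^sub>R b + x) \<bullet> (v + real_of_int m *\<^sub>R b + x) = ?u \<bullet> ?u + (of_int m + \<xi>)\<^sup>2 * h"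
        using u by (simp only:)
      then show ?thesis
        by (simp add: a_def G_def exp_add[symmetric] algebra_simps)
    qed
    \<comment> \<open>A bound on the inner sums that does not depend on \<open>m\<close>, read off from the dual side.\<close>
    define K where "K = norm ?c * (\<Sum>\<^sub>\<infinity>w\<in>span_dual B. E w)"
    have Gbound: "(\<Sum>\<^sub>\<infinity>v\<in>int_span B. G m v) \<le> K" for m
    proof -
      have "(\<Sum>\<^sub>\<infinity>v\<in>int_span B. G m v) \<le> norm (complex_of_real (\<Sum>\<^sub>\<infinity>v\<in>int_span B. G m v))" by simp
      also have "\<dots> \<le> norm ?c * (\<Sum>\<^sub>\<infinity>w\<in>span_dual B. norm (complex_of_real (E w) * cis (2 * pi * (w \<bullet> y m))))"
        unfolding Gval norm_mult[of ?c]
        by (intro mult_left_mono norm_infsum_bound) (use Esum in \<open>auto simp: norm_mult E_def\<close>)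
      also have "\<dots> = K" by (simp add: K_def norm_mult E_def)
      finally show ?thesis .
    qed
    have sum1: "(\<lambda>(m, v). a m * G m v) summable_on (UNIV \<times> int_span B)"
    proof (rule summable_on_SigmaI)
      show "((\<lambda>v. case (m, v) of (m, v) \<Rightarrow> a m * G m v) has_sum a m * (\<Sum>\<^sub>\<infinity>v\<in>int_span B. G m v)) (int_span B)" for m
        using has_sum_cmult_right[OF has_sum_infsum[OF Gsum]] by simp
      show "(\<lambda>m. a m * (\<Sum>\<^sub>\<infinity>v\<in>int_span B. G m v)) summable_on UNIV"
        by (rule summable_on_comparison_test[OF summable_on_cmult_left[OF asum, of K]])
           (auto intro!: mult_left_mono Gbound mult_nonneg_nonneg infsum_nonneg a0 G0)
    qed (auto simp: a0 G0)
    have res1: "(\<lambda>v. exp (- (pi * t * ((v + x) \<bullet> (v + x))))) summable_on int_span (insert b B)"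
    proof -
      have "(\<lambda>z. exp (- (pi * t * (((case z of (m, v) \<Rightarrow> v + real_of_int m *\<^sub>R b) + x) \<bullet> ((case z of (m, v) \<Rightarrow> v + real_of_int m *\<^sub>R b) + x)))))
          summable_on (UNIV \<times> int_span B)"
        using sum1 by (rule summable_on_cong[THEN iffD1, rotated]) (auto simp: term1)
      then show ?thesis
        using summable_on_reindex_bij_betw[OF bb, of "\<lambda>v. exp (- (pi * t * ((v + x) \<bullet> (v + x))))"] by simp
    qed
    have Hbound: "(\<Sum>\<^sub>\<infinity>k. H w k) \<le> sqrt (t * h) * (\<Sum>\<^sub>\<infinity>m::int. exp (- (pi * (t * h) * (of_int m)\<^sup>2)))" for w
      unfolding H_def by (rule gaussian_sum_bound[OF th])
    have sum2: "(\<lambda>(w, k). E w * H w k) summable_on (span_dual B \<times> UNIV)"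
    proof (rule summable_on_SigmaI)
      have Hs: "H w summable_on UNIV" for w
        unfolding H_def using gaussian_summable_int[of "1 / (t * h)" "- (w \<bullet> p)"] th by simp
      show "((\<lambda>k. case (w, k) of (w, k) \<Rightarrow> E w * H w k) has_sum E w * (\<Sum>\<^sub>\<infinity>k. H w k)) UNIV" for w
        using has_sum_cmult_right[OF has_sum_infsum[OF Hs]] by simp
      show "(\<lambda>w. E w * (\<Sum>\<^sub>\<infinity>k. H w k)) summable_on span_dual B"
        by (rule summable_on_comparison_test[OF summable_on_cmult_left[OF Esum,
              of "sqrt (t * h) * (\<Sum>\<^sub>\<infinity>m::int. exp (- (pi * (t * h) * (of_int m)\<^sup>2)))"]])
           (auto intro!: mult_left_mono Hbound mult_nonneg_nonneg infsum_nonneg E0 H0)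
    qed (auto simp: E0 H0)
    have term2: "exp (- (pi * ((w + ((real_of_int k - w \<bullet> p) / h) *\<^sub>R q) \<bullet> (w + ((real_of_int k - w \<bullet> p) / h) *\<^sub>R q)) / t)) = E w * H w k"
      if w: "w \<in> span_dual B" for w k
    proof -
      have "w \<in> span B" using w by (simp add: span_dual_def)
      then have "(w + ((real_of_int k - w \<bullet> p) / h) *\<^sub>R q) \<bullet> (w + ((real_of_int k - w \<bullet> p) / h) *\<^sub>R q)
          = w \<bullet> w + (real_of_int k - w \<bullet> p)\<^sup>2 / h"
        using h by (simp add: inner_add_left inner_add_right qw power2_eq_square flip: h_def)
      then show ?thesis
        using t h by (simp add: E_def H_def exp_add[symmetric] field_simps)
    qed
    have res2: "(\<lambda>w. exp (- (pi * (w \<bullet> w) / t))) summable_on span_dual (insert b B)"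
    proof -
      have "(\<lambda>z. exp (- (pi * ((case z of (w, k) \<Rightarrow> w + ((real_of_int k - w \<bullet> p) / h) *\<^sub>R q) \<bullet> (case z of (w, k) \<Rightarrow> w + ((real_of_int k - w \<bullet> p) / h) *\<^sub>R q)) / t)))
          summable_on (span_dual B \<times> UNIV)"
        using sum2 by (rule summable_on_cong[THEN iffD1, rotated]) (auto simp: term2)
      then show ?thesis
        using summable_on_reindex_bij_betw[OF dd, of "\<lambda>w. exp (- (pi * (w \<bullet> w) / t))"] by simp
    qed
    have "(\<Sum>\<^sub>\<infinity>v\<in>int_span (insert b B). complex_of_real (exp (- (pi * t * ((v + x) \<bullet> (v + x))))))
        = complex_of_real (\<Sum>\<^sub>\<infinity>v\<in>int_span (insert b B). exp (- (pi * t * ((v + x) \<bullet> (v + x)))))"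
      by (rule infsum_of_real)
    also have "(\<Sum>\<^sub>\<infinity>v\<in>int_span (insert b B). exp (- (pi * t * ((v + x) \<bullet> (v + x))))) =
        (\<Sum>\<^sub>\<infinity>(m, v)\<in>UNIV \<times> int_span B. a m * G m v)"
      by (subst infsum_reindex_bij_betw[OF bb, symmetric]) (auto intro!: infsum_cong simp: term1)
    also have "\<dots> = (\<Sum>\<^sub>\<infinity>m. \<Sum>\<^sub>\<infinity>v\<in>int_span B. a m * G m v)"
      by (rule infsum_Sigma'_banach[symmetric]) (use sum1 in simp)
    also have "\<dots> = (\<Sum>\<^sub>\<infinity>m. a m * (\<Sum>\<^sub>\<infinity>v\<in>int_span B. G m v))"
      by (simp add: infsum_cmult_right')
    also have "complex_of_real \<dots> = (\<Sum>\<^sub>\<infinity>m. complex_of_real (a m) * complex_of_real (\<Sum>\<^sub>\<infinity>v\<in>int_span B. G m v))"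
      by (simp add: infsum_of_real[symmetric])
    also have "\<dots> = ?c * (\<Sum>\<^sub>\<infinity>m. \<Sum>\<^sub>\<infinity>w\<in>span_dual B. complex_of_real (a m) * (complex_of_real (E w) * cis (2 * pi * (w \<bullet> y m))))"
      unfolding Gval mult.left_commute[of _ ?c] infsum_cmult_right' ..
    also have "(\<Sum>\<^sub>\<infinity>m. \<Sum>\<^sub>\<infinity>w\<in>span_dual B. complex_of_real (a m) * (complex_of_real (E w) * cis (2 * pi * (w \<bullet> y m))))
       = (\<Sum>\<^sub>\<infinity>w\<in>span_dual B. \<Sum>\<^sub>\<infinity>m. complex_of_real (a m) * (complex_of_real (E w) * cis (2 * pi * (w \<bullet> y m))))"
    proof (rule infsum_swap_banach, rule abs_summable_summable)
      have "(\<lambda>(m, w). a m * E w) summable_on UNIV \<times> span_dual B"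
      proof (rule summable_on_SigmaI)
        show "((\<lambda>w. case (m, w) of (m, w) \<Rightarrow> a m * E w) has_sum a m * (\<Sum>\<^sub>\<infinity>w\<in>span_dual B. E w)) (span_dual B)" for m
          using has_sum_cmult_right[OF has_sum_infsum[OF Esum]] by simp
        show "(\<lambda>m. a m * (\<Sum>\<^sub>\<infinity>w\<in>span_dual B. E w)) summable_on UNIV"
          by (rule summable_on_cmult_left[OF asum])
      qed (auto simp: a0 E0)
      then show "(\<lambda>z. norm (case z of (m, w) \<Rightarrow> complex_of_real (a m) * (complex_of_real (E w) * cis (2 * pi * (w \<bullet> y m)))))
          summable_on UNIV \<times> span_dual B"
        by (rule summable_on_cong[THEN iffD1, rotated]) (auto simp: norm_mult a0 E0)
    qed
    also have "\<dots> = (\<Sum>\<^sub>\<infinity>w\<in>span_dual B. \<Sum>\<^sub>\<infinity>k. 1 / sqrt (t * h) * (complex_of_real (E w * H w k) *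
        cis (2 * pi * ((w + ((real_of_int k - w \<bullet> p) / h) *\<^sub>R q) \<bullet> x))))"
    proof (rule infsum_cong)
      fix w assume w: "w \<in> span_dual B"
      then have ws: "w \<in> span B" by (simp add: span_dual_def)
      have 1: "complex_of_real (a m) * (complex_of_real (E w) * cis (2 * pi * (w \<bullet> y m))) =
         (complex_of_real (E w) * cis (2 * pi * (w \<bullet> x'))) * (complex_of_real (exp (- (pi * (t * h) * (of_int m + \<xi>)\<^sup>2))) * cis (2 * pi * (of_int m * (w \<bullet> p))))"
        for m
      proof -
        have "cis (2 * pi * (w \<bullet> y m)) = cis (2 * pi * (w \<bullet> x')) * cis (2 * pi * (of_int m * (w \<bullet> p)))"
          by (simp add: cis_mult y_def inner_add_right algebra_simps)
        then show ?thesis by (simp add: a_def mult_ac)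
      qed
      have 2: "(complex_of_real (E w) * cis (2 * pi * (w \<bullet> x'))) * (1 / sqrt (t * h) * (complex_of_real (H w k) * cis (2 * pi * (\<xi> * (of_int k - w \<bullet> p)))))
         = 1 / sqrt (t * h) * (complex_of_real (E w * H w k) *
        cis (2 * pi * ((w + ((real_of_int k - w \<bullet> p) / h) *\<^sub>R q) \<bullet> x)))" for k
      proof -
        have ip: "(w + ((real_of_int k - w \<bullet> p) / h) *\<^sub>R q) \<bullet> x = w \<bullet> x' + \<xi> * (of_int k - w \<bullet> p)"
          unfolding xdec using qw[OF ws] qw[OF x'] h
          by (simp add: inner_add_left inner_add_right flip: h_def)
        have "cis (2 * pi * ((w + ((real_of_int k - w \<bullet> p) / h) *\<^sub>R q) \<bullet> x))
            = cis (2 * pi * (w \<bullet> x')) * cis (2 * pi * (\<xi> * (of_int k - w \<bullet> p)))"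
          unfolding ip by (simp add: cis_mult algebra_simps)
        then show ?thesis by (simp add: mult_ac)
      qed
      show "(\<Sum>\<^sub>\<infinity>m. complex_of_real (a m) * (complex_of_real (E w) * cis (2 * pi * (w \<bullet> y m)))) =
        (\<Sum>\<^sub>\<infinity>k. 1 / sqrt (t * h) * (complex_of_real (E w * H w k) * cis (2 * pi * ((w + ((real_of_int k - w \<bullet> p) / h) *\<^sub>R q) \<bullet> x))))"
        unfolding 1 2[symmetric] unfolding infsum_cmult_right' gaussian_poisson_1d[OF th] H_def ..
    qed
    also have "\<dots> = (\<Sum>\<^sub>\<infinity>(w, k)\<in>span_dual B \<times> UNIV. 1 / sqrt (t * h) * (complex_of_real (E w * H w k) *
        cis (2 * pi * ((w + ((real_of_int k - w \<bullet> p) / h) *\<^sub>R q) \<bullet> x))))"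
    proof (rule infsum_Sigma'_banach, rule abs_summable_summable)
      have "(\<lambda>z. 1 / sqrt (t * h) * (case z of (w, k) \<Rightarrow> E w * H w k)) summable_on span_dual B \<times> UNIV"
        by (rule summable_on_cmult_right[OF sum2])
      then show "(\<lambda>z. norm (case z of (w, k) \<Rightarrow> 1 / sqrt (t * h) * (complex_of_real (E w * H w k) *
        cis (2 * pi * ((w + ((real_of_int k - w \<bullet> p) / h) *\<^sub>R q) \<bullet> x))))) summable_on span_dual B \<times> UNIV"
        by (rule summable_on_cong[THEN iffD1, rotated]) (use th in \<open>auto simp: norm_mult norm_divide E0 H0\<close>)
    qed
    also have "\<dots> = (\<Sum>\<^sub>\<infinity>w\<in>span_dual (insert b B). 1 / sqrt (t * h) * (complex_of_real (exp (- (pi * (w \<bullet> w) / t))) * cis (2 * pi * (w \<bullet> x))))"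
      by (subst infsum_reindex_bij_betw[OF dd, symmetric]) (auto intro!: infsum_cong simp: term2)
    also have "\<dots> = 1 / sqrt (t * h) * (\<Sum>\<^sub>\<infinity>w\<in>span_dual (insert b B). complex_of_real (exp (- (pi * (w \<bullet> w) / t))) * cis (2 * pi * (w \<bullet> x)))"
      by (rule infsum_cmult_right')
    finally have res3: "(\<Sum>\<^sub>\<infinity>v\<in>int_span (insert b B). complex_of_real (exp (- (pi * t * ((v + x) \<bullet> (v + x)))))) =
      complex_of_real (V / sqrt h / sqrt t ^ card (insert b B)) *
        (\<Sum>\<^sub>\<infinity>w\<in>span_dual (insert b B). complex_of_real (exp (- (pi * (w \<bullet> w) / t))) * cis (2 * pi * (w \<bullet> x)))"
      using insert(1,2) by (simp add: real_sqrt_mult mult.commute)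
    show ?thesis using res1 res2 res3 by blast
  qed
  show ?case
    by (intro exI[of _ "V / sqrt h"] conjI allI impI ballI step[THEN conjunct1] step[THEN conjunct2, THEN conjunct1]
        step[THEN conjunct2, THEN conjunct2]) (use V h in auto)
qed

section \<open>Exponential series on the upper half-plane\<close>

definition uhp :: "complex set" where "uhp = {\<tau>. Im \<tau> > 0}"

abbreviation at_i_infinity :: "complex filter" where
  "at_i_infinity \<equiv> filtercomap Im at_top"

definition nome :: "complex \<Rightarrow> complex" where
  "nome \<tau> = exp (\<i> * pi * \<tau>)"

lemma open_uhp [simp]: "open uhp"
  unfolding uhp_def by (rule open_halfspace_Im_gt)

lemma convex_uhp [simp]: "convex uhp"
  unfolding uhp_def by (rule convex_halfspace_Im_gt)

lemma uhp_inversion: "\<tau> \<in> uhp \<Longrightarrow> - 1 / \<tau> \<in> uhp"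
  by (auto simp: uhp_def Im_divide sum_power2_gt_zero_iff complex_eq_iff zero_less_divide_iff)

lemma uhp_not_zero: "\<tau> \<in> uhp \<Longrightarrow> \<tau> \<noteq> 0"
  by (auto simp: uhp_def)

lemma at_i_infinity_neq_bot [simp]: "at_i_infinity \<noteq> bot"
proof -
  have "\<exists>\<tau>. Im \<tau> \<ge> N" for N by (rule exI[of _ "Complex 0 N"]) simp
  then show ?thesis
    unfolding trivial_limit_def eventually_filtercomap_at_top_linorder by auto
qed

lemma eventually_uhp: "eventually (\<lambda>\<tau>. \<tau> \<in> uhp) at_i_infinity"
  unfolding eventually_filtercomap_at_top_dense uhp_def by (intro exI[of _ 0]) auto

lemma nome_tendsto_0: "(nome \<longlongrightarrow> 0) at_i_infinity"
proof (rule tendsto_norm_zero_cancel)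
  have "((\<lambda>y::real. exp (- (pi * y))) \<longlongrightarrow> 0) at_top" by real_asymp
  then have "((\<lambda>\<tau>. exp (- (pi * Im \<tau>))) \<longlongrightarrow> 0) at_i_infinity"
    by (rule filterlim_compose[OF _ filterlim_filtercomap])
  then show "((\<lambda>\<tau>. norm (nome \<tau>)) \<longlongrightarrow> 0) at_i_infinity"
    by (simp add: nome_def)
qed

lemma nome_nonzero [simp]: "nome \<tau> \<noteq> 0"
  by (simp add: nome_def)

text \<open>One notion covers theta series of lattices, of their cosets (real exponents) and theta series with a
character (coefficients of modulus one).\<close>
definition exp_series :: "'b set \<Rightarrow> ('b \<Rightarrow> complex) \<Rightarrow> ('b \<Rightarrow> real) \<Rightarrow> complex \<Rightarrow> complex" where
  "exp_series A c e \<tau> = (\<Sum>\<^sub>\<infinity>a\<in>A. c a * exp (\<i> * pi * \<tau> * e a))"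

locale exp_family =
  fixes A :: "'b set" and c :: "'b \<Rightarrow> complex" and e :: "'b \<Rightarrow> real"
  assumes nonneg: "a \<in> A \<Longrightarrow> 0 \<le> e a"
    and coeff: "a \<in> A \<Longrightarrow> norm (c a) \<le> 1"
    and gauss: "t > 0 \<Longrightarrow> (\<lambda>a. exp (- (pi * t * e a))) summable_on A"
begin

lemma norm_term_le:
  assumes "a \<in> A"
  shows "norm (c a * exp (\<i> * pi * \<tau> * e a)) \<le> exp (- (pi * Im \<tau> * e a))"
proof -
  have "norm (c a) * exp (- (pi * Im \<tau> * e a)) \<le> 1 * exp (- (pi * Im \<tau> * e a))"
    by (intro mult_right_mono coeff assms) simp
  then show ?thesis by (simp add: norm_mult)
qed

lemma abs_summable:
  assumes "\<tau> \<in> uhp" "A' \<subseteq> A"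
  shows "(\<lambda>a. norm (c a * exp (\<i> * pi * \<tau> * e a))) summable_on A'"
proof (rule summable_on_comparison_test)
  show "(\<lambda>a. exp (- (pi * Im \<tau> * e a))) summable_on A'"
    using gauss[of "Im \<tau>"] assms summable_on_subset_banach by (auto simp: uhp_def)
qed (use assms norm_term_le in auto)

lemma summable:
  assumes "\<tau> \<in> uhp" "A' \<subseteq> A"
  shows "(\<lambda>a. c a * exp (\<i> * pi * \<tau> * e a)) summable_on A'"
  using abs_summable[OF assms] by (rule abs_summable_summable)

lemma holomorphic: "exp_series A c e holomorphic_on uhp"
  unfolding holomorphic_on_def
proof
  fix z assume z: "z \<in> uhp"
  define r where "r = Im z / 2"
  have r: "r > 0" using z by (simp add: r_def uhp_def)
  have im: "Im w \<ge> r" if "w \<in> cball z r" for w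
  proof -
    have "\<bar>Im (z - w)\<bar> \<le> r"
      using that abs_Im_le_cmod[of "z - w"] by (simp add: dist_norm)
    then have "Im z - Im w \<le> r" unfolding minus_complex.sel by linarith
    then show ?thesis by (simp add: r_def)
  qed
  have ul: "uniform_limit (cball z r) (\<lambda>X w. \<Sum>a\<in>X. c a * exp (\<i> * pi * w * e a)) (exp_series A c e) (finite_subsets_at_top A)"
    unfolding exp_series_def
  proof (rule Weierstrass_m_test_general)
    fix a w assume a: "a \<in> A" and w: "w \<in> cball z r"
    have "norm (c a * exp (\<i> * pi * w * e a)) \<le> exp (- (pi * Im w * e a))"
      by (rule norm_term_le[OF a])
    also have "\<dots> \<le> exp (- (pi * r * e a))"
      using im[OF w] nonneg[OF a] by (simp add: mult_right_mono mult_left_mono)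
    finally show "norm (c a * exp (\<i> * pi * w * e a)) \<le> exp (- (pi * r * e a))" .
  qed (use gauss[OF r] in simp)
  have "exp_series A c e holomorphic_on ball z r"
    by (rule holomorphic_uniform_limit[OF _ ul])
       (auto intro!: always_eventually continuous_intros holomorphic_intros)
  then have "exp_series A c e field_differentiable at z"
    using r by (auto simp: holomorphic_on_imp_differentiable_at)
  then show "exp_series A c e field_differentiable at z within uhp"
    by (rule field_differentiable_at_within)
qed

lemma finite_level: "finite {a \<in> A. e a = \<kappa>}"
proof (rule ccontr)
  assume "infinite {a \<in> A. e a = \<kappa>}"
  then have "\<not> (\<lambda>_. exp (- (pi * 1 * \<kappa>))) summable_on {a \<in> A. e a = \<kappa>}"
    by (rule infsum_diverge_constant) simp
  moreover have "(\<lambda>a. exp (- (pi * 1 * e a))) summable_on {a \<in> A. e a = \<kappa>}"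
    by (rule summable_on_subset_banach[OF gauss]) auto
  then have "(\<lambda>_. exp (- (pi * 1 * \<kappa>))) summable_on {a \<in> A. e a = \<kappa>}"
    by (rule summable_on_cong[THEN iffD1, rotated]) auto
  ultimately show False by contradiction
qed

text \<open>The gap \<open>\<delta>\<close> between the lowest exponent and all others makes the rest of the series decay
exponentially after division by the leading exponential. The series runs over a subfamily \<open>A'\<close>, so that
the statement also applies to tails of a series.\<close>
lemma leading_coefficient:
  assumes \<delta>: "\<delta> > 0" and gap: "\<And>a. a \<in> A' \<Longrightarrow> e a = \<kappa> \<or> e a \<ge> \<kappa> + \<delta>" and A': "A' \<subseteq> A"
  shows "((\<lambda>\<tau>. exp (- (\<i> * pi * \<tau> * \<kappa>)) * exp_series A' c e \<tau>) \<longlongrightarrow> (\<Sum>a\<in>{a\<in>A'. e a = \<kappa>}. c a)) at_i_infinity"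
proof -
  let ?A0 = "{a \<in> A'. e a = \<kappa>}" and ?A1 = "{a \<in> A'. e a \<ge> \<kappa> + \<delta>}"
  have fin: "finite ?A0" by (rule finite_subset[OF _ finite_level[of \<kappa>]]) (use A' in auto)
  have A0: "?A0 \<subseteq> A" and A1: "?A1 \<subseteq> A" using A' by auto
  have split: "A' = ?A0 \<union> ?A1" "?A0 \<inter> ?A1 = {}" using gap \<delta> by auto
  define C where "C = exp (pi * (\<kappa> + \<delta>)) * (\<Sum>\<^sub>\<infinity>a\<in>?A1. exp (- (pi * 1 * e a)))"
  have s1: "(\<lambda>a. exp (- (pi * 1 * e a))) summable_on ?A1"
    by (rule summable_on_subset_banach[OF gauss]) (use A' in auto)
  have bound: "norm (exp (- (\<i> * pi * \<tau> * \<kappa>)) * exp_series A' c e \<tau> - (\<Sum>a\<in>?A0. c a)) \<le> C * exp (- (pi * \<delta> * Im \<tau>))"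
    if \<tau>: "Im \<tau> > 1" for \<tau>
  proof -
    have u: "\<tau> \<in> uhp" using \<tau> by (simp add: uhp_def)
    let ?f = "\<lambda>a. c a * exp (\<i> * pi * \<tau> * e a)"
    have "exp_series A' c e \<tau> = infsum ?f ?A0 + infsum ?f ?A1"
      unfolding exp_series_def
      by (subst (1) split(1), rule infsum_Un_disjoint[OF summable[OF u A0] summable[OF u A1] split(2)])
    moreover have "infsum ?f ?A0 = exp (\<i> * pi * \<tau> * \<kappa>) * (\<Sum>a\<in>?A0. c a)"
      using fin by (simp add: sum_distrib_left mult.commute)
    ultimately have eq: "exp (- (\<i> * pi * \<tau> * \<kappa>)) * exp_series A' c e \<tau> - (\<Sum>a\<in>?A0. c a)
       = exp (- (\<i> * pi * \<tau> * \<kappa>)) * infsum ?f ?A1"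
      by (simp add: distrib_left mult.assoc[symmetric] exp_add[symmetric])
    have "norm (infsum ?f ?A1) \<le> (\<Sum>\<^sub>\<infinity>a\<in>?A1. exp (- (pi * (Im \<tau> - 1) * (\<kappa> + \<delta>))) * exp (- (pi * 1 * e a)))"
    proof (rule norm_infsum_le)
      show "(?f has_sum infsum ?f ?A1) ?A1"
        by (rule has_sum_infsum, rule summable[OF u]) (use A' in auto)
      show "((\<lambda>a. exp (- (pi * (Im \<tau> - 1) * (\<kappa> + \<delta>))) * exp (- (pi * 1 * e a))) has_sum
        (\<Sum>\<^sub>\<infinity>a\<in>?A1. exp (- (pi * (Im \<tau> - 1) * (\<kappa> + \<delta>))) * exp (- (pi * 1 * e a)))) ?A1"
        by (rule has_sum_infsum, rule summable_on_cmult_right[OF s1])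
      fix a assume a: "a \<in> ?A1"
      then have "(Im \<tau> - 1) * (\<kappa> + \<delta>) \<le> (Im \<tau> - 1) * e a"
        using \<tau> by (intro mult_left_mono) auto
      then have "pi * ((Im \<tau> - 1) * (\<kappa> + \<delta>)) \<le> pi * ((Im \<tau> - 1) * e a)"
        by (rule mult_left_mono) simp
      then have "exp (- (pi * Im \<tau> * e a)) \<le> exp (- (pi * (Im \<tau> - 1) * (\<kappa> + \<delta>))) * exp (- (pi * 1 * e a))"
        by (simp add: exp_add[symmetric] algebra_simps)
      moreover have "norm (?f a) \<le> exp (- (pi * Im \<tau> * e a))"
        using norm_term_le a A' by auto
      ultimately show "norm (?f a) \<le> exp (- (pi * (Im \<tau> - 1) * (\<kappa> + \<delta>))) * exp (- (pi * 1 * e a))"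
        by linarith
    qed
    also have "\<dots> = exp (- (pi * (Im \<tau> - 1) * (\<kappa> + \<delta>))) * (\<Sum>\<^sub>\<infinity>a\<in>?A1. exp (- (pi * 1 * e a)))"
      by (rule infsum_cmult_right')
    finally have "norm (exp (- (\<i> * pi * \<tau> * \<kappa>)) * infsum ?f ?A1) \<le>
       exp (pi * Im \<tau> * \<kappa>) * (exp (- (pi * (Im \<tau> - 1) * (\<kappa> + \<delta>))) * (\<Sum>\<^sub>\<infinity>a\<in>?A1. exp (- (pi * 1 * e a))))"
      unfolding norm_mult by (intro mult_mono) auto
    also have "\<dots> = exp (pi * Im \<tau> * \<kappa> - pi * (Im \<tau> - 1) * (\<kappa> + \<delta>)) * (\<Sum>\<^sub>\<infinity>a\<in>?A1. exp (- (pi * 1 * e a)))"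
      by (simp add: exp_diff exp_minus divide_inverse)
    also have "pi * Im \<tau> * \<kappa> - pi * (Im \<tau> - 1) * (\<kappa> + \<delta>) = pi * (\<kappa> + \<delta>) + (- (pi * \<delta> * Im \<tau>))"
      by (simp add: algebra_simps)
    also have "exp \<dots> * (\<Sum>\<^sub>\<infinity>a\<in>?A1. exp (- (pi * 1 * e a))) = C * exp (- (pi * \<delta> * Im \<tau>))"
      by (simp only: C_def exp_add mult_ac)
    finally show ?thesis unfolding eq .
  qed
  have "((\<lambda>y::real. C * exp (- (pi * \<delta> * y))) \<longlongrightarrow> 0) at_top"
    using \<delta> by real_asymp
  then have lim: "((\<lambda>\<tau>. C * exp (- (pi * \<delta> * Im \<tau>))) \<longlongrightarrow> 0) at_i_infinity"
    by (rule filterlim_compose[OF _ filterlim_filtercomap])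
  have "((\<lambda>\<tau>. exp (- (\<i> * pi * \<tau> * \<kappa>)) * exp_series A' c e \<tau> - (\<Sum>a\<in>?A0. c a)) \<longlongrightarrow> 0) at_i_infinity"
    by (rule Lim_null_comparison[OF _ lim])
       (unfold eventually_filtercomap_at_top_dense, use bound in blast)
  then show ?thesis by (rule LIM_zero_cancel)
qed

end

section \<open>Theta functions of self-dual lattices\<close>

text \<open>Unimodularity in an arbitrary Euclidean space. It is used for the given lattice and also for the
integers inside the reals, whose theta functions are those of Jacobi. Integrality of inner products
follows from self-duality.\<close>
definition self_dual_lattice :: "'a::euclidean_space set \<Rightarrow> bool" where
  "self_dual_lattice L \<longleftrightarrow> lattice_of_rank DIM('a) L \<and> dual_lattice L = L"

definition theta :: "'a::euclidean_space set \<Rightarrow> 'a \<Rightarrow> complex \<Rightarrow> complex" where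
  "theta L x = exp_series L (\<lambda>_. 1) (\<lambda>v. (v + x) \<bullet> (v + x))"

definition theta_char :: "'a::euclidean_space set \<Rightarrow> 'a \<Rightarrow> complex \<Rightarrow> complex" where
  "theta_char L x = exp_series L (\<lambda>v. cis (2 * pi * (v \<bullet> x))) (\<lambda>v. v \<bullet> v)"

lemma theta_char_0: "theta_char L 0 = theta L 0"
  by (simp add: theta_def theta_char_def)

context
  fixes L :: "'a::euclidean_space set"
  assumes L: "self_dual_lattice L"
begin

lemma self_dual_zero: "0 \<in> L"
proof -
  have "0 \<in> dual_lattice L" by (simp add: dual_lattice_def)
  then show ?thesis using L by (simp add: self_dual_lattice_def)
qed

lemma self_dual_add: "v \<in> L \<Longrightarrow> w \<in> L \<Longrightarrow> v + w \<in> L"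
proof -
  assume "v \<in> L" "w \<in> L"
  then have "v \<in> dual_lattice L" "w \<in> dual_lattice L" using L by (simp_all add: self_dual_lattice_def)
  then have "v + w \<in> dual_lattice L" by (simp add: dual_lattice_def inner_add_left)
  then show ?thesis using L by (simp add: self_dual_lattice_def)
qed

lemma self_dual_uminus: "v \<in> L \<Longrightarrow> - v \<in> L"
proof -
  assume "v \<in> L"
  then have "v \<in> dual_lattice L" using L by (simp_all add: self_dual_lattice_def)
  then have "- v \<in> dual_lattice L" by (simp add: dual_lattice_def)
  then show ?thesis using L by (simp add: self_dual_lattice_def)
qed

lemma self_dual_inner: "v \<in> L \<Longrightarrow> w \<in> L \<Longrightarrow> v \<bullet> w \<in> \<int>"
  using L by (force simp: self_dual_lattice_def dual_lattice_def)

lemma self_dual_basis: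
  obtains B where "finite B" "card B = DIM('a)" "independent B" "L = int_span B" "span B = UNIV" "span_dual B = L"
proof -
  obtain B where B: "finite B" "card B = DIM('a)" "independent B" "L = int_span B"
    using L by (auto simp: self_dual_lattice_def lattice_of_rank_def int_span_def)
  have sp: "span B = UNIV"
    using card_ge_dim_independent[of B UNIV] B by (auto simp: dim_UNIV)
  have "B \<subseteq> L" unfolding B(4) by (rule int_span_superset[OF B(1)])
  moreover have "w \<bullet> v \<in> \<int>" if "\<forall>b\<in>B. w \<bullet> b \<in> \<int>" "v \<in> L" for w v
  proof -
    obtain c where "v = (\<Sum>b\<in>B. real_of_int (c b) *\<^sub>R b)"
      using \<open>v \<in> L\<close> unfolding B(4) int_span_def by blast
    then have "w \<bullet> v = (\<Sum>b\<in>B. real_of_int (c b) * (w \<bullet> b))"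
      by (simp add: inner_sum_right)
    also have "\<dots> \<in> \<int>" using that(1) by (intro Ints_sum Ints_mult) auto
    finally show ?thesis .
  qed
  ultimately have "span_dual B = dual_lattice L"
    unfolding span_dual_def dual_lattice_def sp by blast
  then show ?thesis using that[of B] B sp L by (simp add: self_dual_lattice_def)
qed

lemma self_dual_summable:
  assumes "t > 0"
  shows "(\<lambda>v. exp (- (pi * t * ((v + x) \<bullet> (v + x))))) summable_on L"
proof -
  obtain B where B: "finite B" "card B = DIM('a)" "independent B" "L = int_span B" "span B = UNIV" "span_dual B = L"
    by (rule self_dual_basis)
  show ?thesis
    using gaussian_poisson_lattice[OF B(1,3)] assms unfolding B(4)[symmetric] B(5) by blast
qed

text \<open>At \<open>t = 1\<close> and \<open>x = 0\<close> the two sides of the Poisson formula are the same positive sum, up to the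
constant \<open>V\<close>, so \<open>V = 1\<close>.\<close>
lemma self_dual_poisson:
  assumes "t > 0"
  shows "(\<Sum>\<^sub>\<infinity>v\<in>L. complex_of_real (exp (- (pi * t * ((v + x) \<bullet> (v + x)))))) =
      complex_of_real (1 / sqrt t ^ DIM('a)) *
        (\<Sum>\<^sub>\<infinity>w\<in>L. complex_of_real (exp (- (pi * (w \<bullet> w) / t))) * cis (2 * pi * (w \<bullet> x)))"
proof -
  obtain B where B: "finite B" "card B = DIM('a)" "independent B" "L = int_span B" "span B = UNIV" "span_dual B = L"
    by (rule self_dual_basis)
  obtain V where V: "V > 0" "\<And>t x. t > 0 \<Longrightarrow>
     (\<Sum>\<^sub>\<infinity>v\<in>L. complex_of_real (exp (- (pi * t * ((v + x) \<bullet> (v + x)))))) =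
      complex_of_real (V / sqrt t ^ DIM('a)) *
        (\<Sum>\<^sub>\<infinity>w\<in>L. complex_of_real (exp (- (pi * (w \<bullet> w) / t))) * cis (2 * pi * (w \<bullet> x)))"
    using gaussian_poisson_lattice[OF B(1,3)] unfolding B(2) B(4)[symmetric] B(5) B(6) by blast
  define S where "S = (\<Sum>\<^sub>\<infinity>v\<in>L. exp (- (pi * (v \<bullet> v))))"
  have "(\<Sum>v\<in>{0::'a}. exp (- (pi * (v \<bullet> v)))) \<le> S"
    unfolding S_def
    by (rule finite_sum_le_infsum) (use self_dual_summable[of 1 0] self_dual_zero in auto)
  then have "S > 0" by simp
  have "complex_of_real S = V * complex_of_real S"
    using V(2)[of 1 0] by (simp add: S_def infsum_of_real)
  then have "V = 1" using \<open>S > 0\<close> by simp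
  then show ?thesis using V(2)[OF assms] by simp
qed

lemma exp_family_theta: "exp_family L (\<lambda>_. 1) (\<lambda>v. (v + x) \<bullet> (v + x))"
  by unfold_locales (auto intro!: self_dual_summable)

lemma exp_family_theta_char: "exp_family L (\<lambda>v. cis (2 * pi * (v \<bullet> x))) (\<lambda>v. v \<bullet> v)"
  by unfold_locales (use self_dual_summable[of _ 0] in auto)

lemma theta_holomorphic: "theta L x holomorphic_on uhp"
  unfolding theta_def by (rule exp_family.holomorphic[OF exp_family_theta])

lemma theta_char_holomorphic: "theta_char L x holomorphic_on uhp"
  unfolding theta_char_def by (rule exp_family.holomorphic[OF exp_family_theta_char])

text \<open>On the imaginary axis this is the Poisson formula; both sides are holomorphic.\<close>
theorem theta_char_inversion:
  assumes "\<tau> \<in> uhp"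
  shows "theta_char L x (- 1 / \<tau>) = csqrt (- \<i> * \<tau>) ^ DIM('a) * theta L x \<tau>"
proof -
  define f where "f = (\<lambda>\<tau>. theta_char L x (- 1 / \<tau>) - csqrt (- \<i> * \<tau>) ^ DIM('a) * theta L x \<tau>)"
  have nonpos: "- \<i> * z \<notin> \<real>\<^sub>\<le>\<^sub>0" if "z \<in> uhp" for z
    using that by (auto simp: uhp_def complex_nonpos_Reals_iff)
  have h1: "(\<lambda>\<tau>. theta_char L x (- 1 / \<tau>)) holomorphic_on uhp"
  proof -
    have "(theta_char L x \<circ> (\<lambda>\<tau>. - 1 / \<tau>)) holomorphic_on uhp"
    proof (rule holomorphic_on_compose_gen[OF _ theta_char_holomorphic])
      show "(\<lambda>\<tau>. - 1 / \<tau>) holomorphic_on uhp"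
        by (intro holomorphic_on_divide holomorphic_intros) (rule uhp_not_zero)
      show "(\<lambda>\<tau>. - 1 / \<tau>) ` uhp \<subseteq> uhp"
        using uhp_inversion by blast
    qed
    then show ?thesis by (simp add: o_def)
  qed
  have hol: "f holomorphic_on uhp"
    unfolding f_def by (intro holomorphic_intros h1 theta_holomorphic) (use nonpos in auto)
  define U where "U = {\<i> * complex_of_real t | t. t > 0}"
  have zero: "f z = 0" if zU: "z \<in> U" for z
  proof -
    obtain t where t: "t > 0" "z = \<i> * complex_of_real t" using zU by (auto simp: U_def)
    have 1: "- 1 / z = \<i> / t" using t by (simp add: field_simps)
    have "csqrt (- \<i> * z) = complex_of_real (sqrt t)"
      using t by (simp add: csqrt_of_real_nonneg)
    moreover have "theta L x z = (\<Sum>\<^sub>\<infinity>v\<in>L. complex_of_real (exp (- (pi * t * ((v + x) \<bullet> (v + x))))))"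
    proof -
      have "\<i> * pi * z * complex_of_real y = complex_of_real (- (pi * t * y))" for y
        using t by (simp add: complex_eq_iff)
      then show ?thesis unfolding theta_def exp_series_def by (simp only: exp_of_real mult_1)
    qed
    moreover have "theta_char L x (- 1 / z) = (\<Sum>\<^sub>\<infinity>w\<in>L. complex_of_real (exp (- (pi * (w \<bullet> w) / t))) * cis (2 * pi * (w \<bullet> x)))"
    proof -
      have "\<i> * pi * (- 1 / z) * complex_of_real y = complex_of_real (- (pi * y / t))" for y
        unfolding 1 by (simp add: complex_eq_iff)
      then show ?thesis unfolding theta_char_def exp_series_def by (simp only: exp_of_real mult.commute)
    qed
    ultimately show "f z = 0"
      unfolding f_def using self_dual_poisson[OF t(1), of x] t by simp
  qed
  have "f \<tau> = 0"
  proof (rule analytic_continuation[OF hol, of U \<i>])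
    show "open uhp" by simp
    show "connected uhp" by (simp add: convex_connected)
    show "\<i> islimpt U"
    proof (rule islimptI)
      fix T assume T: "\<i> \<in> T" "open T"
      then obtain e where e: "e > 0" "ball \<i> e \<subseteq> T" using open_contains_ball by blast
      have "\<i> * complex_of_real (1 + e/2) \<in> U" unfolding U_def using e by (intro CollectI exI[of _ "1 + e/2"]) auto
      moreover have "\<i> * complex_of_real (1 + e/2) \<in> ball \<i> e"
        using e by (simp add: dist_norm norm_mult algebra_simps)
      moreover have "\<i> * complex_of_real (1 + e/2) \<noteq> \<i>" using e by (simp add: complex_eq_iff)
      ultimately show "\<exists>y\<in>U. y \<in> T \<and> y \<noteq> \<i>" using e by blast
    qed
  qed (use zero assms in \<open>auto simp: U_def uhp_def\<close>)
  then show ?thesis by (simp add: f_def)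
qed

theorem theta_inversion:
  assumes "\<tau> \<in> uhp"
  shows "theta L x (- 1 / \<tau>) = csqrt (- \<i> * \<tau>) ^ DIM('a) * theta_char L x \<tau>"
proof -
  have nz: "\<tau> \<noteq> 0" using assms by (rule uhp_not_zero)
  have np: "- \<i> * \<tau> \<notin> \<real>\<^sub>\<le>\<^sub>0"
    using assms by (auto simp: uhp_def complex_nonpos_Reals_iff)
  have "theta_char L x \<tau> = csqrt (- \<i> * (- 1 / \<tau>)) ^ DIM('a) * theta L x (- 1 / \<tau>)"
    using theta_char_inversion[OF uhp_inversion[OF assms]] nz by simp
  moreover have "- \<i> * (- 1 / \<tau>) = inverse (- \<i> * \<tau>)" using nz by (simp add: field_simps)
  then have "csqrt (- \<i> * (- 1 / \<tau>)) = inverse (csqrt (- \<i> * \<tau>))"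
    using csqrt_inverse[OF np] by simp
  ultimately show ?thesis using nz by (simp add: power_inverse)
qed

text \<open>The map sending \<open>v\<close> to \<open>v \<bullet> v\<close> is additive modulo 2. The linear form that takes the value \<open>b \<bullet> b\<close> at each
basis vector \<open>b\<close> is an integral lift, and by self-duality it is the inner product with a lattice
vector.\<close>
lemma characteristic_vector_exists:
  obtains u where "u \<in> L" "\<And>v. v \<in> L \<Longrightarrow> \<exists>k::int. v \<bullet> v - v \<bullet> u = 2 * of_int k"
proof -
  obtain B where B: "finite B" "card B = DIM('a)" "independent B" "L = int_span B" "span B = UNIV" "span_dual B = L"
    by (rule self_dual_basis)
  obtain g :: "'a \<Rightarrow> real" where g: "linear g" "\<And>b. b \<in> B \<Longrightarrow> g b = b \<bullet> b"
    using linear_independent_extend[OF B(3), of "\<lambda>b. b \<bullet> b"] by blast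
  define u where "u = (\<Sum>i\<in>Basis. g i *\<^sub>R i)"
  have gu: "v \<bullet> u = g v" for v
  proof -
    have "g v = g (\<Sum>i\<in>Basis. (v \<bullet> i) *\<^sub>R i)" by (simp add: euclidean_representation)
    also have "\<dots> = (\<Sum>i\<in>Basis. (v \<bullet> i) * g i)" using g(1) by (simp add: linear_sum linear_scale)
    finally show ?thesis by (simp add: u_def inner_sum_right mult.commute)
  qed
  have BL: "b \<in> L" if "b \<in> B" for b
    using int_span_superset[OF B(1)] that unfolding B(4) by blast
  have "u \<in> span_dual B"
    unfolding span_dual_def using B(5) gu g(2) self_dual_inner[OF BL BL] by (auto simp: inner_commute)
  then have uL: "u \<in> L" using B(6) by simp
  define P where "P = (\<lambda>v. \<exists>k::int. v \<bullet> v - v \<bullet> u = 2 * of_int k)"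
  have add: "P (v + w)" if vw: "P v" "P w" "v \<in> L" "w \<in> L" for v w
  proof -
    obtain k l m where "v \<bullet> v - v \<bullet> u = 2 * of_int k" "w \<bullet> w - w \<bullet> u = 2 * of_int l" "v \<bullet> w = of_int m"
      using vw self_dual_inner[of v w] unfolding P_def by (auto elim: Ints_cases)
    then have "(v + w) \<bullet> (v + w) - (v + w) \<bullet> u = 2 * of_int (k + l + m)"
      by (simp add: inner_add_left inner_add_right inner_commute)
    then show ?thesis unfolding P_def by blast
  qed
  have scale: "P (of_int c *\<^sub>R b)" if bB: "b \<in> B" for b and c :: int
  proof -
    obtain m where m: "b \<bullet> b = of_int m" using self_dual_inner[OF BL BL, of b b] bB by (auto elim: Ints_cases)
    have "even (c * c - c)" by simp
    then obtain j where j: "c * c - c = 2 * j" by (rule dvdE)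
    have "(of_int c *\<^sub>R b) \<bullet> (of_int c *\<^sub>R b) - (of_int c *\<^sub>R b) \<bullet> u = of_int ((c * c - c) * m)"
      using gu[of b] g(2)[OF bB] m by (simp add: algebra_simps)
    then show ?thesis unfolding P_def j by (intro exI[of _ "j * m"]) simp
  qed
  have scaleL: "of_int c *\<^sub>R b \<in> L" if "b \<in> B" for b and c :: int
  proof -
    have "of_int c *\<^sub>R b \<in> dual_lattice L"
      using self_dual_inner[OF BL[OF that]] by (auto simp: dual_lattice_def)
    then show ?thesis using L by (simp add: self_dual_lattice_def)
  qed
  have "P v" if vL: "v \<in> L" for v
  proof -
    obtain c where c: "v = (\<Sum>b\<in>B. real_of_int (c b) *\<^sub>R b)"
      using vL unfolding B(4) int_span_def by blast
    have "P (\<Sum>b\<in>B'. real_of_int (c b) *\<^sub>R b) \<and> (\<Sum>b\<in>B'. real_of_int (c b) *\<^sub>R b) \<in> L" if "finite B'" "B' \<subseteq> B" for B'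
      using that
    proof (induction B' rule: finite_induct)
      case empty
      have "P 0" unfolding P_def by (intro exI[of _ 0]) simp
      then show ?case using self_dual_zero by simp
    next
      case (insert b B')
      then show ?case by (auto intro!: add scale self_dual_add scaleL)
    qed
    then show ?thesis using B(1) c by blast
  qed
  then show ?thesis using that[of u] uL unfolding P_def by blast
qed

end

section \<open>Translations, characteristic vectors and the Jacobi theta functions\<close>

lemma exp_i_pi_int_even:
  assumes "x = 2 * of_int k"
  shows "exp (\<i> * pi * complex_of_real x) = 1"
proof -
  have "exp (\<i> * pi * complex_of_real x) = cis (2 * pi * of_int k)"
    unfolding assms by (simp add: cis_conv_exp algebra_simps)
  then show ?thesis using cis_multiple_2pi[of "of_int k"] by simp
qed

context
  fixes L :: "'a::euclidean_space set" and u :: 'a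
  assumes L: "self_dual_lattice L"
    and char: "\<And>v. v \<in> L \<Longrightarrow> \<exists>k::int. v \<bullet> v - v \<bullet> u = 2 * of_int k"
begin

lemma theta_translate: "theta L 0 (\<tau> + 1) = theta_char L ((1/2) *\<^sub>R u) \<tau>"
  unfolding theta_def theta_char_def exp_series_def
proof (rule infsum_cong)
  fix v assume v: "v \<in> L"
  obtain k :: int where k: "v \<bullet> v - v \<bullet> u = 2 * of_int k" using char[OF v] by blast
  have "exp (\<i> * pi * (\<tau> + 1) * complex_of_real (v \<bullet> v)) =
     exp (\<i> * pi * complex_of_real (v \<bullet> v - v \<bullet> u)) * (exp (\<i> * pi * complex_of_real (v \<bullet> u)) * exp (\<i> * pi * \<tau> * complex_of_real (v \<bullet> v)))"
    by (simp add: exp_add[symmetric] algebra_simps)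
  also have "exp (\<i> * pi * complex_of_real (v \<bullet> v - v \<bullet> u)) = 1"
    by (rule exp_i_pi_int_even[OF k])
  also have "exp (\<i> * pi * complex_of_real (v \<bullet> u)) = cis (2 * pi * (v \<bullet> ((1/2) *\<^sub>R u)))"
    by (simp add: cis_conv_exp mult_ac)
  finally show "1 * exp (\<i> * pi * (\<tau> + 1) * complex_of_real ((v + 0) \<bullet> (v + 0))) =
     cis (2 * pi * (v \<bullet> ((1/2) *\<^sub>R u))) * exp (\<i> * pi * \<tau> * complex_of_real (v \<bullet> v))"
    by simp
qed

lemma theta_char_translate: "theta_char L ((1/2) *\<^sub>R u) (\<tau> + 1) = theta L 0 \<tau>"
  unfolding theta_def theta_char_def exp_series_def
proof (rule infsum_cong)
  fix v assume v: "v \<in> L"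
  obtain k :: int where k: "v \<bullet> v - v \<bullet> u = 2 * of_int k" using char[OF v] by blast
  obtain m :: int where m: "v \<bullet> v = of_int m" using self_dual_inner[OF L v v] by (auto elim: Ints_cases)
  have e: "v \<bullet> v + v \<bullet> u = 2 * of_int (m - k)" using k m by simp
  have "cis (2 * pi * (v \<bullet> ((1/2) *\<^sub>R u))) * exp (\<i> * pi * (\<tau> + 1) * complex_of_real (v \<bullet> v)) =
     exp (\<i> * pi * complex_of_real (v \<bullet> v + v \<bullet> u)) * exp (\<i> * pi * \<tau> * complex_of_real (v \<bullet> v))"
    by (simp add: cis_conv_exp exp_add[symmetric] algebra_simps)
  also have "exp (\<i> * pi * complex_of_real (v \<bullet> v + v \<bullet> u)) = 1"
    by (rule exp_i_pi_int_even[OF e])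
  finally show "cis (2 * pi * (v \<bullet> ((1/2) *\<^sub>R u))) * exp (\<i> * pi * (\<tau> + 1) * complex_of_real (v \<bullet> v)) =
     1 * exp (\<i> * pi * \<tau> * complex_of_real ((v + 0) \<bullet> (v + 0)))"
    by simp
qed

text \<open>The coset of \<open>L\<close> through half a characteristic vector is the shadow of \<open>L\<close> (for odd \<open>L\<close>). Its theta
function describes the theta function of \<open>L\<close> at the cusp 1.\<close>
lemma shadow_norm_eq:
  "(v + (1/2) *\<^sub>R u) \<bullet> (v + (1/2) *\<^sub>R u) = v \<bullet> v + v \<bullet> u + (u \<bullet> u) / 4"
  by (simp add: inner_add_left inner_add_right inner_commute)

lemma shadow_norm_cong:
  assumes v: "v \<in> L"
  shows "\<exists>j::int. (v + (1/2) *\<^sub>R u) \<bullet> (v + (1/2) *\<^sub>R u) = (u \<bullet> u) / 4 + 2 * of_int j"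
proof -
  obtain k :: int where k: "v \<bullet> v - v \<bullet> u = 2 * of_int k" using char[OF v] by blast
  obtain m :: int where m: "v \<bullet> v = of_int m" using self_dual_inner[OF L v v] by (auto elim: Ints_cases)
  have "v \<bullet> v + v \<bullet> u = 2 * of_int (m - k)" using k m by simp
  then show ?thesis unfolding shadow_norm_eq by (intro exI[of _ "m - k"]) simp
qed

lemma theta_shadow_translate:
  "theta L ((1/2) *\<^sub>R u) (\<tau> + 1) = cis (pi * (u \<bullet> u) / 4) * theta L ((1/2) *\<^sub>R u) \<tau>"
  unfolding theta_def exp_series_def infsum_cmult_right'[symmetric]
proof (rule infsum_cong)
  fix v assume v: "v \<in> L"
  let ?s = "(v + (1/2) *\<^sub>R u) \<bullet> (v + (1/2) *\<^sub>R u)"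
  obtain j :: int where j: "?s = (u \<bullet> u) / 4 + 2 * of_int j" using shadow_norm_cong[OF v] by blast
  have "exp (\<i> * pi * (\<tau> + 1) * complex_of_real ?s) =
     exp (\<i> * pi * complex_of_real ?s) * exp (\<i> * pi * \<tau> * complex_of_real ?s)"
    by (simp add: exp_add[symmetric] algebra_simps)
  also have "exp (\<i> * pi * complex_of_real ?s) = exp (\<i> * pi * complex_of_real (2 * of_int j)) * cis (pi * (u \<bullet> u) / 4)"
  proof -
    have "exp (\<i> * pi * complex_of_real (x + y)) = exp (\<i> * pi * complex_of_real y) * cis (pi * x)" for x y
      by (simp add: cis_conv_exp exp_add[symmetric] algebra_simps)
    then show ?thesis unfolding j by (simp only: times_divide_eq_right)
  qed
  also have "exp (\<i> * pi * complex_of_real (2 * of_int j)) = 1"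
    by (rule exp_i_pi_int_even[OF refl])
  finally show "1 * exp (\<i> * pi * (\<tau> + 1) * complex_of_real ?s) =
    cis (pi * (u \<bullet> u) / 4) * (1 * exp (\<i> * pi * \<tau> * complex_of_real ?s))" by simp
qed

end

lemma self_dual_Ints: "self_dual_lattice (\<int> :: real set)"
proof -
  have "lattice_of_rank DIM(real) (\<int> :: real set)"
    unfolding lattice_of_rank_def
  proof (intro exI[of _ "{1}"] conjI)
    show "\<int> = {\<Sum>b\<in>{1 :: real}. real_of_int (c b) *\<^sub>R b |c. True}"
    proof (intro equalityI subsetI)
      fix x :: real assume "x \<in> \<int>"
      then obtain m where "x = of_int m" by (auto elim: Ints_cases)
      then show "x \<in> {\<Sum>b\<in>{1 :: real}. real_of_int (c b) *\<^sub>R b |c. True}"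
        by (intro CollectI exI[of _ "\<lambda>_. m"] conjI TrueI) simp
    qed auto
  qed auto
  moreover have "dual_lattice (\<int> :: real set) = \<int>"
  proof (intro equalityI subsetI)
    fix v :: real assume "v \<in> dual_lattice \<int>"
    then have "\<forall>w\<in>\<int>. v \<bullet> w \<in> \<int>" by (simp only: dual_lattice_def mem_Collect_eq)
    from bspec[OF this Ints_1] show "v \<in> \<int>" by simp
  qed (auto simp: dual_lattice_def)
  ultimately show ?thesis by (simp add: self_dual_lattice_def)
qed

lemma Ints_characteristic:
  fixes v :: real
  assumes "v \<in> \<int>"
  shows "\<exists>k::int. v \<bullet> v - v \<bullet> 1 = 2 * of_int k"
proof -
  obtain m where m: "v = of_int m" using assms by (auto elim: Ints_cases)
  have "even (m * m - m)" by simp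
  then obtain j where "m * m - m = 2 * j" by (rule dvdE)
  then have "real_of_int (m * m - m) = 2 * of_int j" by simp
  then show ?thesis unfolding m by (intro exI[of _ j]) simp
qed

definition \<theta>\<^sub>2 :: "complex \<Rightarrow> complex" where "\<theta>\<^sub>2 = theta (\<int> :: real set) (1/2)"
definition \<theta>\<^sub>3 :: "complex \<Rightarrow> complex" where "\<theta>\<^sub>3 = theta (\<int> :: real set) 0"
definition \<theta>\<^sub>4 :: "complex \<Rightarrow> complex" where "\<theta>\<^sub>4 = theta_char (\<int> :: real set) (1/2)"

lemma jacobi_holomorphic:
  "\<theta>\<^sub>2 holomorphic_on uhp" "\<theta>\<^sub>3 holomorphic_on uhp" "\<theta>\<^sub>4 holomorphic_on uhp"
  unfolding \<theta>\<^sub>2_def \<theta>\<^sub>3_def \<theta>\<^sub>4_def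
  by (rule theta_holomorphic[OF self_dual_Ints] theta_char_holomorphic[OF self_dual_Ints])+

lemma jacobi_inversion:
  assumes "\<tau> \<in> uhp"
  shows "\<theta>\<^sub>2 (- 1 / \<tau>) = csqrt (- \<i> * \<tau>) * \<theta>\<^sub>4 \<tau>" "\<theta>\<^sub>3 (- 1 / \<tau>) = csqrt (- \<i> * \<tau>) * \<theta>\<^sub>3 \<tau>"
    "\<theta>\<^sub>4 (- 1 / \<tau>) = csqrt (- \<i> * \<tau>) * \<theta>\<^sub>2 \<tau>"
  unfolding \<theta>\<^sub>2_def \<theta>\<^sub>3_def \<theta>\<^sub>4_def
  using theta_inversion[OF self_dual_Ints assms] theta_char_inversion[OF self_dual_Ints assms]
  by (simp_all add: theta_char_0)

lemma jacobi_translate: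
  "\<theta>\<^sub>2 (\<tau> + 1) = cis (pi / 4) * \<theta>\<^sub>2 \<tau>" "\<theta>\<^sub>3 (\<tau> + 1) = \<theta>\<^sub>4 \<tau>" "\<theta>\<^sub>4 (\<tau> + 1) = \<theta>\<^sub>3 \<tau>"
  unfolding \<theta>\<^sub>2_def \<theta>\<^sub>3_def \<theta>\<^sub>4_def
  using theta_shadow_translate[OF self_dual_Ints Ints_characteristic] theta_translate[OF self_dual_Ints Ints_characteristic]
    theta_char_translate[OF self_dual_Ints Ints_characteristic] by simp_all

lemma Ints_square_gap:
  fixes v :: real
  assumes "v \<in> \<int>"
  shows "v = 0 \<or> v\<^sup>2 \<ge> 1"
proof -
  obtain m where m: "v = of_int m" using assms by (auto elim: Ints_cases)
  have "m = 0 \<or> m\<^sup>2 \<ge> 1" by (metis int_one_le_iff_zero_less zero_less_power2)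
  then show ?thesis unfolding m by (metis of_int_0 of_int_1_le_iff of_int_power)
qed

lemma \<theta>\<^sub>3_tendsto: "(\<theta>\<^sub>3 \<longlongrightarrow> 1) at_i_infinity"
proof -
  interpret exp_family "\<int> :: real set" "\<lambda>_. 1" "\<lambda>v. (v + 0) \<bullet> (v + 0)"
    by (rule exp_family_theta[OF self_dual_Ints])
  have "{a \<in> \<int> :: real set. (a + 0) \<bullet> (a + 0) = 0} = {0}" by auto
  then show ?thesis
    using leading_coefficient[of 1 "\<int>" 0] Ints_square_gap
    by (simp add: \<theta>\<^sub>3_def theta_def power2_eq_square cong: conj_cong)
qed

lemma infsum_product:
  fixes f :: "'a \<Rightarrow> complex" and g :: "'b \<Rightarrow> complex"
  assumes f: "(\<lambda>x. norm (f x)) summable_on A" and g: "(\<lambda>y. norm (g y)) summable_on B"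
  shows "(\<lambda>z. f (fst z) * g (snd z)) summable_on A \<times> B"
    and "(\<Sum>\<^sub>\<infinity>x\<in>A. f x) * (\<Sum>\<^sub>\<infinity>y\<in>B. g y) = (\<Sum>\<^sub>\<infinity>z\<in>A \<times> B. f (fst z) * g (snd z))"
proof -
  have "(\<lambda>z. norm (f (fst z)) * norm (g (snd z))) summable_on A \<times> B"
  proof (rule summable_on_SigmaI)
    show "((\<lambda>y. norm (f (fst (x, y))) * norm (g (snd (x, y)))) has_sum norm (f x) * (\<Sum>\<^sub>\<infinity>y\<in>B. norm (g y))) B" for x
      using has_sum_cmult_right[OF has_sum_infsum[OF g]] by simp
    show "(\<lambda>x. norm (f x) * (\<Sum>\<^sub>\<infinity>y\<in>B. norm (g y))) summable_on A"
      by (rule summable_on_cmult_left[OF f])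
  qed simp
  then have "(\<lambda>z. norm (f (fst z) * g (snd z))) summable_on A \<times> B"
    by (simp add: norm_mult)
  then show s: "(\<lambda>z. f (fst z) * g (snd z)) summable_on A \<times> B"
    by (rule abs_summable_summable)
  have "(\<Sum>\<^sub>\<infinity>z\<in>A \<times> B. f (fst z) * g (snd z)) = (\<Sum>\<^sub>\<infinity>x\<in>A. \<Sum>\<^sub>\<infinity>y\<in>B. f x * g y)"
    using infsum_Sigma_banach[OF s] by simp
  also have "\<dots> = (\<Sum>\<^sub>\<infinity>x\<in>A. f x) * (\<Sum>\<^sub>\<infinity>y\<in>B. g y)"
  proof -
    have inner: "(\<Sum>\<^sub>\<infinity>y\<in>B. f x * g y) = f x * (\<Sum>\<^sub>\<infinity>y\<in>B. g y)" for x
      by (rule infsum_cmult_right')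
    show ?thesis unfolding inner by (rule infsum_cmult_left')
  qed
  finally show "(\<Sum>\<^sub>\<infinity>x\<in>A. f x) * (\<Sum>\<^sub>\<infinity>y\<in>B. g y) = (\<Sum>\<^sub>\<infinity>z\<in>A \<times> B. f (fst z) * g (snd z))" ..
qed

lemma cis_pi_of_int: "cis (pi * of_int b) = (if even b then 1 else - 1)"
proof (cases "even b")
  case True
  then obtain k where "b = 2 * k" by (rule dvdE)
  then show ?thesis using cis_multiple_2pi[of "of_int k"] by (simp add: mult_ac)
next
  case False
  then obtain k where k: "b = 2 * k + 1" by (rule oddE)
  have "cis (pi * of_int b) = cis (2 * pi * of_int k) * cis pi"
    unfolding k cis_mult by (simp add: algebra_simps)
  then show ?thesis using cis_multiple_2pi[of "of_int k"] False by simp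
qed

lemma Ints_infsum: "(\<Sum>\<^sub>\<infinity>x\<in>(\<int> :: real set). f x) = (\<Sum>\<^sub>\<infinity>m::int. f (of_int m))"
  unfolding Ints_def by (subst infsum_reindex) (auto simp: o_def inj_def)

text \<open>Expand the left side as a sum over pairs \<open>(a, b)\<close>. Exchanging \<open>a\<close> and \<open>b\<close> flips the sign of the terms
with \<open>a + b\<close> odd, which therefore cancel; the others are parametrized by \<open>a = c + d\<close>, \<open>b = c - d\<close>, where
\<open>a\<^sup>2 + b\<^sup>2 = 2 c\<^sup>2 + 2 d\<^sup>2\<close>.\<close>
theorem \<theta>\<^sub>3_\<theta>\<^sub>4_doubling:
  assumes \<tau>: "\<tau> \<in> uhp"
  shows "\<theta>\<^sub>3 \<tau> * \<theta>\<^sub>4 \<tau> = (\<theta>\<^sub>4 (2 * \<tau>))\<^sup>2"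
proof -
  define sg :: "int \<Rightarrow> complex" where "sg = (\<lambda>b. if even b then 1 else - 1)"
  define F where "F = (\<lambda>\<tau> (m::int). exp (\<i> * pi * \<tau> * of_int (m * m)))"
  have Fsum: "(\<lambda>m. norm (F \<sigma> m)) summable_on UNIV" if "\<sigma> \<in> uhp" for \<sigma>
  proof -
    have "(\<lambda>m::int. exp (- (pi * Im \<sigma> * (of_int m + 0)\<^sup>2))) summable_on UNIV"
      by (rule gaussian_summable_int) (use that in \<open>simp add: uhp_def\<close>)
    then show ?thesis by (simp add: F_def power2_eq_square)
  qed
  have sgF: "(\<lambda>m. norm (sg m * F \<sigma> m)) summable_on UNIV" if "\<sigma> \<in> uhp" for \<sigma>
    using Fsum[OF that] by (rule summable_on_cong[THEN iffD1, rotated]) (simp add: sg_def norm_mult)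
  have t3: "\<theta>\<^sub>3 \<sigma> = (\<Sum>\<^sub>\<infinity>m. F \<sigma> m)" for \<sigma>
    unfolding \<theta>\<^sub>3_def theta_def exp_series_def Ints_infsum F_def by simp
  have t4: "\<theta>\<^sub>4 \<sigma> = (\<Sum>\<^sub>\<infinity>m. sg m * F \<sigma> m)" for \<sigma>
    unfolding \<theta>\<^sub>4_def theta_char_def exp_series_def Ints_infsum F_def sg_def cis_pi_of_int[symmetric] by simp
  define h where "h = (\<lambda>z. F \<tau> (fst z) * (sg (snd z) * F \<tau> (snd z)))"
  have hs: "h summable_on UNIV \<times> UNIV" unfolding h_def by (rule infsum_product(1)[OF Fsum[OF \<tau>] sgF[OF \<tau>]])
  have hs': "h summable_on X" for X by (rule summable_on_subset_banach[OF hs]) auto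
  define E where "E = {z :: int \<times> int. even (fst z + snd z)}"
  have "\<theta>\<^sub>3 \<tau> * \<theta>\<^sub>4 \<tau> = infsum h (UNIV \<times> UNIV)"
    unfolding t3 t4 h_def by (rule infsum_product(2)[OF Fsum[OF \<tau>] sgF[OF \<tau>]])
  also have "UNIV \<times> UNIV = E \<union> - E" by auto
  also have "infsum h (E \<union> - E) = infsum h E + infsum h (- E)"
    by (rule infsum_Un_disjoint[OF hs' hs']) auto
  also have "infsum h (- E) = 0"
  proof -
    have bij: "bij_betw (\<lambda>z. (snd z, fst z)) (- E) (- E)"
      by (rule bij_betw_byWitness[where f' = "\<lambda>z. (snd z, fst z)"]) (auto simp: E_def add.commute)
    have "infsum h (- E) = (\<Sum>\<^sub>\<infinity>z\<in>- E. h (snd z, fst z))"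
      by (rule infsum_reindex_bij_betw[OF bij, symmetric])
    also have "\<dots> = (\<Sum>\<^sub>\<infinity>z\<in>- E. - h z)"
      by (rule infsum_cong) (auto simp: h_def E_def sg_def)
    also have "\<dots> = - infsum h (- E)" by (rule infsum_uminus)
    finally show ?thesis by simp
  qed
  also have "infsum h E = (\<Sum>\<^sub>\<infinity>z\<in>UNIV \<times> UNIV. h (fst z + snd z, fst z - snd z))"
  proof -
    have bij: "bij_betw (\<lambda>z::int\<times>int. (fst z + snd z, fst z - snd z)) (UNIV \<times> UNIV) E"
    proof (rule bij_betw_byWitness[where f' = "\<lambda>z. ((fst z + snd z) div 2, (fst z - snd z) div 2)"])
      show "\<forall>z\<in>E. (fst ((fst z + snd z) div 2, (fst z - snd z) div 2) + snd ((fst z + snd z) div 2, (fst z - snd z) div 2),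
          fst ((fst z + snd z) div 2, (fst z - snd z) div 2) - snd ((fst z + snd z) div 2, (fst z - snd z) div 2)) = z"
      proof
        fix z assume "z \<in> E"
        then have "2 dvd fst z + snd z" by (simp only: E_def mem_Collect_eq)
        then obtain k where k: "fst z + snd z = 2 * k" by (rule dvdE)
        then have "fst z - snd z = 2 * (k - snd z)" by simp
        then have "(fst z - snd z) div 2 = k - snd z" by simp
        moreover have "(fst z + snd z) div 2 = k" using k by simp
        ultimately show "(fst ((fst z + snd z) div 2, (fst z - snd z) div 2) + snd ((fst z + snd z) div 2, (fst z - snd z) div 2),
          fst ((fst z + snd z) div 2, (fst z - snd z) div 2) - snd ((fst z + snd z) div 2, (fst z - snd z) div 2)) = z"
          using k by (simp add: prod_eq_iff)
      qed
    qed (auto simp: E_def)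
    show ?thesis by (rule infsum_reindex_bij_betw[OF bij, symmetric])
  qed
  also have "\<dots> = (\<Sum>\<^sub>\<infinity>z\<in>UNIV \<times> UNIV. (sg (fst z) * F (2 * \<tau>) (fst z)) * (sg (snd z) * F (2 * \<tau>) (snd z)))"
  proof (rule infsum_cong)
    fix z :: "int \<times> int"
    obtain c d where z: "z = (c, d)" by (cases z)
    have "F \<tau> (c + d) * F \<tau> (c - d) = F (2 * \<tau>) c * F (2 * \<tau>) d"
      by (simp add: F_def exp_add[symmetric] algebra_simps)
    moreover have "sg (c - d) = sg c * sg d" by (simp add: sg_def)
    ultimately show "h (fst z + snd z, fst z - snd z) = (sg (fst z) * F (2 * \<tau>) (fst z)) * (sg (snd z) * F (2 * \<tau>) (snd z))"
      by (simp add: h_def z mult_ac)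
  qed
  also have "\<dots> = \<theta>\<^sub>4 (2 * \<tau>) * \<theta>\<^sub>4 (2 * \<tau>)"
  proof -
    have "2 * \<tau> \<in> uhp" using \<tau> by (simp add: uhp_def)
    then show ?thesis unfolding t4 by (intro infsum_product(2)[symmetric] sgF)
  qed
  finally show ?thesis by (simp add: power2_eq_square)
qed

text \<open>By the doubling identity a zero at \<open>\<sigma>\<close> would produce a zero at \<open>2 \<sigma> + 1\<close>, whose imaginary part is
twice as large. Iterating contradicts the limit 1 at infinity.\<close>
lemma \<theta>\<^sub>3_nonzero:
  assumes "\<tau> \<in> uhp"
  shows "\<theta>\<^sub>3 \<tau> \<noteq> 0"
proof
  assume zero: "\<theta>\<^sub>3 \<tau> = 0"
  have step: "\<theta>\<^sub>3 (2 * \<sigma> + 1) = 0" if "\<sigma> \<in> uhp" "\<theta>\<^sub>3 \<sigma> = 0" for \<sigma>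
    using \<theta>\<^sub>3_\<theta>\<^sub>4_doubling[OF that(1)] that(2) by (simp add: jacobi_translate)
  define s where "s = (\<lambda>k. ((\<lambda>\<sigma>. 2 * \<sigma> + 1) ^^ k) \<tau>)"
  have s: "s k \<in> uhp \<and> Im (s k) = 2 ^ k * Im \<tau> \<and> \<theta>\<^sub>3 (s k) = 0" for k
  proof (induction k)
    case 0
    then show ?case using assms zero by (simp add: s_def)
  next
    case (Suc k)
    have "s (Suc k) = 2 * s k + 1" by (simp add: s_def)
    then show ?case using Suc step[of "s k"] by (simp add: uhp_def)
  qed
  have "eventually (\<lambda>\<sigma>. \<theta>\<^sub>3 \<sigma> \<noteq> 0) at_i_infinity"
    by (rule tendsto_imp_eventually_ne[OF \<theta>\<^sub>3_tendsto]) simp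
  then obtain N where N: "\<And>\<sigma>. Im \<sigma> > N \<Longrightarrow> \<theta>\<^sub>3 \<sigma> \<noteq> 0"
    unfolding eventually_filtercomap_at_top_dense by blast
  have pos: "Im \<tau> > 0" using assms by (simp add: uhp_def)
  obtain k where "N / Im \<tau> < 2 ^ k"
    using real_arch_pow[of 2 "N / Im \<tau>"] by auto
  then have "N < Im (s k)" using s[of k] pos by (simp add: divide_less_eq)
  then show False using N s by blast
qed

lemma \<theta>\<^sub>4_nonzero: "\<tau> \<in> uhp \<Longrightarrow> \<theta>\<^sub>4 \<tau> \<noteq> 0"
  using \<theta>\<^sub>3_nonzero[of "\<tau> + 1"] by (simp add: jacobi_translate uhp_def)

lemma \<theta>\<^sub>2_nonzero:
  assumes "\<tau> \<in> uhp"
  shows "\<theta>\<^sub>2 \<tau> \<noteq> 0"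
  using \<theta>\<^sub>4_nonzero[OF uhp_inversion[OF assms]] jacobi_inversion(3)[OF assms] by auto

section \<open>Behaviour at the cusp 1\<close>

lemma csqrt_neq_0: "\<tau> \<in> uhp \<Longrightarrow> csqrt (- \<i> * \<tau>) \<noteq> 0"
  using uhp_not_zero by auto

lemma uhp_cusp: "\<tau> \<in> uhp \<Longrightarrow> 1 - 1 / \<tau> \<in> uhp"
  using uhp_inversion[of \<tau>] by (simp add: uhp_def)

text \<open>The relation in the modular group which says that a function invariant under \<open>- 1 / \<tau>\<close> and
\<open>\<tau> + 2\<close> becomes invariant under \<open>\<tau> - 1\<close> in the coordinate \<open>1 - 1 / \<tau>\<close> at the cusp 1.\<close>
lemma cusp_relation:
  assumes "\<tau> \<in> uhp"
  shows "- 1 / (1 - 1 / \<tau>) + 2 = 1 - 1 / (\<tau> - 1)"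
proof -
  have "\<tau> \<noteq> 0" "\<tau> \<noteq> 1" using assms by (auto simp: uhp_def)
  then show ?thesis by (simp add: field_simps)
qed

lemma jacobi_cusp:
  assumes "\<tau> \<in> uhp"
  shows "\<theta>\<^sub>2 (1 - 1 / \<tau>) = cis (pi / 4) * (csqrt (- \<i> * \<tau>) * \<theta>\<^sub>4 \<tau>)"
    "\<theta>\<^sub>3 (1 - 1 / \<tau>) = csqrt (- \<i> * \<tau>) * \<theta>\<^sub>2 \<tau>"
    "\<theta>\<^sub>4 (1 - 1 / \<tau>) = csqrt (- \<i> * \<tau>) * \<theta>\<^sub>3 \<tau>"
proof -
  have e: "1 - 1 / \<tau> = - 1 / \<tau> + 1" by simp
  show "\<theta>\<^sub>2 (1 - 1 / \<tau>) = cis (pi / 4) * (csqrt (- \<i> * \<tau>) * \<theta>\<^sub>4 \<tau>)"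
    "\<theta>\<^sub>3 (1 - 1 / \<tau>) = csqrt (- \<i> * \<tau>) * \<theta>\<^sub>2 \<tau>"
    "\<theta>\<^sub>4 (1 - 1 / \<tau>) = csqrt (- \<i> * \<tau>) * \<theta>\<^sub>3 \<tau>"
    unfolding e jacobi_translate jacobi_inversion[OF assms] by simp_all
qed

lemma theta_cusp:
  fixes L :: "'a::euclidean_space set"
  assumes L: "self_dual_lattice L"
    and char: "\<And>v. v \<in> L \<Longrightarrow> \<exists>k::int. v \<bullet> v - v \<bullet> u = 2 * of_int k"
    and \<tau>: "\<tau> \<in> uhp"
  shows "theta L 0 (1 - 1 / \<tau>) = csqrt (- \<i> * \<tau>) ^ DIM('a) * theta L ((1/2) *\<^sub>R u) \<tau>"
proof -
  have "theta L 0 (- 1 / \<tau> + 1) = theta_char L ((1/2) *\<^sub>R u) (- 1 / \<tau>)"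
    by (rule theta_translate[OF L char])
  then show ?thesis using theta_char_inversion[OF L \<tau>] by simp
qed

text \<open>The quotient of the theta functions of \<open>L\<close> and of the standard lattice of the same rank is invariant
under the theta group, so the corresponding quotient of shadow theta functions has period 1. But that
translation multiplies its numerator and denominator by the eighth roots of unity with exponents
\<open>u \<bullet> u\<close> and the rank.\<close>
theorem characteristic_norm_cong:
  fixes L :: "'a::euclidean_space set"
  assumes L: "self_dual_lattice L"
    and char: "\<And>v. v \<in> L \<Longrightarrow> \<exists>k::int. v \<bullet> v - v \<bullet> u = 2 * of_int k"
  shows "\<exists>k::int. u \<bullet> u = real DIM('a) + 8 * of_int k"
proof -
  let ?n = "DIM('a)" and ?S = "theta L ((1/2) *\<^sub>R u)"
  define F where "F = (\<lambda>\<tau>. theta L 0 \<tau> / \<theta>\<^sub>3 \<tau> ^ ?n)"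
  have FS: "F (- 1 / \<tau>) = F \<tau>" if "\<tau> \<in> uhp" for \<tau>
    unfolding F_def jacobi_inversion[OF that] theta_inversion[OF L that] theta_char_0
    using csqrt_neq_0[OF that] by (simp add: power_mult_distrib)
  have FT: "F (\<tau> + 2) = F \<tau>" for \<tau>
  proof -
    have "theta L 0 (\<tau> + 2) = theta L 0 \<tau>" "\<theta>\<^sub>3 (\<tau> + 2) = \<theta>\<^sub>3 \<tau>"
      using theta_translate[OF L char, of "\<tau> + 1"] theta_char_translate[OF L char, of \<tau>]
        jacobi_translate(2)[of "\<tau> + 1"] jacobi_translate(3)[of \<tau>] by (simp_all add: add.assoc)
    then show ?thesis by (simp add: F_def)
  qed
  have R: "F (1 - 1 / \<tau>) = ?S \<tau> / \<theta>\<^sub>2 \<tau> ^ ?n" if "\<tau> \<in> uhp" for \<tau>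
  proof -
    have cusp: "theta L 0 (1 - 1 / \<tau>) = csqrt (- \<i> * \<tau>) ^ ?n * ?S \<tau>"
      by (rule theta_cusp[OF L char that])
    show ?thesis
      unfolding F_def jacobi_cusp[OF that] cusp
      using csqrt_neq_0[OF that] by (simp add: power_mult_distrib)
  qed
  have shift: "F (1 - 1 / (\<tau> - 1)) = F (1 - 1 / \<tau>)" if "\<tau> \<in> uhp" for \<tau>
    unfolding cusp_relation[OF that, symmetric] FT using FS[OF uhp_cusp[OF that]] by simp
  have i: "\<i> \<in> uhp" "\<i> + 1 \<in> uhp" by (simp_all add: uhp_def)
  have "?S (\<i> + 1) / \<theta>\<^sub>2 (\<i> + 1) ^ ?n = ?S \<i> / \<theta>\<^sub>2 \<i> ^ ?n"
    using shift[OF i(2)] R[OF i(1)] R[OF i(2)] by simp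
  moreover have "?S \<i> \<noteq> 0"
  proof -
    have "?S \<i> = complex_of_real (\<Sum>\<^sub>\<infinity>v\<in>L. exp (- (pi * 1 * ((v + (1/2) *\<^sub>R u) \<bullet> (v + (1/2) *\<^sub>R u)))))"
    proof -
      have "\<i> * pi * \<i> * complex_of_real y = complex_of_real (- (pi * 1 * y))" for y
        by (simp add: complex_eq_iff)
      then show ?thesis unfolding theta_def exp_series_def infsum_of_real[symmetric] by (simp only: exp_of_real mult_1)
    qed
    moreover have "(\<Sum>v\<in>{0::'a}. exp (- (pi * 1 * ((v + (1/2) *\<^sub>R u) \<bullet> (v + (1/2) *\<^sub>R u)))))
       \<le> (\<Sum>\<^sub>\<infinity>v\<in>L. exp (- (pi * 1 * ((v + (1/2) *\<^sub>R u) \<bullet> (v + (1/2) *\<^sub>R u)))))"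
      by (rule finite_sum_le_infsum[OF self_dual_summable[OF L]]) (use self_dual_zero[OF L] in auto)
    then have "(\<Sum>\<^sub>\<infinity>v\<in>L. exp (- (pi * 1 * ((v + (1/2) *\<^sub>R u) \<bullet> (v + (1/2) *\<^sub>R u))))) > 0"
      by (rule less_le_trans[rotated]) simp
    ultimately show ?thesis by simp
  qed
  moreover have "?S (\<i> + 1) = cis (pi * (u \<bullet> u) / 4) * ?S \<i>"
    by (rule theta_shadow_translate[OF L char])
  ultimately have "cis (pi * (u \<bullet> u) / 4) = cis (pi / 4) ^ ?n"
    using \<theta>\<^sub>2_nonzero[OF i(1)] by (simp add: jacobi_translate power_mult_distrib field_simps)
  also have "\<dots> = cis (?n * (pi / 4))" by (rule Complex.DeMoivre)
  finally have "cis (pi * (u \<bullet> u) / 4) / cis (?n * (pi / 4)) = 1"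
    using divide_self[OF cis_neq_zero[of "?n * (pi / 4)"]] by (simp only:)
  then have "cis (pi * (u \<bullet> u) / 4 - ?n * (pi / 4)) = 1"
    by (simp only: cis_divide)
  then obtain k :: int where "pi * (u \<bullet> u) / 4 - ?n * (pi / 4) = 2 * pi * of_int k"
    unfolding cis_conv_exp exp_eq_1 by (auto simp: mult_ac)
  then have "pi * (u \<bullet> u) = pi * (real ?n + 8 * of_int k)" by (simp add: algebra_simps)
  then have "u \<bullet> u = real ?n + 8 * of_int k" by simp
  then show ?thesis by blast
qed

section \<open>Second-order expansions at infinity\<close>

text \<open>The expansion \<open>a + b q + c q\<^sup>2 + o(q\<^sup>2)\<close> in the nome \<open>q\<close>. Stated as a limit it needs no analyticity in
\<open>q\<close>, and it is closed under the arithmetic operations.\<close>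
definition jet2 :: "(complex \<Rightarrow> complex) \<Rightarrow> complex \<Rightarrow> complex \<Rightarrow> complex \<Rightarrow> bool" where
  "jet2 f a b c \<longleftrightarrow> ((\<lambda>\<tau>. (f \<tau> - a - b * nome \<tau>) / nome \<tau> ^ 2) \<longlongrightarrow> c) at_i_infinity"

lemma jet2_tendsto:
  assumes "jet2 f a b c"
  shows "(f \<longlongrightarrow> a) at_i_infinity"
proof -
  have "((\<lambda>\<tau>. a + b * nome \<tau> + (f \<tau> - a - b * nome \<tau>) / nome \<tau> ^ 2 * nome \<tau> ^ 2) \<longlongrightarrow> a + b * 0 + c * 0 ^ 2) at_i_infinity"
    using assms unfolding jet2_def by (intro tendsto_intros nome_tendsto_0)
  then show ?thesis by simp
qed

lemma jet2_const: "jet2 (\<lambda>_. a) a 0 0"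
  by (simp add: jet2_def)

lemma jet2_nome: "jet2 nome 0 1 0"
  by (simp add: jet2_def)

lemma jet2_diff:
  assumes "jet2 f a b c" "jet2 g a' b' c'"
  shows "jet2 (\<lambda>\<tau>. f \<tau> - g \<tau>) (a - a') (b - b') (c - c')"
proof -
  have "((\<lambda>\<tau>. (f \<tau> - a - b * nome \<tau>) / nome \<tau> ^ 2 - (g \<tau> - a' - b' * nome \<tau>) / nome \<tau> ^ 2) \<longlongrightarrow> c - c') at_i_infinity"
    using assms unfolding jet2_def by (intro tendsto_intros)
  moreover have "(f \<tau> - a - b * nome \<tau>) / nome \<tau> ^ 2 - (g \<tau> - a' - b' * nome \<tau>) / nome \<tau> ^ 2 =
      (f \<tau> - g \<tau> - (a - a') - (b - b') * nome \<tau>) / nome \<tau> ^ 2" for \<tau>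
    unfolding diff_divide_distrib[symmetric] by (simp add: algebra_simps)
  ultimately show ?thesis unfolding jet2_def by simp
qed

lemma jet2_mult:
  assumes "jet2 f a b c" "jet2 g a' b' c'"
  shows "jet2 (\<lambda>\<tau>. f \<tau> * g \<tau>) (a * a') (a * b' + b * a') (a * c' + b * b' + c * a')"
proof -
  define r where "r = (\<lambda>\<tau>. (f \<tau> - a - b * nome \<tau>) / nome \<tau> ^ 2)"
  define s where "s = (\<lambda>\<tau>. (g \<tau> - a' - b' * nome \<tau>) / nome \<tau> ^ 2)"
  have f: "f \<tau> = a + b * nome \<tau> + r \<tau> * nome \<tau> ^ 2" and g: "g \<tau> = a' + b' * nome \<tau> + s \<tau> * nome \<tau> ^ 2" for \<tau>
    by (simp_all add: r_def s_def)
  have "(r \<longlongrightarrow> c) at_i_infinity" "(s \<longlongrightarrow> c') at_i_infinity"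
    using assms by (simp_all add: jet2_def r_def s_def)
  then have "((\<lambda>\<tau>. a * s \<tau> + b * b' + r \<tau> * a' + (b * s \<tau> + r \<tau> * b') * nome \<tau> + r \<tau> * s \<tau> * nome \<tau> ^ 2)
      \<longlongrightarrow> a * c' + b * b' + c * a' + (b * c' + c * b') * 0 + c * c' * 0 ^ 2) at_i_infinity"
    by (intro tendsto_intros nome_tendsto_0)
  moreover have "(f \<tau> * g \<tau> - a * a' - (a * b' + b * a') * nome \<tau>) / nome \<tau> ^ 2 =
      a * s \<tau> + b * b' + r \<tau> * a' + (b * s \<tau> + r \<tau> * b') * nome \<tau> + r \<tau> * s \<tau> * nome \<tau> ^ 2" for \<tau>
    unfolding f g by (simp add: divide_eq_eq algebra_simps power2_eq_square)
  ultimately show ?thesis unfolding jet2_def by simp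
qed

lemma jet2_power:
  assumes "jet2 f 1 b c"
  shows "jet2 (\<lambda>\<tau>. f \<tau> ^ n) 1 (of_nat n * b) (of_nat n * c + of_nat n * (of_nat n - 1) / 2 * b\<^sup>2)"
proof (induction n)
  case 0
  then show ?case using jet2_const[of 1] by simp
next
  case (Suc n)
  show ?case
    using jet2_mult[OF assms Suc.IH] by (simp add: field_simps power2_eq_square)
qed

lemma jet2_inverse:
  assumes "jet2 f 1 b c"
  shows "jet2 (\<lambda>\<tau>. 1 / f \<tau>) 1 (- b) (b\<^sup>2 - c)"
proof -
  define r where "r = (\<lambda>\<tau>. (f \<tau> - 1 - b * nome \<tau>) / nome \<tau> ^ 2)"
  have f: "f \<tau> = 1 + b * nome \<tau> + r \<tau> * nome \<tau> ^ 2" for \<tau>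
    by (simp add: r_def)
  have r: "(r \<longlongrightarrow> c) at_i_infinity" using assms by (simp add: jet2_def r_def)
  have lim: "((\<lambda>\<tau>. (b\<^sup>2 - r \<tau> + b * r \<tau> * nome \<tau>) / f \<tau>) \<longlongrightarrow> (b\<^sup>2 - c + b * c * 0) / 1) at_i_infinity"
    by (intro tendsto_intros r nome_tendsto_0 jet2_tendsto[OF assms]) simp
  have "eventually (\<lambda>\<tau>. f \<tau> \<noteq> 0) at_i_infinity"
    by (rule tendsto_imp_eventually_ne[OF jet2_tendsto[OF assms]]) simp
  then have "eventually (\<lambda>\<tau>. (b\<^sup>2 - r \<tau> + b * r \<tau> * nome \<tau>) / f \<tau> = (1 / f \<tau> - 1 - (- b) * nome \<tau>) / nome \<tau> ^ 2) at_i_infinity"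
  proof eventually_elim
    case (elim \<tau>)
    have "1 / f \<tau> - 1 - (- b) * nome \<tau> = (1 - f \<tau> + b * nome \<tau> * f \<tau>) / f \<tau>"
      using elim by (simp add: field_simps)
    also have "1 - f \<tau> + b * nome \<tau> * f \<tau> = (b\<^sup>2 - r \<tau> + b * r \<tau> * nome \<tau>) * nome \<tau> ^ 2"
      unfolding f by (simp add: algebra_simps power2_eq_square)
    finally show ?case by simp
  qed
  from Lim_transform_eventually[OF lim this] show ?thesis
    unfolding jet2_def by simp
qed

lemma (in exp_family) jet2_exp_series:
  assumes int: "\<And>a. a \<in> A \<Longrightarrow> e a \<in> \<int>"
  shows "jet2 (exp_series A c e) (\<Sum>a\<in>{a\<in>A. e a = 0}. c a) (\<Sum>a\<in>{a\<in>A. e a = 1}. c a) (\<Sum>a\<in>{a\<in>A. e a = 2}. c a)"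
proof -
  define A2 where "A2 = {a \<in> A. e a \<ge> 2}"
  let ?L = "\<lambda>k. {a \<in> A. e a = k}"
  have cases: "e a = 0 \<or> e a = 1 \<or> e a = 2 \<or> e a \<ge> 3" if a: "a \<in> A" for a
  proof -
    obtain m where m: "e a = of_int m" using int[OF a] by (auto elim: Ints_cases)
    then have "m \<ge> 0" using nonneg[OF a] by simp
    then have "m = 0 \<or> m = 1 \<or> m = 2 \<or> m \<ge> 3" by linarith
    then show ?thesis unfolding m by auto
  qed
  have A: "A = ?L 0 \<union> (?L 1 \<union> A2)" using cases by (force simp: A2_def)
  have lim: "((\<lambda>\<tau>. exp (- (\<i> * pi * \<tau> * complex_of_real 2)) * exp_series A2 c e \<tau>) \<longlongrightarrow> (\<Sum>a\<in>{a\<in>A2. e a = 2}. c a)) at_i_infinity"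
    by (rule leading_coefficient[of 1]) (use cases in \<open>force simp: A2_def\<close>)+
  have "eventually (\<lambda>\<tau>. exp (- (\<i> * pi * \<tau> * complex_of_real 2)) * exp_series A2 c e \<tau> =
      (exp_series A c e \<tau> - (\<Sum>a\<in>?L 0. c a) - (\<Sum>a\<in>?L 1. c a) * nome \<tau>) / nome \<tau> ^ 2) at_i_infinity"
    using eventually_uhp
  proof eventually_elim
    case (elim \<tau>)
    let ?f = "\<lambda>a. c a * exp (\<i> * pi * \<tau> * e a)"
    have s: "?f summable_on X" if "X \<subseteq> A" for X by (rule summable[OF elim that])
    have "exp_series A c e \<tau> = infsum ?f (?L 0 \<union> (?L 1 \<union> A2))"
      unfolding exp_series_def by (subst (1) A) (rule refl)
    also have "\<dots> = infsum ?f (?L 0) + infsum ?f (?L 1 \<union> A2)"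
      by (rule infsum_Un_disjoint[OF s s]) (auto simp: A2_def)
    also have "infsum ?f (?L 1 \<union> A2) = infsum ?f (?L 1) + infsum ?f A2"
      by (rule infsum_Un_disjoint[OF s s]) (auto simp: A2_def)
    also have "infsum ?f (?L 0) = (\<Sum>a\<in>?L 0. c a)"
      using finite_level[of 0] by simp
    also have "infsum ?f (?L 1) = (\<Sum>a\<in>?L 1. c a) * nome \<tau>"
      using finite_level[of 1] by (simp add: nome_def sum_distrib_right)
    finally have "exp_series A c e \<tau> - (\<Sum>a\<in>?L 0. c a) - (\<Sum>a\<in>?L 1. c a) * nome \<tau> = exp_series A2 c e \<tau>"
      by (simp add: exp_series_def)
    moreover have "exp (- (\<i> * pi * \<tau> * complex_of_real 2)) = 1 / nome \<tau> ^ 2"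
      by (simp add: nome_def exp_minus exp_of_nat_mult[symmetric] divide_inverse mult_ac)
    ultimately show ?case by simp
  qed
  from Lim_transform_eventually[OF lim this]
  have "jet2 (exp_series A c e) (\<Sum>a\<in>?L 0. c a) (\<Sum>a\<in>?L 1. c a) (\<Sum>a\<in>{a\<in>A2. e a = 2}. c a)"
    unfolding jet2_def .
  moreover have "{a\<in>A2. e a = 2} = ?L 2" by (auto simp: A2_def)
  ultimately show ?thesis by simp
qed

lemma Ints_square_eq_1: "{v \<in> \<int>. v * v = (1::real)} = {1, - 1}"
  by (auto simp: square_eq_1_iff)

lemma Ints_square_eq_2: "{v \<in> \<int>. v * v = (2::real)} = {}"
proof -
  have False if v: "v \<in> \<int>" "v * v = (2::real)" for v
  proof -
    obtain m where m: "v = of_int m" using v(1) by (auto elim: Ints_cases)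
    have "real_of_int (m * m) = real_of_int 2" using v(2) m by simp
    then have mm: "m * m = 2" by (simp only: of_int_eq_iff)
    have "\<bar>m\<bar> < 2"
    proof (rule ccontr)
      assume "\<not> \<bar>m\<bar> < 2"
      then have "2 * 2 \<le> \<bar>m\<bar> * \<bar>m\<bar>" by (intro mult_mono) auto
      then show False using mm by (simp add: abs_mult[symmetric])
    qed
    then have "m = 0 \<or> m = 1 \<or> m = - 1" by linarith
    then show False using mm by auto
  qed
  then show ?thesis by blast
qed

lemma jet2_\<theta>\<^sub>3: "jet2 \<theta>\<^sub>3 1 2 0"
proof -
  interpret exp_family "\<int> :: real set" "\<lambda>_. 1" "\<lambda>v. (v + 0) \<bullet> (v + 0)"
    by (rule exp_family_theta[OF self_dual_Ints])
  have l0: "{v \<in> \<int>. v * v = (0::real)} = {0}" by auto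
  show ?thesis
    using jet2_exp_series unfolding \<theta>\<^sub>3_def theta_def
    by (simp add: l0 Ints_square_eq_1 Ints_square_eq_2 cong: conj_cong)
qed

lemma jet2_\<theta>\<^sub>4: "jet2 \<theta>\<^sub>4 1 (- 2) 0"
proof -
  interpret exp_family "\<int> :: real set" "\<lambda>v. cis (2 * pi * (v \<bullet> (1/2)))" "\<lambda>v. v \<bullet> v"
    by (rule exp_family_theta_char[OF self_dual_Ints])
  have l0: "{v \<in> \<int>. v * v = (0::real)} = {0}" by auto
  have "cis (- pi) = - 1" by (simp add: complex_eq_iff)
  then show ?thesis
    using jet2_exp_series unfolding \<theta>\<^sub>4_def theta_char_def
    by (simp add: l0 Ints_square_eq_1 Ints_square_eq_2 cong: conj_cong)
qed

text \<open>The Jacobi function \<open>\<theta>\<^sub>2\<close> starts with twice the fourth root of the nome; dividing by this term leaves a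
series in integral powers with constant term 1.\<close>
definition \<psi> :: "complex \<Rightarrow> complex" where
  "\<psi> \<tau> = exp (- (\<i> * pi * \<tau> / 4)) * \<theta>\<^sub>2 \<tau> / 2"

lemma \<theta>\<^sub>2_eq_\<psi>: "\<theta>\<^sub>2 \<tau> = 2 * \<psi> \<tau> * exp (\<i> * pi * \<tau> / 4)"
  by (simp add: \<psi>_def exp_minus)

lemma \<theta>\<^sub>2_power_4: "\<theta>\<^sub>2 \<tau> ^ 4 = 16 * nome \<tau> * \<psi> \<tau> ^ 4"
proof -
  have "exp (\<i> * pi * \<tau> / 4) ^ 4 = nome \<tau>"
    by (simp add: nome_def exp_of_nat_mult[symmetric])
  then show ?thesis unfolding \<theta>\<^sub>2_eq_\<psi> by (simp add: power_mult_distrib)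
qed

lemma jet2_\<psi>: "jet2 \<psi> 1 0 1"
proof -
  let ?e = "\<lambda>v::real. v * v + v"
  have e: "(v + 1/2) \<bullet> (v + 1/2) = ?e v + 1/4" for v :: real
    by (simp add: algebra_simps)

  have nn: "0 \<le> ?e v" if v: "v \<in> \<int>" for v
  proof -
    obtain m where m: "v = of_int m" using v by (auto elim: Ints_cases)
    have "m * (m + 1) \<ge> 0" by (cases "m \<ge> 0") (auto simp: zero_le_mult_iff)
    then have "real_of_int (m * (m + 1)) \<ge> 0" by (simp only: of_int_0_le_iff)
    then show ?thesis unfolding m by (simp add: algebra_simps)
  qed
  have gs: "(\<lambda>v. exp (- (pi * t * ?e v))) summable_on \<int>" if "t > 0" for t :: real
  proof -
    have "(\<lambda>v. exp (pi * t / 4) * exp (- (pi * t * ((v + 1/2) \<bullet> (v + 1/2))))) summable_on (\<int> :: real set)"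
      by (intro summable_on_cmult_right self_dual_summable[OF self_dual_Ints that])
    also have "(\<lambda>v::real. exp (pi * t / 4) * exp (- (pi * t * ((v + 1/2) \<bullet> (v + 1/2))))) = (\<lambda>v. exp (- (pi * t * ?e v)))"
      unfolding e by (simp add: exp_add[symmetric] algebra_simps)
    finally show ?thesis .
  qed
  interpret exp_family "\<int> :: real set" "\<lambda>_. 1/2" ?e
    by unfold_locales (auto simp: nn intro!: gs)
  have "\<psi> \<tau> = exp_series \<int> (\<lambda>_. 1/2) ?e \<tau>" for \<tau>
  proof -
    have 1: "exp (\<i> * pi * \<tau> * complex_of_real (?e v)) = exp (- (\<i> * pi * \<tau> / 4)) * exp (\<i> * pi * \<tau> * complex_of_real ((v + 1/2) \<bullet> (v + 1/2)))"
      for v :: real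
      unfolding e by (simp add: exp_add[symmetric] algebra_simps)
    have "exp_series \<int> (\<lambda>_. 1/2) ?e \<tau> = 1/2 * (exp (- (\<i> * pi * \<tau> / 4)) *
        (\<Sum>\<^sub>\<infinity>v\<in>(\<int> :: real set). exp (\<i> * pi * \<tau> * complex_of_real ((v + 1/2) \<bullet> (v + 1/2)))))"
      unfolding exp_series_def 1 infsum_cmult_right' ..
    then show ?thesis
      unfolding \<psi>_def \<theta>\<^sub>2_def theta_def exp_series_def mult_1 by (simp only: times_divide_eq_left mult_1)
  qed
  then have \<psi>: "\<psi> = exp_series \<int> (\<lambda>_. 1/2) ?e" by blast
  have l0: "{v \<in> \<int>. ?e v = 0} = {0, - 1}"
  proof -
    have "?e v = v * (v + 1)" for v :: real by (simp add: algebra_simps)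
    then have "?e v = 0 \<longleftrightarrow> v = 0 \<or> v = - 1" for v :: real
      by (simp only: mult_eq_0_iff eq_neg_iff_add_eq_0)
    then show ?thesis by auto
  qed
  have l1: "{v \<in> \<int>. ?e v = 1} = {}"
  proof -
    have False if v: "v \<in> \<int>" "?e v = 1" for v
    proof -
      obtain m where m: "v = of_int m" using v(1) by (auto elim: Ints_cases)
      have "real_of_int (m * m + m) = real_of_int 1" using v(2) m by simp
      then have mm: "m * m + m = 1" by (simp only: of_int_eq_iff)
      have "even (m * m + m)" by simp
      then show False using mm by simp
    qed
    then show ?thesis by blast
  qed
  have l2: "{v \<in> \<int>. ?e v = 2} = {1, - 2}"
  proof -
    have "?e v - 2 = (v - 1) * (v + 2)" for v :: real by (simp add: algebra_simps)
    then have "?e v - 2 = 0 \<longleftrightarrow> v = 1 \<or> v = - 2" for v :: real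
      by (simp only: mult_eq_0_iff eq_neg_iff_add_eq_0 right_minus_eq)
    then have "?e v = 2 \<longleftrightarrow> v = 1 \<or> v = - 2" for v :: real
      by (simp only: right_minus_eq)
    then show ?thesis by auto
  qed
  have "?e a \<in> \<int>" if "a \<in> \<int>" for a using that by simp
  from jet2_exp_series[OF this] show ?thesis
    unfolding \<psi>[symmetric] l0 l1 l2 by simp
qed

section \<open>A residue theorem for the theta group\<close>

text \<open>If \<open>f\<close> tends to \<open>c\<close>, then \<open>F \<tau> - c * \<tau>\<close> is almost constant high up in the half-plane, while its
increment under the translation does not depend on \<open>\<tau>\<close>.\<close>
lemma primitive_increment:
  fixes F f :: "complex \<Rightarrow> complex" and s :: real
  assumes deriv: "\<And>\<tau>. \<tau> \<in> uhp \<Longrightarrow> (F has_field_derivative f \<tau>) (at \<tau>)"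
    and lim: "(f \<longlongrightarrow> c) at_i_infinity"
    and shift: "\<And>\<tau>. \<tau> \<in> uhp \<Longrightarrow> F (\<tau> + of_real s) = F \<tau> + A"
  shows "A = of_real s * c"
proof -
  have "norm (A - of_real s * c) \<le> 0 + \<epsilon>" if \<epsilon>: "\<epsilon> > 0" for \<epsilon> :: real
  proof -
    define \<delta> where "\<delta> = \<epsilon> / (\<bar>s\<bar> + 1)"
    have \<delta>: "\<delta> > 0" using \<epsilon> by (simp add: \<delta>_def add_nonneg_pos)
    have "eventually (\<lambda>\<tau>. norm (f \<tau> - c) < \<delta>) at_i_infinity"
      using tendstoD[OF lim \<delta>] by (simp add: dist_norm)
    then obtain N where N: "\<And>\<tau>. Im \<tau> > N \<Longrightarrow> norm (f \<tau> - c) < \<delta>"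
      unfolding eventually_filtercomap_at_top_dense by blast
    define S where "S = {\<tau>. Im \<tau> > max N 0}"
    define \<tau>0 where "\<tau>0 = Complex 0 (max N 0 + 1)"
    have conv: "convex S" unfolding S_def by (rule convex_halfspace_Im_gt)
    have in_S: "\<tau>0 \<in> S" "\<tau>0 + of_real s \<in> S" by (auto simp: S_def \<tau>0_def)
    have SU: "\<tau> \<in> uhp" if "\<tau> \<in> S" for \<tau> using that by (auto simp: S_def uhp_def)
    have "norm ((F (\<tau>0 + of_real s) - c * (\<tau>0 + of_real s)) - (F \<tau>0 - c * \<tau>0)) \<le> \<delta> * norm (\<tau>0 + of_real s - \<tau>0)"
    proof (rule field_differentiable_bound[OF conv])
      fix z assume z: "z \<in> S"
      show "((\<lambda>\<tau>. F \<tau> - c * \<tau>) has_field_derivative f z - c) (at z within S)"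
        by (rule has_field_derivative_at_within) (auto intro!: derivative_eq_intros deriv SU[OF z])
      show "norm (f z - c) \<le> \<delta>" using N[of z] z by (auto simp: S_def)
    qed (use in_S in auto)
    also have "(F (\<tau>0 + of_real s) - c * (\<tau>0 + of_real s)) - (F \<tau>0 - c * \<tau>0) = A - of_real s * c"
      using shift[OF SU[OF in_S(1)]] by (simp add: algebra_simps)
    also have "\<delta> * norm (\<tau>0 + of_real s - \<tau>0) = \<epsilon> * (\<bar>s\<bar> / (\<bar>s\<bar> + 1))"
      by (simp add: \<delta>_def)
    also have "\<dots> \<le> \<epsilon> * 1" using \<epsilon> by (intro mult_left_mono) auto
    finally show ?thesis by simp
  qed
  then have "norm (A - of_real s * c) \<le> 0" by (rule field_le_epsilon)
  then show ?thesis by simp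
qed

lemma uhp_constant_difference:
  assumes F: "\<And>\<tau>. \<tau> \<in> uhp \<Longrightarrow> (F has_field_derivative f \<tau>) (at \<tau>)"
    and G: "\<And>\<tau>. \<tau> \<in> uhp \<Longrightarrow> (G has_field_derivative f \<tau>) (at \<tau>)"
  obtains A where "\<And>\<tau>. \<tau> \<in> uhp \<Longrightarrow> F \<tau> = G \<tau> + A"
proof -
  have "((\<lambda>\<tau>. F \<tau> - G \<tau>) has_field_derivative 0) (at \<tau> within uhp)" if "\<tau> \<in> uhp" for \<tau>
    using DERIV_diff[OF F[OF that] G[OF that]] by (auto intro: has_field_derivative_at_within)
  then obtain A where "\<And>\<tau>. \<tau> \<in> uhp \<Longrightarrow> F \<tau> - G \<tau> = A"
    using has_field_derivative_zero_constant[OF convex_uhp] by metis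
  then show ?thesis by (intro that[of A]) (simp add: algebra_simps)
qed

text \<open>The constant terms at the two cusps of a weight two form for the theta group add up to zero, when
weighted by the cusp widths 2 and 1; here the sign of the second one is absorbed in \<open>k\<close>. No fundamental domain is needed: the
half-plane is convex, so \<open>g\<close> has a primitive \<open>G\<close>. It is invariant under \<open>- 1 / \<tau>\<close>, because the
difference is constant and vanishes at the fixed point \<open>\<i>\<close>. It grows by a constant \<open>A\<close> under
\<open>\<tau> + 2\<close>, and hence, by the relation at the cusp, also under \<open>\<tau> - 1\<close> in the coordinate
\<open>1 - 1 / \<tau>\<close>. Comparing with the constant terms computes \<open>A\<close> in two ways. The polar terms at
infinity do not matter since their primitives are periodic.\<close>
theorem theta_group_residues:
  fixes g k :: "complex \<Rightarrow> complex"
  assumes hol: "g holomorphic_on uhp"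
    and S: "\<And>\<tau>. \<tau> \<in> uhp \<Longrightarrow> g (- 1 / \<tau>) = \<tau>\<^sup>2 * g \<tau>"
    and T: "\<And>\<tau>. \<tau> \<in> uhp \<Longrightarrow> g (\<tau> + 2) = g \<tau>"
    and cusp: "\<And>\<tau>. \<tau> \<in> uhp \<Longrightarrow> g (1 - 1 / \<tau>) = - (\<tau>\<^sup>2 * k \<tau>)"
    and lim_cusp: "(k \<longlongrightarrow> K) at_i_infinity"
    and lim_inf: "((\<lambda>\<tau>. g \<tau> - \<alpha> / nome \<tau> ^ 2 - \<beta> / nome \<tau>) \<longlongrightarrow> \<gamma>) at_i_infinity"
  shows "2 * \<gamma> = K"
proof -
  obtain G where "\<And>\<tau>. \<tau> \<in> uhp \<Longrightarrow> (G has_field_derivative g \<tau>) (at \<tau> within uhp)"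
    using holomorphic_convex_primitive'[OF convex_uhp open_uhp hol] by blast
  then have G: "(G has_field_derivative g \<tau>) (at \<tau>)" if "\<tau> \<in> uhp" for \<tau>
    using that by (metis at_within_open open_uhp)
  have GS: "G (- 1 / \<tau>) = G \<tau>" if \<tau>: "\<tau> \<in> uhp" for \<tau>
  proof -
    have 1: "((\<lambda>\<tau>. G (- 1 / \<tau>)) has_field_derivative g \<tau>) (at \<tau>)" if "\<tau> \<in> uhp" for \<tau>
    proof -
      have nz: "\<tau> \<noteq> 0" using that by (rule uhp_not_zero)
      have "((\<lambda>\<tau>. - 1 / \<tau>) has_field_derivative 1 / \<tau>\<^sup>2) (at \<tau>)"
        using nz by (auto intro!: derivative_eq_intros simp: power2_eq_square)
      from DERIV_chain2[OF G[OF uhp_inversion[OF that]] this]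
      show ?thesis using nz by (simp only: S[OF that]) simp
    qed
    obtain A where A: "\<And>\<tau>. \<tau> \<in> uhp \<Longrightarrow> G (- 1 / \<tau>) = G \<tau> + A"
      using uhp_constant_difference[OF 1 G] by blast
    have "- 1 / \<i> = \<i>" by (simp add: field_simps)
    then have "A = 0" using A[of \<i>] by (simp add: uhp_def)
    then show ?thesis using A[OF \<tau>] by simp
  qed
  have "((\<lambda>\<tau>. G (\<tau> + 2)) has_field_derivative g \<tau>) (at \<tau>)" if "\<tau> \<in> uhp" for \<tau>
  proof -
    have u: "\<tau> + 2 \<in> uhp" using that by (simp add: uhp_def)
    have "((\<lambda>\<tau>. \<tau> + 2) has_field_derivative 1) (at \<tau>)"
      by (auto intro!: derivative_eq_intros)
    from DERIV_chain2[where f = G and g = "\<lambda>\<tau>. \<tau> + 2", OF G[OF u] this]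
    show ?thesis by (simp add: T[OF that])
  qed
  then obtain A where A: "\<And>\<tau>. \<tau> \<in> uhp \<Longrightarrow> G (\<tau> + 2) = G \<tau> + A"
    using uhp_constant_difference[OF _ G] by blast
  have "A = of_real (- 1) * (- K)"
  proof (rule primitive_increment[where F = "\<lambda>\<tau>. G (1 - 1 / \<tau>)" and f = "\<lambda>\<tau>. - k \<tau>"])
    fix \<tau> assume \<tau>: "\<tau> \<in> uhp"
    have nz: "\<tau> \<noteq> 0" using \<tau> by (rule uhp_not_zero)
    have "((\<lambda>\<tau>. 1 - 1 / \<tau>) has_field_derivative 1 / \<tau>\<^sup>2) (at \<tau>)"
      using nz by (auto intro!: derivative_eq_intros simp: power2_eq_square)
    from DERIV_chain2[OF G[OF uhp_cusp[OF \<tau>]] this]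
    show "((\<lambda>\<tau>. G (1 - 1 / \<tau>)) has_field_derivative - k \<tau>) (at \<tau>)"
      using nz by (simp only: cusp[OF \<tau>]) simp
    have "G (1 - 1 / (\<tau> - 1)) = G (- 1 / (1 - 1 / \<tau>)) + A"
      unfolding cusp_relation[OF \<tau>, symmetric] by (rule A[OF uhp_inversion[OF uhp_cusp[OF \<tau>]]])
    then show "G (1 - 1 / (\<tau> + of_real (- 1))) = G (1 - 1 / \<tau>) + A"
      using GS[OF uhp_cusp[OF \<tau>]] by simp
  qed (intro tendsto_minus lim_cusp)
  moreover have "A = of_real 2 * \<gamma>"
  proof (rule primitive_increment[where f = "\<lambda>\<tau>. g \<tau> - \<alpha> / nome \<tau> ^ 2 - \<beta> / nome \<tau>"
        and F = "\<lambda>\<tau>. G \<tau> + \<alpha> / (2 * \<i> * pi) * exp (- (2 * \<i> * pi * \<tau>)) + \<beta> / (\<i> * pi) * exp (- (\<i> * pi * \<tau>))"])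
    fix \<tau> assume \<tau>: "\<tau> \<in> uhp"
    have e: "\<alpha> / nome \<tau> ^ 2 = \<alpha> * exp (- (2 * \<i> * pi * \<tau>))" "\<beta> / nome \<tau> = \<beta> * exp (- (\<i> * pi * \<tau>))"
      by (simp_all add: nome_def exp_minus divide_inverse exp_of_nat_mult[symmetric] mult_ac)
    show "((\<lambda>\<tau>. G \<tau> + \<alpha> / (2 * \<i> * pi) * exp (- (2 * \<i> * pi * \<tau>)) + \<beta> / (\<i> * pi) * exp (- (\<i> * pi * \<tau>)))
        has_field_derivative g \<tau> - \<alpha> / nome \<tau> ^ 2 - \<beta> / nome \<tau>) (at \<tau>)"
      unfolding e by (rule derivative_eq_intros G[OF \<tau>] refl | simp)+
    have p: "exp (- (2 * \<i> * pi * (\<tau> + 2))) = exp (- (2 * \<i> * pi * \<tau>))" "exp (- (\<i> * pi * (\<tau> + 2))) = exp (- (\<i> * pi * \<tau>))"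
    proof -
      have "exp (- (2 * \<i> * pi * (\<tau> + 2))) = exp (- (2 * \<i> * pi * \<tau>)) * exp (\<i> * pi * complex_of_real (- 4))"
        "exp (- (\<i> * pi * (\<tau> + 2))) = exp (- (\<i> * pi * \<tau>)) * exp (\<i> * pi * complex_of_real (- 2))"
        by (simp_all add: exp_add[symmetric] algebra_simps)
      then show "exp (- (2 * \<i> * pi * (\<tau> + 2))) = exp (- (2 * \<i> * pi * \<tau>))" "exp (- (\<i> * pi * (\<tau> + 2))) = exp (- (\<i> * pi * \<tau>))"
        using exp_i_pi_int_even[of "- 4" "- 2"] exp_i_pi_int_even[of "- 2" "- 1"] by simp_all
    qed
    show "G (\<tau> + of_real 2) + \<alpha> / (2 * \<i> * pi) * exp (- (2 * \<i> * pi * (\<tau> + of_real 2))) + \<beta> / (\<i> * pi) * exp (- (\<i> * pi * (\<tau> + of_real 2)))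
      = G \<tau> + \<alpha> / (2 * \<i> * pi) * exp (- (2 * \<i> * pi * \<tau>)) + \<beta> / (\<i> * pi) * exp (- (\<i> * pi * \<tau>)) + A"
      using A[OF \<tau>] p by simp
  qed (rule lim_inf)
  ultimately show ?thesis by simp
qed

section \<open>The number of roots\<close>

lemma even_card_involution:
  assumes "finite X" "\<And>x. x \<in> X \<Longrightarrow> h x \<in> X" "\<And>x. x \<in> X \<Longrightarrow> h (h x) = x" "\<And>x. x \<in> X \<Longrightarrow> h x \<noteq> x"
  shows "even (card X)"
  using assms
proof (induction "card X" arbitrary: X rule: less_induct)
  case less
  show ?case
  proof (cases "X = {}")
    case False
    then obtain x where x: "x \<in> X" by blast
    define Y where "Y = X - {x, h x}"
    have hx: "h x \<in> X" "h x \<noteq> x" using less.prems x by auto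
    have X: "X = insert x (insert (h x) Y)" using x hx by (auto simp: Y_def)
    have fin: "finite Y" using less.prems by (simp add: Y_def)
    have notin: "x \<notin> insert (h x) Y" "h x \<notin> Y" using hx by (auto simp: Y_def)
    have c: "card X = Suc (Suc (card Y))"
      by (subst X) (use fin notin in simp)
    have "even (card Y)"
    proof (rule less.hyps)
      fix y assume y: "y \<in> Y"
      then have yX: "y \<in> X" "y \<noteq> x" "y \<noteq> h x" by (auto simp: Y_def)
      have "h y \<noteq> x" using less.prems(3)[OF yX(1)] yX(3) by auto
      moreover have "h y \<noteq> h x" using less.prems(3)[OF yX(1)] less.prems(3)[OF x] yX(2) by metis
      ultimately show "h y \<in> Y" using less.prems(2)[OF yX(1)] by (simp add: Y_def)
      show "h (h y) = y" "h y \<noteq> y" using less.prems yX by auto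
    qed (use c fin in auto)
    then show ?thesis using c by simp
  qed simp
qed

lemma jet2_eq_rhs: "jet2 f a b c \<Longrightarrow> a = a' \<Longrightarrow> b = b' \<Longrightarrow> c = c' \<Longrightarrow> jet2 f a' b' c'"
  by simp

text \<open>The automorphy factors \<open>s\<close>, square roots of \<open>- \<i> \<tau>\<close>, of the theta functions below collect to a
fourth power, that is to weight two.\<close>
lemma weight_two_scaling:
  fixes s a p d y z :: complex
  assumes "s \<noteq> 0"
  shows "(s ^ n * a) * (s * p) ^ 16 * (s ^ 4 * d) / ((s * p) ^ n * ((s * y) * (s * z)) ^ 8) =
    s ^ 4 * (a * p ^ 16 * d / (p ^ n * (y * z) ^ 8))"
proof -
  define X where "X = s ^ n * (s ^ 8 * s ^ 8)"
  have X: "X \<noteq> 0" using assms by (simp add: X_def)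
  have "s ^ 16 = s ^ 8 * s ^ 8" by (simp flip: power_add)
  then have num: "(s ^ n * a) * (s * p) ^ 16 * (s ^ 4 * d) = X * (s ^ 4 * (a * p ^ 16 * d))"
    by (simp only: X_def power_mult_distrib mult_ac)
  have den: "(s * p) ^ n * ((s * y) * (s * z)) ^ 8 = X * (p ^ n * (y * z) ^ 8)"
    by (simp only: X_def power_mult_distrib mult_ac)
  show ?thesis unfolding num den using X by simp
qed

text \<open>The weight two form \<open>g\<close> is the theta function of \<open>L\<close> times
\<open>\<theta>\<^sub>3 ^ (16 - n) * (\<theta>\<^sub>2 * \<theta>\<^sub>4) ^ (- 8) * (\<theta>\<^sub>4 ^ 4 - \<theta>\<^sub>2 ^ 4)\<close>. The factor multiplying the theta function
has a double pole in the nome at infinity, so that the constant term there sees exactly the vectors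
of norm at most 2. At the cusp 1 it has a pole of order \<open>(n - 16) / 4\<close>, and for rank at most 23 the
shadow has no vectors of smaller norm: its norms are congruent to \<open>n / 4\<close> modulo 2 and not negative.
Hence the constant term at the cusp 1 counts the shadow vectors of norm \<open>(n - 16) / 4\<close>.\<close>
theorem root_count_formula:
  fixes L :: "'a::euclidean_space set"
  assumes L: "self_dual_lattice L"
    and u: "u \<in> L"
    and char: "\<And>v. v \<in> L \<Longrightarrow> \<exists>k::int. v \<bullet> v - v \<bullet> u = 2 * of_int k"
    and no1: "\<And>v. v \<in> L \<Longrightarrow> v \<bullet> v \<noteq> 1"
    and n: "DIM('a) \<le> 23"
  shows "real (card {v \<in> L. v \<bullet> v = 2}) - 2 * real DIM('a) * (23 - real DIM('a)) =
    2 ^ 24 / 2 ^ DIM('a) * real (card {v \<in> L. (v + (1/2) *\<^sub>R u) \<bullet> (v + (1/2) *\<^sub>R u) = (real DIM('a) - 16) / 4})"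
proof -
  let ?n = "DIM('a)"
  let ?s = "\<lambda>v. (v + (1/2) *\<^sub>R u) \<bullet> (v + (1/2) *\<^sub>R u)"
  let ?S = "theta L ((1/2) *\<^sub>R u)"
  define \<kappa> where "\<kappa> = (real ?n - 16) / 4"
  define N where "N = card {v \<in> L. v \<bullet> v = 2}"
  define M where "M = card {v \<in> L. ?s v = \<kappa>}"
  define g where "g = (\<lambda>\<tau>. theta L 0 \<tau> * \<theta>\<^sub>3 \<tau> ^ 16 * (\<theta>\<^sub>4 \<tau> ^ 4 - \<theta>\<^sub>2 \<tau> ^ 4) / (\<theta>\<^sub>3 \<tau> ^ ?n * (\<theta>\<^sub>2 \<tau> * \<theta>\<^sub>4 \<tau>) ^ 8))"
  define k where "k = (\<lambda>\<tau>. ?S \<tau> * \<theta>\<^sub>2 \<tau> ^ 16 * (\<theta>\<^sub>3 \<tau> ^ 4 + \<theta>\<^sub>4 \<tau> ^ 4) / (\<theta>\<^sub>2 \<tau> ^ ?n * (\<theta>\<^sub>3 \<tau> * \<theta>\<^sub>4 \<tau>) ^ 8))"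
  note nz = \<theta>\<^sub>2_nonzero \<theta>\<^sub>3_nonzero \<theta>\<^sub>4_nonzero
  have s4: "csqrt (- \<i> * \<tau>) ^ 4 = - (\<tau>\<^sup>2)" for \<tau>
  proof -
    have "x ^ 4 = (x\<^sup>2)\<^sup>2" for x :: complex
      by (simp add: power4_eq_xxxx power2_eq_square mult.assoc)
    then have "csqrt (- \<i> * \<tau>) ^ 4 = (- \<i> * \<tau>)\<^sup>2" by (simp only: power2_csqrt)
    also have "\<dots> = - (\<tau>\<^sup>2)" by (simp add: power_mult_distrib)
    finally show ?thesis .
  qed
  \<comment> \<open>\<open>k\<close> is, up to the factor \<open>- (\<tau>\<^sup>2)\<close>, the form \<open>g\<close> in the coordinate at the cusp 1.\<close>
  have hol: "g holomorphic_on uhp"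
    unfolding g_def
    by (intro holomorphic_intros theta_holomorphic[OF L] jacobi_holomorphic) (use nz in simp)
  have S: "g (- 1 / \<tau>) = \<tau>\<^sup>2 * g \<tau>" if \<tau>: "\<tau> \<in> uhp" for \<tau>
  proof -
    define s where "s = csqrt (- \<i> * \<tau>)"
    have s: "s \<noteq> 0" "\<tau>\<^sup>2 = - (s ^ 4)" using csqrt_neq_0[OF \<tau>] s4[of \<tau>] by (simp_all add: s_def)
    have "g (- 1 / \<tau>) = (s ^ ?n * theta L 0 \<tau>) * (s * \<theta>\<^sub>3 \<tau>) ^ 16 * ((s * \<theta>\<^sub>2 \<tau>) ^ 4 - (s * \<theta>\<^sub>4 \<tau>) ^ 4) /
        ((s * \<theta>\<^sub>3 \<tau>) ^ ?n * ((s * \<theta>\<^sub>4 \<tau>) * (s * \<theta>\<^sub>2 \<tau>)) ^ 8)"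
      unfolding g_def jacobi_inversion[OF \<tau>] theta_inversion[OF L \<tau>] theta_char_0 s_def ..
    also have "(s * \<theta>\<^sub>2 \<tau>) ^ 4 - (s * \<theta>\<^sub>4 \<tau>) ^ 4 = s ^ 4 * (\<theta>\<^sub>2 \<tau> ^ 4 - \<theta>\<^sub>4 \<tau> ^ 4)"
      by (simp add: power_mult_distrib right_diff_distrib)
    also have "(s ^ ?n * theta L 0 \<tau>) * (s * \<theta>\<^sub>3 \<tau>) ^ 16 * \<dots> / ((s * \<theta>\<^sub>3 \<tau>) ^ ?n * ((s * \<theta>\<^sub>4 \<tau>) * (s * \<theta>\<^sub>2 \<tau>)) ^ 8) =
        s ^ 4 * (theta L 0 \<tau> * \<theta>\<^sub>3 \<tau> ^ 16 * (\<theta>\<^sub>2 \<tau> ^ 4 - \<theta>\<^sub>4 \<tau> ^ 4) / (\<theta>\<^sub>3 \<tau> ^ ?n * (\<theta>\<^sub>4 \<tau> * \<theta>\<^sub>2 \<tau>) ^ 8))"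
      by (rule weight_two_scaling[OF s(1)])
    also have "\<theta>\<^sub>2 \<tau> ^ 4 - \<theta>\<^sub>4 \<tau> ^ 4 = - (\<theta>\<^sub>4 \<tau> ^ 4 - \<theta>\<^sub>2 \<tau> ^ 4)" by simp
    finally show ?thesis unfolding s(2) g_def
      by (simp only: mult.commute[of "\<theta>\<^sub>4 \<tau>" "\<theta>\<^sub>2 \<tau>"] mult_minus_left mult_minus_right minus_divide_left[symmetric])
  qed
  have T: "g (\<tau> + 2) = g \<tau>" for \<tau>
  proof -
    have e: "\<tau> + 2 = (\<tau> + 1) + 1" by simp
    have "theta L 0 (\<tau> + 2) = theta L 0 \<tau>"
      unfolding e using theta_translate[OF L char] theta_char_translate[OF L char] by metis
    moreover have "\<theta>\<^sub>3 (\<tau> + 2) = \<theta>\<^sub>3 \<tau>" "\<theta>\<^sub>4 (\<tau> + 2) = \<theta>\<^sub>4 \<tau>" "\<theta>\<^sub>2 (\<tau> + 2) = \<i> * \<theta>\<^sub>2 \<tau>"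
      unfolding e jacobi_translate by (simp_all add: mult.assoc[symmetric] cis_mult)
    ultimately show ?thesis by (simp add: g_def power_mult_distrib)
  qed
  have cusp: "g (1 - 1 / \<tau>) = - (\<tau>\<^sup>2 * k \<tau>)" if \<tau>: "\<tau> \<in> uhp" for \<tau>
  proof -
    define s where "s = csqrt (- \<i> * \<tau>)"
    define \<zeta> where "\<zeta> = cis (pi / 4)"
    have s: "s \<noteq> 0" "\<tau>\<^sup>2 = - (s ^ 4)" using csqrt_neq_0[OF \<tau>] s4[of \<tau>] by (simp_all add: s_def)
    have \<zeta>: "\<zeta> ^ 4 = - 1" "\<zeta> ^ 8 = 1"
      unfolding \<zeta>_def Complex.DeMoivre by simp_all
    have th: "theta L 0 (1 - 1 / \<tau>) = s ^ ?n * ?S \<tau>"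
      unfolding s_def by (rule theta_cusp[OF L char \<tau>])
    have "g (1 - 1 / \<tau>) = (s ^ ?n * ?S \<tau>) * (s * \<theta>\<^sub>2 \<tau>) ^ 16 * ((s * \<theta>\<^sub>3 \<tau>) ^ 4 - (\<zeta> * (s * \<theta>\<^sub>4 \<tau>)) ^ 4) /
        ((s * \<theta>\<^sub>2 \<tau>) ^ ?n * ((\<zeta> * (s * \<theta>\<^sub>4 \<tau>)) * (s * \<theta>\<^sub>3 \<tau>)) ^ 8)"
      unfolding g_def th unfolding jacobi_cusp[OF \<tau>] s_def \<zeta>_def ..
    also have "(s * \<theta>\<^sub>3 \<tau>) ^ 4 - (\<zeta> * (s * \<theta>\<^sub>4 \<tau>)) ^ 4 = s ^ 4 * (\<theta>\<^sub>3 \<tau> ^ 4 + \<theta>\<^sub>4 \<tau> ^ 4)"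
      by (simp add: power_mult_distrib \<zeta> distrib_left)
    also have "((\<zeta> * (s * \<theta>\<^sub>4 \<tau>)) * (s * \<theta>\<^sub>3 \<tau>)) ^ 8 = ((s * \<theta>\<^sub>3 \<tau>) * (s * \<theta>\<^sub>4 \<tau>)) ^ 8"
      by (simp add: power_mult_distrib \<zeta> mult_ac)
    also have "(s ^ ?n * ?S \<tau>) * (s * \<theta>\<^sub>2 \<tau>) ^ 16 * (s ^ 4 * (\<theta>\<^sub>3 \<tau> ^ 4 + \<theta>\<^sub>4 \<tau> ^ 4)) /
        ((s * \<theta>\<^sub>2 \<tau>) ^ ?n * ((s * \<theta>\<^sub>3 \<tau>) * (s * \<theta>\<^sub>4 \<tau>)) ^ 8) = s ^ 4 * k \<tau>"
      unfolding k_def by (rule weight_two_scaling[OF s(1)])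
    finally show ?thesis unfolding s(2) by simp
  qed
  have "(k \<longlongrightarrow> 2 ^ 17 / 2 ^ ?n * of_nat M) at_i_infinity"
  proof -
    interpret exp_family L "\<lambda>_. 1" ?s by (rule exp_family_theta[OF L])
    have gap: "?s v = \<kappa> \<or> ?s v \<ge> \<kappa> + 2" if v: "v \<in> L" for v
    proof -
      obtain i :: int where i: "?s v = (u \<bullet> u) / 4 + 2 * of_int i"
        using shadow_norm_cong[OF L char v] by blast
      obtain j :: int where j: "u \<bullet> u = real ?n + 8 * of_int j"
        using characteristic_norm_cong[OF L char] by blast
      define m where "m = i + j + 2"
      have sv: "?s v = \<kappa> + 2 * of_int m" unfolding i j \<kappa>_def m_def by (simp add: field_simps)
      have "?s v \<ge> 0" by simp
      moreover have "\<kappa> < 2" using n unfolding \<kappa>_def by simp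
      ultimately have "m > - 1" unfolding sv by linarith
      then have "m = 0 \<or> m \<ge> 1" by linarith
      then show ?thesis unfolding sv by auto
    qed
    have "((\<lambda>\<tau>. exp (- (\<i> * pi * \<tau> * complex_of_real \<kappa>)) * ?S \<tau>) \<longlongrightarrow> of_nat M) at_i_infinity"
      using leading_coefficient[of 2 L \<kappa>] gap unfolding theta_def M_def by simp
    moreover have "(\<psi> \<longlongrightarrow> 1) at_i_infinity" "(\<theta>\<^sub>3 \<longlongrightarrow> 1) at_i_infinity" "(\<theta>\<^sub>4 \<longlongrightarrow> 1) at_i_infinity"
      using jet2_tendsto jet2_\<psi> jet2_\<theta>\<^sub>3 jet2_\<theta>\<^sub>4 by blast+
    ultimately have "((\<lambda>\<tau>. (exp (- (\<i> * pi * \<tau> * complex_of_real \<kappa>)) * ?S \<tau>) * (2 * \<psi> \<tau>) ^ 16 * (\<theta>\<^sub>3 \<tau> ^ 4 + \<theta>\<^sub>4 \<tau> ^ 4) /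
        ((2 * \<psi> \<tau>) ^ ?n * (\<theta>\<^sub>3 \<tau> * \<theta>\<^sub>4 \<tau>) ^ 8)) \<longlongrightarrow>
        of_nat M * (2 * 1) ^ 16 * (1 ^ 4 + 1 ^ 4) / ((2 * 1) ^ ?n * (1 * 1) ^ 8)) at_i_infinity"
      by (intro tendsto_intros) simp_all
    also have "of_nat M * (2 * 1) ^ 16 * (1 ^ 4 + 1 ^ 4) / ((2 * 1) ^ ?n * (1 * 1) ^ 8) = (2 ^ 17 / 2 ^ ?n * of_nat M :: complex)"
      by simp
    also have "(\<lambda>\<tau>. (exp (- (\<i> * pi * \<tau> * complex_of_real \<kappa>)) * ?S \<tau>) * (2 * \<psi> \<tau>) ^ 16 * (\<theta>\<^sub>3 \<tau> ^ 4 + \<theta>\<^sub>4 \<tau> ^ 4) /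
        ((2 * \<psi> \<tau>) ^ ?n * (\<theta>\<^sub>3 \<tau> * \<theta>\<^sub>4 \<tau>) ^ 8)) = k"
    proof
      fix \<tau>
      let ?E = "exp (\<i> * pi * \<tau> / 4)"
      have "?E ^ 16 = exp (16 * (\<i> * pi * \<tau> / 4))" "?E ^ ?n = exp (of_nat ?n * (\<i> * pi * \<tau> / 4))"
        by (simp_all only: exp_of_nat_mult of_nat_numeral flip: exp_of_nat_mult)
      then have "?E ^ 16 = exp (- (\<i> * pi * \<tau> * complex_of_real \<kappa>)) * ?E ^ ?n"
        by (simp add: exp_add[symmetric] \<kappa>_def field_simps)
      then have "k \<tau> = (?E ^ ?n * ((exp (- (\<i> * pi * \<tau> * complex_of_real \<kappa>)) * ?S \<tau>) * (2 * \<psi> \<tau>) ^ 16 * (\<theta>\<^sub>3 \<tau> ^ 4 + \<theta>\<^sub>4 \<tau> ^ 4))) /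
        (?E ^ ?n * ((2 * \<psi> \<tau>) ^ ?n * (\<theta>\<^sub>3 \<tau> * \<theta>\<^sub>4 \<tau>) ^ 8))"
        unfolding k_def \<theta>\<^sub>2_eq_\<psi> power_mult_distrib[of "2 * \<psi> \<tau>"] by (simp only: mult_ac)
      then show "(exp (- (\<i> * pi * \<tau> * complex_of_real \<kappa>)) * ?S \<tau>) * (2 * \<psi> \<tau>) ^ 16 * (\<theta>\<^sub>3 \<tau> ^ 4 + \<theta>\<^sub>4 \<tau> ^ 4) /
        ((2 * \<psi> \<tau>) ^ ?n * (\<theta>\<^sub>3 \<tau> * \<theta>\<^sub>4 \<tau>) ^ 8) = k \<tau>"
        by simp
    qed
    finally show ?thesis .
  qed
  moreover obtain \<beta> where "((\<lambda>\<tau>. g \<tau> - (1/256) / nome \<tau> ^ 2 - \<beta> / nome \<tau>) \<longlongrightarrow>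
      (of_nat N - 2 * of_nat ?n * (23 - of_nat ?n)) / 256) at_i_infinity"
  proof -
    interpret exp_family L "\<lambda>_. 1" "\<lambda>v. v \<bullet> v" using exp_family_theta[OF L, of 0] by simp
    have int: "v \<bullet> v \<in> \<int>" if "v \<in> L" for v by (rule self_dual_inner[OF L that that])
    have levels: "{v \<in> L. v \<bullet> v = 0} = {0}" "{v \<in> L. v \<bullet> v = 1} = {}"
      using self_dual_zero[OF L] no1 by auto
    from jet2_exp_series[OF int] have jL: "jet2 (theta L 0) 1 0 (of_nat N)"
      unfolding levels by (simp add: theta_def N_def)
    have j44: "jet2 (\<lambda>\<tau>. \<theta>\<^sub>4 \<tau> ^ 4) 1 (- 8) 24"
      using jet2_power[OF jet2_\<theta>\<^sub>4, of 4] by simp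
    have j\<psi>4: "jet2 (\<lambda>\<tau>. \<psi> \<tau> ^ 4) 1 0 4"
      using jet2_power[OF jet2_\<psi>, of 4] by simp
    have j16: "jet2 (\<lambda>\<tau>. 16 * (nome \<tau> * \<psi> \<tau> ^ 4)) 0 16 0"
      using jet2_mult[OF jet2_const[of 16] jet2_mult[OF jet2_nome j\<psi>4]] by simp
    have jW: "jet2 (\<lambda>\<tau>. \<theta>\<^sub>4 \<tau> ^ 4 - 16 * (nome \<tau> * \<psi> \<tau> ^ 4)) 1 (- 24) 24"
      using jet2_diff[OF j44 j16] by simp
    have j316: "jet2 (\<lambda>\<tau>. \<theta>\<^sub>3 \<tau> ^ 16) 1 32 480"
      using jet2_power[OF jet2_\<theta>\<^sub>3, of 16] by simp
    have j3n: "jet2 (\<lambda>\<tau>. \<theta>\<^sub>3 \<tau> ^ ?n) 1 (of_nat ?n * 2) (2 * of_nat ?n * (of_nat ?n - 1))"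
      by (rule jet2_eq_rhs[OF jet2_power[OF jet2_\<theta>\<^sub>3, of ?n]]) (simp_all add: field_simps)
    have j\<psi>8: "jet2 (\<lambda>\<tau>. \<psi> \<tau> ^ 8) 1 0 8"
      using jet2_power[OF jet2_\<psi>, of 8] by simp
    have j48: "jet2 (\<lambda>\<tau>. \<theta>\<^sub>4 \<tau> ^ 8) 1 (- 16) 112"
      using jet2_power[OF jet2_\<theta>\<^sub>4, of 8] by simp
    have jD: "jet2 (\<lambda>\<tau>. \<theta>\<^sub>3 \<tau> ^ ?n * (\<psi> \<tau> ^ 8 * \<theta>\<^sub>4 \<tau> ^ 8)) 1 (2 * of_nat ?n - 16) (120 - 32 * of_nat ?n + 2 * of_nat ?n * (of_nat ?n - 1))"
      by (rule jet2_eq_rhs[OF jet2_mult[OF j3n jet2_mult[OF j\<psi>8 j48]]]) (simp_all add: field_simps)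
    define \<beta> where "\<beta> = 24 - 2 * complex_of_nat ?n"
    have j: "jet2 (\<lambda>\<tau>. theta L 0 \<tau> * \<theta>\<^sub>3 \<tau> ^ 16 * ((\<theta>\<^sub>4 \<tau> ^ 4 - 16 * (nome \<tau> * \<psi> \<tau> ^ 4)) * (1 / (\<theta>\<^sub>3 \<tau> ^ ?n * (\<psi> \<tau> ^ 8 * \<theta>\<^sub>4 \<tau> ^ 8)))))
       1 \<beta> (of_nat N - 2 * of_nat ?n * (23 - of_nat ?n))"
      by (rule jet2_eq_rhs[OF jet2_mult[OF jet2_mult[OF jL j316] jet2_mult[OF jW jet2_inverse[OF jD]]]])
         (simp_all add: \<beta>_def field_simps power2_eq_square)
    have gq: "g \<tau> = theta L 0 \<tau> * \<theta>\<^sub>3 \<tau> ^ 16 * ((\<theta>\<^sub>4 \<tau> ^ 4 - 16 * (nome \<tau> * \<psi> \<tau> ^ 4)) * (1 / (\<theta>\<^sub>3 \<tau> ^ ?n * (\<psi> \<tau> ^ 8 * \<theta>\<^sub>4 \<tau> ^ 8)))) / (256 * nome \<tau> ^ 2)" for \<tau>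
    proof -
      have "\<theta>\<^sub>2 \<tau> ^ 8 = (\<theta>\<^sub>2 \<tau> ^ 4) ^ 2" by (simp flip: power_mult)
      also have "\<dots> = 256 * nome \<tau> ^ 2 * \<psi> \<tau> ^ 8"
        unfolding \<theta>\<^sub>2_power_4 by (simp add: power_mult_distrib flip: power_mult)
      finally show ?thesis
        unfolding g_def power_mult_distrib \<theta>\<^sub>2_power_4 by (simp add: mult_ac)
    qed
    have "((\<lambda>\<tau>. (theta L 0 \<tau> * \<theta>\<^sub>3 \<tau> ^ 16 * ((\<theta>\<^sub>4 \<tau> ^ 4 - 16 * (nome \<tau> * \<psi> \<tau> ^ 4)) * (1 / (\<theta>\<^sub>3 \<tau> ^ ?n * (\<psi> \<tau> ^ 8 * \<theta>\<^sub>4 \<tau> ^ 8)))) - 1 - \<beta> * nome \<tau>) / nome \<tau> ^ 2 / 256)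
       \<longlongrightarrow> (of_nat N - 2 * of_nat ?n * (23 - of_nat ?n)) / 256) at_i_infinity"
      using j unfolding jet2_def by (intro tendsto_intros) simp_all
    also have "(\<lambda>\<tau>. (theta L 0 \<tau> * \<theta>\<^sub>3 \<tau> ^ 16 * ((\<theta>\<^sub>4 \<tau> ^ 4 - 16 * (nome \<tau> * \<psi> \<tau> ^ 4)) * (1 / (\<theta>\<^sub>3 \<tau> ^ ?n * (\<psi> \<tau> ^ 8 * \<theta>\<^sub>4 \<tau> ^ 8)))) - 1 - \<beta> * nome \<tau>) / nome \<tau> ^ 2 / 256)
      = (\<lambda>\<tau>. g \<tau> - (1/256) / nome \<tau> ^ 2 - (\<beta> / 256) / nome \<tau>)"
      unfolding gq by (simp add: diff_divide_distrib power2_eq_square mult_ac)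
    finally show ?thesis by (rule that)
  qed
  ultimately have eq: "2 * ((of_nat N - 2 * of_nat ?n * (23 - of_nat ?n)) / 256) = (2 ^ 17 / 2 ^ ?n * of_nat M :: complex)"
    using theta_group_residues[OF hol S T cusp] by blast
  have "complex_of_real (real N - 2 * real ?n * (23 - real ?n)) =
      128 * (2 * ((of_nat N - 2 * of_nat ?n * (23 - of_nat ?n)) / 256))" by simp
  also have "\<dots> = complex_of_real (2 ^ 24 / 2 ^ ?n * real M)"
    unfolding eq by simp
  finally have "complex_of_real (real N - 2 * real ?n * (23 - real ?n)) = complex_of_real (2 ^ 24 / 2 ^ ?n * real M)" .
  then have "real N - 2 * real ?n * (23 - real ?n) = 2 ^ 24 / 2 ^ ?n * real M"
    by (simp only: of_real_eq_iff)
  then show ?thesis unfolding N_def M_def \<kappa>_def .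
qed

theorem mainTheorem4:
  fixes L :: "(real ^ 'n::finite) set" and n N2 :: nat
  assumes "n = CARD('n)"
    and "integral_unimodular_lattice L"
    and "vectors_of_norm L 1 = {}"
    and "\<not> (even_lattice L \<and> n = 16)"
    and "N2 = card (vectors_of_norm L 2)"
  shows "\<exists>k::int. real N2 - 2 * real n * (23 - real n) = real_of_int k * 2 powi (25 - int n)"
proof -
  have dim: "DIM(real ^ 'n) = n" using assms(1) by simp
  have L: "self_dual_lattice L"
    using assms(1,2) by (simp add: self_dual_lattice_def integral_unimodular_lattice_def)
  have N2: "N2 = card {v \<in> L. v \<bullet> v = 2}" using assms(5) by (simp add: vectors_of_norm_def)
  consider "n \<ge> 25" | "n = 24" | "n \<le> 23" by linarith
  then show ?thesis
  proof cases
    case 1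
    have "int n - 25 = int (n - 25)" using 1 by simp
    then have p: "2 powi (25 - int n) = (1 / 2 ^ (n - 25) :: real)"
      by (metis minus_diff_eq power_int_minus power_int_of_nat inverse_eq_divide)
    show ?thesis
      unfolding p
      by (rule exI[of _ "(int N2 - 2 * int n * (23 - int n)) * 2 ^ (n - 25)"]) simp
  next
    case 2
    interpret exp_family L "\<lambda>_. 1" "\<lambda>v. (v + 0) \<bullet> (v + 0)" by (rule exp_family_theta[OF L])
    have "even N2"
      unfolding N2
    proof (rule even_card_involution[where h = uminus])
      show "finite {v \<in> L. v \<bullet> v = 2}" using finite_level[of 2] by simp
    next
      fix v assume v: "v \<in> {v \<in> L. v \<bullet> v = 2}"
      then show "- v \<in> {v \<in> L. v \<bullet> v = 2}" using self_dual_uminus[OF L] by simp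
      show "- v \<noteq> v"
      proof
        assume "- v = v"
        then have "v + v = 0" by (metis add.right_inverse)
        then have "2 *\<^sub>R v = 0" by (simp only: scaleR_2)
        then show False using v by simp
      qed
    qed simp
    then obtain m where "N2 = 2 * m" by (rule evenE)
    then show ?thesis using 2 by (intro exI[of _ "int m + 24"]) simp
  next
    case 3
    obtain u where u: "u \<in> L" and char: "\<And>v. v \<in> L \<Longrightarrow> \<exists>k::int. v \<bullet> v - v \<bullet> u = 2 * of_int k"
      using characteristic_vector_exists[OF L] by blast
    let ?s = "\<lambda>v. (v + (1/2) *\<^sub>R u) \<bullet> (v + (1/2) *\<^sub>R u)"
    let ?M = "{v \<in> L. ?s v = (real n - 16) / 4}"
    interpret exp_family L "\<lambda>_. 1" ?s by (rule exp_family_theta[OF L])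
    have "even (card ?M)"
    proof (rule even_card_involution[where h = "\<lambda>v. - u - v"])
      show "finite ?M" by (rule finite_level)
    next
      fix v assume v: "v \<in> ?M"
      have "- u - v + (1/2) *\<^sub>R u = - (v + (1/2) *\<^sub>R u)"
        using scaleR_2[of "(1/2) *\<^sub>R u"] by (simp add: algebra_simps)
      then have "?s (- u - v) = ?s v" by (simp only: inner_minus_left inner_minus_right minus_minus)
      moreover have "- u - v \<in> L"
        using self_dual_add[OF L self_dual_uminus[OF L u] self_dual_uminus[OF L, of v]] v by simp
      ultimately show "- u - v \<in> ?M" using v by simp
      show "- u - v \<noteq> v"
      proof
        assume "- u - v = v"
        then have "- u = v + v" by (simp only: diff_eq_eq)
        then have uv: "u = - (2 *\<^sub>R v)" by (metis minus_minus scaleR_2)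
        then have "v + (1/2) *\<^sub>R u = 0" by simp
        then have "n = 16" using v by simp
        moreover have "even_lattice L"
          unfolding even_lattice_def
        proof
          fix w assume w: "w \<in> L"
          obtain k :: int where "w \<bullet> w - w \<bullet> u = 2 * of_int k" using char[OF w] by blast
          moreover obtain m where "w \<bullet> v = of_int m"
            using self_dual_inner[OF L w, of v] v by (auto elim: Ints_cases)
          ultimately have "w \<bullet> w = of_int (2 * (k - m))" by (simp add: uv)
          then show "\<exists>k::int. even k \<and> w \<bullet> w = real_of_int k" by (intro exI[of _ "2 * (k - m)"]) simp
        qed
        ultimately show False using assms(4) by blast
      qed
    qed simp
    then obtain m where m: "card ?M = 2 * m" by (rule evenE)
    have no1: "v \<bullet> v \<noteq> 1" if "v \<in> L" for v using assms(3) that by (auto simp: vectors_of_norm_def)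
    have "real N2 - 2 * real n * (23 - real n) = 2 ^ 24 / 2 ^ n * real (card ?M)"
      using root_count_formula[OF L u char no1] 3 unfolding dim N2 by blast
    also have "\<dots> = real_of_int (int m) * (2 ^ 25 / 2 ^ n)" unfolding m by simp
    also have "2 ^ 25 / 2 ^ n = (2 powi (25 - int n) :: real)"
      by (subst power_int_diff) simp_all
    finally show ?thesis by blast
  qed
qed

end
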